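(* Let $d\in\{1,2,3\}$. There exists a universal constant $C_d>0$ (depending only on $d$) such that for every complex-valued potential $V\in L^1(\mathbb{R}^d)$, $$\sigma_{\mathrm p}(H_V)\subset\left\{\lambda\in\mathbb{C}:\ |\lambda|\le C_d\,\|V\|_{L^1(\mathbb{R}^d)}^{4/(4-d)}\right\},$$ where $H_V=\Delta^2\dot{+}V$ in $L^2(\mathbb{R}^d)$. Moreover, one can take $C_1=\frac14$ for $d=1$ and $C_3=\frac14\,\frac{1}{(4\pi)^4}$ for $d=3$.
   Context: All function spaces are complex-valued. Let $V:\mathbb{R}^d\to\mathbb{C}$ be measurable and such that there exist $a\in(0,1)$ and $b\in\mathbb{R}$ with $\int_{\mathbb{R}^d}|V||\psi|^2\le a\int_{\mathbb{R}^d}|\Delta\psi|^2+b\int_{\mathbb{R}^d}|\psi|^2$ for all $\psi\in H^2(\mathbb{R}^d)$. (Every $V\in L^1(\mathbb{R}^d)$ with $d\le 3$ satisfies this.) The operator $H_V=\Delta^2\dot{+}V$ is the m-sectorial operator in $L^2(\mathbb{R}^d)$ associated, via the representation theorem, with the closed sectorial form $h_V(\varphi,\psi)=\int_{\mathbb{R}^d}\overline{\Delta\varphi}\,\Delta\psi+\int_{\mathbb{R}^d}V\,\overline{\varphi}\,\psi$ with form domain $H^2(\mathbb{R}^d)$. That is, $\psi\in H^2(\mathbb{R}^d)$ belongs to the domain of $H_V$ with $H_V\psi=f\in L^2(\mathbb{R}^d)$ if and only if $h_V(\varphi,\psi)=\int_{\mathbb{R}^d}\overline{\varphi}f$ for all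 $\varphi\in H^2(\mathbb{R}^d)$. The point spectrum $\sigma_{\mathrm p}(H_V)$ is the set of all eigenvalues $\lambda\in\mathbb{C}$ of $H_V$ (including those lying in $[0,+\infty)$). *)

theory Defs
  imports "HOL-Analysis.Analysis"
begin

definition partial_deriv :: "'n::finite \<Rightarrow> (real ^ 'n \<Rightarrow> complex) \<Rightarrow> real ^ 'n \<Rightarrow> complex" where
  "partial_deriv i f = (\<lambda>x. frechet_derivative f (at x) (axis i 1))"

primrec C_diff :: "nat \<Rightarrow> (real ^ 'n::finite \<Rightarrow> complex) \<Rightarrow> bool" where
  "C_diff 0 f \<longleftrightarrow> continuous_on UNIV f"
| "C_diff (Suc k) f \<longleftrightarrow> f differentiable_on UNIV \<and> (\<forall>i. C_diff k (partial_deriv i f))"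

definition test_functions :: "(real ^ 'n::finite \<Rightarrow> complex) set" where
  "test_functions = {\<phi>. (\<forall>k. C_diff k \<phi>) \<and> compact (closure {x. \<phi> x \<noteq> 0})}"

text \<open>Elements of Lebesgue and Sobolev spaces are represented by functions rather than by
  classes modulo equality almost everywhere; all notions below respect that equality.\<close>

definition L2 :: "(real ^ 'n::finite \<Rightarrow> complex) set" where
  "L2 = {f. f \<in> borel_measurable lebesgue \<and> integrable lebesgue (\<lambda>x. (cmod (f x))\<^sup>2)}"

definition L1_norm :: "(real ^ 'n::finite \<Rightarrow> complex) \<Rightarrow> real" where
  "L1_norm V = (LINT x|lebesgue. cmod (V x))"

definition has_weak_partial :: "'n::finite \<Rightarrow> (real ^ 'n \<Rightarrow> complex) \<Rightarrow> (real ^ 'n \<Rightarrow> complex) \<Rightarrow> bool" where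
  "has_weak_partial i f g \<longleftrightarrow> f \<in> L2 \<and> g \<in> L2 \<and>
    (\<forall>\<phi>\<in>test_functions.
       (LINT x|lebesgue. f x * partial_deriv i \<phi> x) = - (LINT x|lebesgue. g x * \<phi> x))"

primrec sobolev :: "nat \<Rightarrow> (real ^ 'n::finite \<Rightarrow> complex) set" where
  "sobolev 0 = L2"
| "sobolev (Suc k) = {f \<in> L2. \<forall>i. \<exists>g\<in>sobolev k. has_weak_partial i f g}"

abbreviation H2 :: "(real ^ 'n::finite \<Rightarrow> complex) set" where
  "H2 \<equiv> sobolev 2"

text \<open>A weak derivative is unique only up to a null set, so a representative is chosen; the
  choice does not affect the integrals in which it occurs.\<close>

definition weak_partial :: "'n::finite \<Rightarrow> (real ^ 'n \<Rightarrow> complex) \<Rightarrow> real ^ 'n \<Rightarrow> complex" where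
  "weak_partial i f = (SOME g. has_weak_partial i f g)"

definition laplacian :: "(real ^ 'n::finite \<Rightarrow> complex) \<Rightarrow> real ^ 'n \<Rightarrow> complex" where
  "laplacian f = (\<lambda>x. \<Sum>i\<in>UNIV. weak_partial i (weak_partial i f) x)"

definition form_h :: "(real ^ 'n::finite \<Rightarrow> complex) \<Rightarrow> (real ^ 'n \<Rightarrow> complex) \<Rightarrow>
    (real ^ 'n \<Rightarrow> complex) \<Rightarrow> complex" where
  "form_h V \<phi> \<psi> = (LINT x|lebesgue. cnj (laplacian \<phi> x) * laplacian \<psi> x)
                 + (LINT x|lebesgue. V x * cnj (\<phi> x) * \<psi> x)"

text \<open>The graph of the operator associated with the form: \<open>\<psi>\<close> is in the domain and is mapped
  to \<open>f\<close>. If \<open>V\<close> is integrable and the dimension is at most 3, then elements of \<open>H2\<close> are essentially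
  bounded, so the potential term of the form is a convergent integral.\<close>

definition operator_graph :: "(real ^ 'n::finite \<Rightarrow> complex) \<Rightarrow>
    ((real ^ 'n \<Rightarrow> complex) \<times> (real ^ 'n \<Rightarrow> complex)) set" where
  "operator_graph V = {(\<psi>, f). \<psi> \<in> H2 \<and> f \<in> L2 \<and>
     (\<forall>\<phi>\<in>H2. form_h V \<phi> \<psi> = (LINT x|lebesgue. cnj (\<phi> x) * f x))}"

definition point_spectrum :: "(real ^ 'n::finite \<Rightarrow> complex) \<Rightarrow> complex set" where
  "point_spectrum V = {z. \<exists>\<psi>. \<not> (AE x in lebesgue. \<psi> x = 0) \<and>
     (\<psi>, \<lambda>x. z * \<psi> x) \<in> operator_graph V}"

end

theory Submission
  imports Defs "HOL-Computational_Algebra.Polynomial" "HOL-Real_Asymp.Real_Asymp"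
begin

text \<open>
  If \<open>\<Delta>\<^sup>2 \<psi> + V \<psi> = z \<psi>\<close> and \<open>G\<close> is a fundamental solution of \<open>\<Delta>\<^sup>2 - z\<close>, then \<open>\<psi> = - G * (V \<psi>)\<close>. Hence
  \<open>\<parallel>\<psi>\<parallel>\<^sub>\<infinity> \<le> \<parallel>G\<parallel>\<^sub>\<infinity> \<parallel>V\<parallel>\<^sub>1 \<parallel>\<psi>\<parallel>\<^sub>\<infinity>\<close>, and a nonzero bounded \<open>\<psi>\<close> forces \<open>1 \<le> \<parallel>G\<parallel>\<^sub>\<infinity> \<parallel>V\<parallel>\<^sub>1\<close>. In dimensions 1, 2 and 3 the singularity
  of \<open>G\<close> is weak enough for \<open>G\<close> to be bounded. With \<open>z = k\<^sup>4\<close>, scaling gives \<open>\<parallel>G\<parallel>\<^sub>\<infinity> = O(\<bar>k\<bar>\<^sup>d\<^sup>-\<^sup>4)\<close>, which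
  turns \<open>1 \<le> \<parallel>G\<parallel>\<^sub>\<infinity> \<parallel>V\<parallel>\<^sub>1\<close> into the claim. The constants for \<open>d = 1\<close> and \<open>d = 3\<close> come from the value of \<open>\<bar>G\<bar>\<close> at
  the origin, which is its supremum.

  \<^emph>\<open>Kernels.\<close> By partial fractions \<open>G = (g\<^sub>-\<^sub>i\<^sub>k - g\<^sub>k) / (2 k\<^sup>2)\<close>, where \<open>g\<^sub>\<kappa>\<close> is the fundamental solution of
  \<open>\<kappa>\<^sup>2 - \<Delta>\<close> for \<open>Re \<kappa> > 0\<close> (\<open>biharmonic_fundamental_solution\<close>). In dimension three \<open>g\<^sub>\<kappa>\<close> is the Yukawa kernel
  \<open>exp (-\<kappa> r) / (4 \<pi> r)\<close>; it is treated by replacing \<open>r\<close> with \<open>(r\<^sup>2 + \<epsilon>\<^sup>2)\<^sup>1\<^sup>/\<^sup>2\<close>, applying Green's identity, and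
  letting \<open>\<epsilon> \<rightarrow> 0\<close> (\<open>yukawa_fundamental_3\<close>). In dimension two it is the integral of the Yukawa kernel over lines,
  and in dimension one it is \<open>exp (-\<kappa> r) / (2 \<kappa>)\<close>. The three bounds on \<open>g\<^sub>-\<^sub>i\<^sub>k - g\<^sub>k\<close> are
  \<open>yukawa_diff_bound_3\<close>, \<open>green_2_diff_bound\<close> and \<open>green_1_diff_bound\<close>.

  \<^emph>\<open>From the form to the integral equation.\<close> Testing the form with smooth functions of compact support moves all
  derivatives to the test function (\<open>eigenfunction_weak_equations\<close>). Weak derivatives are unique by the fundamental
  lemma of the calculus of variations (\<open>AE_eq_0_if_test_integrals_eq_0\<close>), for which smooth bumps are constructed.
  A weak solution is then the convolution of the fundamental solution with the right-hand side
  (\<open>weak_solution_eq_convolution\<close>); this also yields the boundedness of \<open>\<psi>\<close> (\<open>H2_essentially_bounded\<close>), since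
  \<open>g\<^sub>1\<close> is square integrable.

  \<^emph>\<open>Eigenvalues in the essential spectrum.\<close> For \<open>z > 0\<close> no fundamental solution is integrable. The
  fourth root of \<open>z\<close> is therefore moved into the open first quadrant, and the error made by this vanishes
  in the limit (\<open>eigenvalue_bound_of_kernels\<close>).
\<close>

section \<open>Differential calculus of test functions\<close>

lemma partial_deriv_eq:
  assumes "(f has_derivative f') (at x)"
  shows "partial_deriv i f x = f' (axis i 1)"
  using assms unfolding partial_deriv_def by (metis frechet_derivative_at)

lemma C_diff_differentiable:
  assumes "C_diff (Suc k) f"
  shows "f differentiable (at x)"
  using assms unfolding C_diff.simps differentiable_on_def by simp

lemma C_diff_SucD: "C_diff (Suc k) f \<Longrightarrow> C_diff k f"
proof (induction k arbitrary: f)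
  case 0
  then show ?case by (simp add: differentiable_imp_continuous_on)
next
  case (Suc k)
  then show ?case by simp
qed

lemma C_diff_continuous_on: "C_diff k f \<Longrightarrow> continuous_on UNIV f"
  by (cases k) (auto intro: differentiable_imp_continuous_on)

lemma C_diff_const: "C_diff k (\<lambda>_ :: real ^ 'n::finite. c)"
proof (induction k arbitrary: c)
  case (Suc k)
  have "partial_deriv i (\<lambda>_ :: real ^ 'n. c) = (\<lambda>_. 0)" for i
    by (rule ext, subst partial_deriv_eq[OF has_derivative_const]) simp
  then have "C_diff k (partial_deriv i (\<lambda>_ :: real ^ 'n. c))" for i using Suc by simp
  then show ?case unfolding C_diff.simps by (simp add: differentiable_on_def)
qed simp

lemma partial_deriv_add:
  assumes "f differentiable (at x)" "g differentiable (at x)"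
  shows "partial_deriv i (\<lambda>x. f x + g x) x = partial_deriv i f x + partial_deriv i g x"
proof -
  obtain f' g' where *: "(f has_derivative f') (at x)" "(g has_derivative g') (at x)"
    using assms by (auto simp: differentiable_def)
  show ?thesis
    by (simp add: partial_deriv_eq[OF has_derivative_add[OF *]] partial_deriv_eq[OF *(1)] partial_deriv_eq[OF *(2)])
qed

lemma partial_deriv_mult:
  assumes "f differentiable (at x)" "g differentiable (at x)"
  shows "partial_deriv i (\<lambda>x. f x * g x) x = f x * partial_deriv i g x + partial_deriv i f x * g x"
proof -
  obtain f' g' where *: "(f has_derivative f') (at x)" "(g has_derivative g') (at x)"
    using assms by (auto simp: differentiable_def)
  show ?thesis
    by (simp add: partial_deriv_eq[OF has_derivative_mult[OF *]] partial_deriv_eq[OF *(1)] partial_deriv_eq[OF *(2)])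
qed

lemma C_diff_add: "C_diff k f \<Longrightarrow> C_diff k g \<Longrightarrow> C_diff k (\<lambda>x. f x + g x)"
proof (induction k arbitrary: f g)
  case 0
  then show ?case by (auto intro: continuous_on_add)
next
  case (Suc k)
  have d: "f differentiable (at x)" "g differentiable (at x)" for x
    using Suc.prems C_diff_differentiable by blast+
  have "partial_deriv i (\<lambda>x. f x + g x) = (\<lambda>x. partial_deriv i f x + partial_deriv i g x)" for i
    using partial_deriv_add d by blast
  then show ?case
    using Suc d by (auto simp: differentiable_on_def)
qed

lemma C_diff_mult: "C_diff k f \<Longrightarrow> C_diff k g \<Longrightarrow> C_diff k (\<lambda>x. f x * g x)"
proof (induction k arbitrary: f g)
  case 0
  then show ?case by (auto intro: continuous_on_mult)
next
  case (Suc k)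
  have d: "f differentiable (at x)" "g differentiable (at x)" for x
    using Suc.prems C_diff_differentiable by blast+
  have "partial_deriv i (\<lambda>x. f x * g x) = (\<lambda>x. f x * partial_deriv i g x + partial_deriv i f x * g x)" for i
    using partial_deriv_mult d by blast
  then show ?case
    using Suc d C_diff_SucD[OF Suc.prems(1)] C_diff_SucD[OF Suc.prems(2)]
    by (auto simp: differentiable_on_def intro!: C_diff_add)
qed

lemma C_diff_prod:
  assumes "\<And>i. i \<in> I \<Longrightarrow> C_diff k (f i)"
  shows "C_diff k (\<lambda>x. \<Prod>i\<in>I. f i x)"
proof (cases "finite I")
  case True
  then show ?thesis using assms
    by (induction I) (auto simp: C_diff_const intro: C_diff_mult)
qed (simp add: C_diff_const)

lemma C_diff_power: "C_diff k f \<Longrightarrow> C_diff k (\<lambda>x. f x ^ m)"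
  by (induction m) (auto simp: C_diff_const intro: C_diff_mult)

lemma partial_deriv_translate:
  assumes "f differentiable (at (x + c))"
  shows "partial_deriv i (\<lambda>x. f (x + c)) x = partial_deriv i f (x + c)"
proof -
  obtain f' where *: "(f has_derivative f') (at (x + c))"
    using assms by (auto simp: differentiable_def)
  have "((\<lambda>x. f (x + c)) has_derivative f') (at x)"
    using has_derivative_compose[OF has_derivative_add[OF has_derivative_ident has_derivative_const], of f f' x c] *
    by simp
  then show ?thesis
    using * by (simp add: partial_deriv_eq)
qed

lemma partial_deriv_cnj:
  assumes "f differentiable (at x)"
  shows "partial_deriv i (\<lambda>x. cnj (f x)) x = cnj (partial_deriv i f x)"
proof -
  obtain f' where *: "(f has_derivative f') (at x)"
    using assms by (auto simp: differentiable_def)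
  show ?thesis
    using * by (simp add: partial_deriv_eq[OF has_derivative_cnj[OF *]] partial_deriv_eq)
qed

lemma differentiable_translate:
  fixes f :: "'a::real_normed_vector \<Rightarrow> 'b::real_normed_vector"
  assumes "f differentiable (at (x + c))"
  shows "(\<lambda>x. f (x + c)) differentiable (at x)"
proof -
  obtain f' where *: "(f has_derivative f') (at (x + c))"
    using assms by (auto simp: differentiable_def)
  have "((\<lambda>x. f (x + c)) has_derivative f') (at x)"
    using has_derivative_compose[OF has_derivative_add[OF has_derivative_ident has_derivative_const], of f f' x c] *
    by simp
  then show ?thesis by (auto simp: differentiable_def)
qed

lemma C_diff_translate: "C_diff k f \<Longrightarrow> C_diff k (\<lambda>x. f (x + c))"
proof (induction k arbitrary: f)
  case 0
  then show ?case
    by (auto intro!: continuous_intros continuous_on_compose2[of UNIV f])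
next
  case (Suc k)
  have "partial_deriv i (\<lambda>x. f (x + c)) = (\<lambda>x. partial_deriv i f (x + c))" for i
    using C_diff_differentiable[OF Suc.prems] partial_deriv_translate by blast
  moreover have "(\<lambda>x. f (x + c)) differentiable_on UNIV"
    using C_diff_differentiable[OF Suc.prems] by (auto simp: differentiable_on_def intro: differentiable_translate)
  ultimately show ?case using Suc by simp
qed

lemma C_diff_cnj: "C_diff k f \<Longrightarrow> C_diff k (\<lambda>x. cnj (f x))"
proof (induction k arbitrary: f)
  case 0
  then show ?case by (auto intro: continuous_on_cnj)
next
  case (Suc k)
  have "partial_deriv i (\<lambda>x. cnj (f x)) = (\<lambda>x. cnj (partial_deriv i f x))" for i
    using C_diff_differentiable[OF Suc.prems] partial_deriv_cnj by blast
  moreover have "(\<lambda>x. cnj (f x)) differentiable_on UNIV"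
    using C_diff_differentiable[OF Suc.prems]
    by (auto simp: differentiable_on_def differentiable_def intro: has_derivative_cnj)
  ultimately show ?case using Suc by simp
qed

lemma test_functionI:
  assumes "\<And>k. C_diff k f" "bounded {x. f x \<noteq> 0}"
  shows "f \<in> test_functions"
  using assms by (auto simp: test_functions_def compact_closure)

lemma test_functionD:
  assumes "f \<in> test_functions"
  shows "C_diff k f" "bounded {x. f x \<noteq> 0}" "f differentiable (at x)" "continuous_on UNIV f"
proof -
  have *: "C_diff k f" for k using assms by (simp add: test_functions_def)
  show "C_diff k f" "f differentiable (at x)" "continuous_on UNIV f"
    using * C_diff_differentiable C_diff_continuous_on by blast+
  show "bounded {x. f x \<noteq> 0}" using assms by (simp add: test_functions_def compact_closure)
qed

lemma test_function_partial_deriv: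
  assumes "f \<in> test_functions"
  shows "partial_deriv i f \<in> test_functions"
proof (rule test_functionI)
  show "C_diff k (partial_deriv i f)" for k
    using test_functionD(1)[OF assms, of "Suc k"] by simp
  have "partial_deriv i f x = 0" if x: "x \<notin> closure {x. f x \<noteq> 0}" for x
  proof -
    have "(f has_derivative (\<lambda>_. 0)) (at x)"
    proof (rule has_derivative_transform_within_open[where s = "- closure {x. f x \<noteq> 0}"])
      show "((\<lambda>_. 0) has_derivative (\<lambda>_. 0)) (at x)" by simp
      show "0 = f y" if "y \<in> - closure {x. f x \<noteq> 0}" for y
        using that closure_subset[of "{x. f x \<noteq> 0}"] by auto
    qed (use x in auto)
    from partial_deriv_eq[OF this] show ?thesis by simp
  qed
  then have "{x. partial_deriv i f x \<noteq> 0} \<subseteq> closure {x. f x \<noteq> 0}" by auto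
  then show "bounded {x. partial_deriv i f x \<noteq> 0}"
    by (rule bounded_subset[OF bounded_closure[OF test_functionD(2)[OF assms]]])
qed

lemma test_function_add:
  assumes "f \<in> test_functions" "g \<in> test_functions"
  shows "(\<lambda>x. f x + g x) \<in> test_functions"
proof (rule test_functionI)
  show "C_diff k (\<lambda>x. f x + g x)" for k
    using assms by (intro C_diff_add test_functionD)
  have "{x. f x + g x \<noteq> 0} \<subseteq> {x. f x \<noteq> 0} \<union> {x. g x \<noteq> 0}" by auto
  then show "bounded {x. f x + g x \<noteq> 0}"
    using assms[THEN test_functionD(2)] by (auto intro: bounded_subset[of "{x. f x \<noteq> 0} \<union> {x. g x \<noteq> 0}"])
qed

lemma test_function_mult:
  assumes "f \<in> test_functions" "\<And>k. C_diff k g"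
  shows "(\<lambda>x. g x * f x) \<in> test_functions"
proof (rule test_functionI)
  show "C_diff k (\<lambda>x. g x * f x)" for k
    by (rule C_diff_mult[OF assms(2) test_functionD(1)[OF assms(1)]])
  have "{x. g x * f x \<noteq> 0} \<subseteq> {x. f x \<noteq> 0}" by auto
  then show "bounded {x. g x * f x \<noteq> 0}"
    by (rule bounded_subset[OF test_functionD(2)[OF assms(1)]])
qed

lemma test_function_cmult: "f \<in> test_functions \<Longrightarrow> (\<lambda>x. c * f x) \<in> test_functions"
  by (intro test_function_mult C_diff_const)

lemma test_function_sum:
  assumes "\<And>i. i \<in> I \<Longrightarrow> f i \<in> test_functions"
  shows "(\<lambda>x. \<Sum>i\<in>I. f i x) \<in> test_functions"
proof -
  have z: "(\<lambda>x. 0) \<in> test_functions" by (rule test_functionI) (auto simp: C_diff_const)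
  show ?thesis
  proof (cases "finite I")
    case True
    then show ?thesis using assms
      by (induction I) (auto intro: test_function_add z)
  qed (simp add: z)
qed

lemma test_function_translate:
  assumes "f \<in> test_functions"
  shows "(\<lambda>x. f (x + c)) \<in> test_functions"
proof (rule test_functionI)
  show "C_diff k (\<lambda>x. f (x + c))" for k
    using assms by (intro C_diff_translate test_functionD)
  have "x \<in> (\<lambda>x. x - c) ` {x. f x \<noteq> 0}" if "f (x + c) \<noteq> 0" for x
    using that by (intro image_eqI[of _ _ "x + c"]) auto
  then show "bounded {x. f (x + c) \<noteq> 0}"
    by (intro bounded_subset[OF bounded_translation_minus[OF test_functionD(2)[OF assms]]]) auto
qed

lemma test_function_cnj:
  assumes "f \<in> test_functions"
  shows "(\<lambda>x. cnj (f x)) \<in> test_functions"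
  using test_functionD(1,2)[OF assms] by (intro test_functionI C_diff_cnj) auto

text \<open>The classical Laplacian; \<^const>\<open>laplacian\<close> is the weak one.\<close>

definition lap :: "(real ^ 'n::finite \<Rightarrow> complex) \<Rightarrow> real ^ 'n \<Rightarrow> complex" where
  "lap f = (\<lambda>x. \<Sum>i\<in>UNIV. partial_deriv i (partial_deriv i f) x)"

lemma test_function_lap: "f \<in> test_functions \<Longrightarrow> lap f \<in> test_functions"
  unfolding lap_def by (intro test_function_sum test_function_partial_deriv)

lemma partial_deriv_test_add:
  assumes "f \<in> test_functions" "g \<in> test_functions"
  shows "partial_deriv i (\<lambda>x. f x + g x) = (\<lambda>x. partial_deriv i f x + partial_deriv i g x)"
  using partial_deriv_add[OF test_functionD(3)[OF assms(1)] test_functionD(3)[OF assms(2)]] by blast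

lemma partial_deriv_test_cmult:
  assumes "f \<in> test_functions"
  shows "partial_deriv i (\<lambda>x. c * f x) = (\<lambda>x. c * partial_deriv i f x)"
proof
  fix x
  show "partial_deriv i (\<lambda>x. c * f x) x = c * partial_deriv i f x"
    using partial_deriv_mult[OF _ test_functionD(3)[OF assms], of "\<lambda>_. c" x i]
    by (simp add: partial_deriv_eq[OF has_derivative_const])
qed

lemma partial_deriv_test_translate:
  assumes "f \<in> test_functions"
  shows "partial_deriv i (\<lambda>x. f (x + c)) = (\<lambda>x. partial_deriv i f (x + c))"
  using partial_deriv_translate test_functionD(3)[OF assms] by blast

lemma partial_deriv_test_cnj:
  assumes "f \<in> test_functions"
  shows "partial_deriv i (\<lambda>x. cnj (f x)) = (\<lambda>x. cnj (partial_deriv i f x))"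
  using partial_deriv_cnj test_functionD(3)[OF assms] by blast

lemma lap_add:
  assumes "f \<in> test_functions" "g \<in> test_functions"
  shows "lap (\<lambda>x. f x + g x) = (\<lambda>x. lap f x + lap g x)"
  using assms by (simp add: lap_def partial_deriv_test_add test_function_partial_deriv sum.distrib)

lemma lap_cmult:
  assumes "f \<in> test_functions"
  shows "lap (\<lambda>x. c * f x) = (\<lambda>x. c * lap f x)"
  using assms by (simp add: lap_def partial_deriv_test_cmult test_function_partial_deriv sum_distrib_left)

lemma lap_translate:
  assumes "f \<in> test_functions"
  shows "lap (\<lambda>x. f (x + c)) = (\<lambda>x. lap f (x + c))"
  using assms by (simp add: lap_def partial_deriv_test_translate test_function_partial_deriv)

lemma lap_cnj:
  assumes "f \<in> test_functions"
  shows "lap (\<lambda>x. cnj (f x)) = (\<lambda>x. cnj (lap f x))"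
  using assms by (simp add: lap_def partial_deriv_test_cnj test_function_partial_deriv)

section \<open>Integration by parts\<close>

lemma integrable_dominated:
  fixes f :: "'a \<Rightarrow> 'b::{banach, second_countable_topology}" and b :: "'a \<Rightarrow> real"
  assumes "integrable M b" "f \<in> borel_measurable M" "\<And>x. norm (f x) \<le> b x"
  shows "integrable M f"
proof (rule Bochner_Integration.integrable_bound[OF assms(1,2)])
  show "AE x in M. norm (f x) \<le> norm (b x)"
    using assms(3) by (intro AE_I2) (metis abs_ge_self order_trans real_norm_def)
qed

lemma integrable_mult_bounded:
  fixes f g :: "'a \<Rightarrow> complex"
  assumes "integrable M g" "f \<in> borel_measurable M" "\<And>x. cmod (f x) \<le> B"
  shows "integrable M (\<lambda>x. g x * f x)"
proof (rule integrable_dominated)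
  show "integrable M (\<lambda>x. cmod (g x) * B)" using assms(1) by simp
  show "(\<lambda>x. g x * f x) \<in> borel_measurable M"
    using assms(1,2) by (intro borel_measurable_times) auto
  show "cmod (g x * f x) \<le> cmod (g x) * B" for x
    unfolding norm_mult by (intro mult_left_mono assms(3)) simp
qed

lemma lborel_translate:
  fixes f :: "'a::euclidean_space \<Rightarrow> 'b::{banach, second_countable_topology}"
  assumes [measurable]: "f \<in> borel_measurable borel"
  shows "integrable lborel (\<lambda>x. f (x + c)) \<longleftrightarrow> integrable lborel f"
    "(LINT x|lborel. f (x + c)) = integral\<^sup>L lborel f"
proof -
  have *: "integral\<^sup>L (distr lborel borel ((+) c)) f = (LINT x|lborel. f (c + x))"
    by (subst integral_distr) auto
  have **: "integrable (distr lborel borel ((+) c)) f = integrable lborel (\<lambda>x. f (c + x))"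
    by (subst integrable_distr_eq) auto
  show "integrable lborel (\<lambda>x. f (x + c)) \<longleftrightarrow> integrable lborel f"
    "(LINT x|lborel. f (x + c)) = integral\<^sup>L lborel f"
    using * ** by (simp_all add: lborel_distr_plus add.commute)
qed

text \<open>By Fubini's theorem and translation invariance,
  \<open>\<integral>F' = \<integral>\<^sub>0\<^sup>1 \<integral>F'(x + s b) dx ds = \<integral>(F(x + b) - F(x)) dx = 0\<close>.\<close>

lemma integral_directional_derivative_eq_0:
  fixes F F' :: "'a::euclidean_space \<Rightarrow> complex"
  assumes F: "integrable lborel F" and F': "integrable lborel F'" "continuous_on UNIV F'"
    and deriv: "\<And>x t. ((\<lambda>t. F (x + t *\<^sub>R b)) has_vector_derivative F' (x + t *\<^sub>R b)) (at t)"
  shows "(LINT x|lborel. F' x) = 0"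
proof -
  let ?I = "\<lambda>s. indicator {0..1::real} s :: real"
  have cF': "F' \<in> borel_measurable borel" by (rule borel_measurable_continuous_onI[OF F'(2)])
  have trans: "integrable lborel (\<lambda>x. f (x + c))" "(LINT x|lborel. f (x + c)) = integral\<^sup>L lborel f"
    if "integrable lborel f" for f :: "'a \<Rightarrow> complex" and c
    using lborel_translate[of f c] that by auto
  have meas [measurable]: "(\<lambda>z. F' (snd z + fst z *\<^sub>R b)) \<in> borel_measurable (lborel \<Otimes>\<^sub>M lborel)"
    using cF' by measurable
  have "integrable (lborel \<Otimes>\<^sub>M lborel) (\<lambda>(s, x). ?I s *\<^sub>R F' (x + s *\<^sub>R b))"
  proof (rule lborel_pair.Fubini_integrable)
    show "(\<lambda>(s, x). ?I s *\<^sub>R F' (x + s *\<^sub>R b)) \<in> borel_measurable (lborel \<Otimes>\<^sub>M lborel)"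
      by (auto simp: split_beta')
    have eq: "(LINT x|lborel. cmod (F' (x + s *\<^sub>R b))) = (LINT x|lborel. cmod (F' x))" for s
      using lborel_translate(2)[of "\<lambda>x. cmod (F' x)" "s *\<^sub>R b"] cF' by simp
    show "integrable lborel (\<lambda>s. LINT x|lborel. norm (case (s, x) of (s, x) \<Rightarrow> ?I s *\<^sub>R F' (x + s *\<^sub>R b)))"
      by (simp add: eq)
    show "AE s in lborel. integrable lborel (\<lambda>x. case (s, x) of (s, x) \<Rightarrow> ?I s *\<^sub>R F' (x + s *\<^sub>R b))"
      using trans(1)[OF F'(1)] by simp
  qed
  from lborel_pair.Fubini_integral[OF this]
  have "(LINT x|lborel. (LINT s|lborel. ?I s *\<^sub>R F' (x + s *\<^sub>R b)))
      = (LINT s|lborel. (LINT x|lborel. ?I s *\<^sub>R F' (x + s *\<^sub>R b)))"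
    by simp
  also have "\<dots> = (LINT s|lborel. ?I s *\<^sub>R (LINT x|lborel. F' x))"
    using trans(2)[OF F'(1)] by simp
  also have "\<dots> = (LINT x|lborel. F' x)"
    by (subst integral_scaleR_left) auto
  finally have "(LINT x|lborel. F' x) = (LINT x|lborel. (LINT s|lborel. ?I s *\<^sub>R F' (x + s *\<^sub>R b)))" ..
  also have "\<dots> = (LINT x|lborel. F (x + b) - F x)"
  proof (rule Bochner_Integration.integral_cong)
    fix x
    have "(LINT s|lborel. ?I s *\<^sub>R F' (x + s *\<^sub>R b)) = F (x + 1 *\<^sub>R b) - F (x + 0 *\<^sub>R b)"
      using deriv F'(2)
      by (intro integral_FTC_atLeastAtMost[of 0 1 "\<lambda>t. F (x + t *\<^sub>R b)"])
        (auto intro: has_vector_derivative_at_within intro!: continuous_intros continuous_on_compose2[of UNIV F'])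
    then show "(LINT s|lborel. ?I s *\<^sub>R F' (x + s *\<^sub>R b)) = F (x + b) - F x" by simp
  qed simp
  also have "\<dots> = 0"
    using F trans by simp
  finally show ?thesis .
qed

lemma test_function_bounded:
  assumes "f \<in> test_functions"
  obtains B where "B > 0" "\<And>x. cmod (f x) \<le> B"
proof -
  have "compact (closure {x. f x \<noteq> 0})" using assms by (simp add: test_functions_def)
  then have "compact (f ` closure {x. f x \<noteq> 0})"
    using test_functionD(4)[OF assms] by (meson compact_continuous_image continuous_on_subset subset_UNIV)
  then obtain B where B: "B > 0" "\<And>y. y \<in> f ` closure {x. f x \<noteq> 0} \<Longrightarrow> norm y \<le> B"
    using compact_imp_bounded[of "f ` closure {x. f x \<noteq> 0}"] unfolding bounded_pos by blast
  have "cmod (f x) \<le> B" for x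
  proof (cases "f x = 0")
    case False
    then have "x \<in> closure {x. f x \<noteq> 0}" using closure_subset[of "{x. f x \<noteq> 0}"] by blast
    then show ?thesis by (intro B(2) imageI)
  qed (use B(1) in simp)
  with B(1) show ?thesis by (rule that)
qed

lemma test_function_measurable [measurable]: "f \<in> test_functions \<Longrightarrow> f \<in> borel_measurable borel"
  using test_functionD(4) by (rule borel_measurable_continuous_onI)

lemma integrable_bounded_support:
  fixes f :: "'a::euclidean_space \<Rightarrow> complex"
  assumes "f \<in> borel_measurable borel" "\<And>x. cmod (f x) \<le> B" "bounded {x. f x \<noteq> 0}"
  shows "integrable lborel f"
proof -
  obtain a where a: "{x. f x \<noteq> 0} \<subseteq> cbox (-a) a"
    using assms(3) bounded_subset_cbox_symmetric by blast
  have "integrable lborel (\<lambda>x. B * indicator (cbox (-a) a) x)"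
    using emeasure_lborel_cbox_finite[of "-a" a] by simp
  then show ?thesis
  proof (rule Bochner_Integration.integrable_bound)
    show "AE x in lborel. cmod (f x) \<le> norm (B * indicator (cbox (-a) a) x)"
    proof (intro AE_I2)
      fix x show "cmod (f x) \<le> norm (B * indicator (cbox (-a) a) x)"
        using a assms(2)[of x] by (cases "f x = 0") (auto simp: indicator_def)
    qed
  qed (use assms in simp)
qed

lemma test_function_integrable:
  assumes "f \<in> test_functions"
  shows "integrable lborel f"
proof -
  obtain B where "\<And>x. cmod (f x) \<le> B" using test_function_bounded[OF assms] by blast
  then show ?thesis
    by (rule integrable_bounded_support[OF test_function_measurable[OF assms] _ test_functionD(2)[OF assms]])
qed

lemma has_vector_derivative_partial_deriv:
  assumes "f differentiable (at (x + t *\<^sub>R axis i 1))"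
  shows "((\<lambda>t. f (x + t *\<^sub>R axis i 1)) has_vector_derivative partial_deriv i f (x + t *\<^sub>R axis i 1)) (at t)"
proof -
  obtain f' where *: "(f has_derivative f') (at (x + t *\<^sub>R axis i 1))"
    using assms by (auto simp: differentiable_def)
  have "((\<lambda>t. f (x + t *\<^sub>R axis i 1)) has_derivative (\<lambda>h. f' (h *\<^sub>R axis i 1))) (at t)"
    by (rule has_derivative_compose[where f' = "\<lambda>h. h *\<^sub>R axis i 1" and f = "\<lambda>t. x + t *\<^sub>R axis i 1", OF _ *])
      (auto intro!: derivative_eq_intros)
  moreover have "f' (h *\<^sub>R axis i 1) = h *\<^sub>R f' (axis i 1)" for h
    using has_derivative_linear[OF *] by (simp add: linear_scale)
  ultimately show ?thesis
    by (simp add: has_vector_derivative_def partial_deriv_eq[OF *])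
qed

lemma test_function_integration_by_parts:
  assumes f: "f \<in> test_functions" and g: "g \<in> test_functions"
  shows "(LINT x|lborel. f x * partial_deriv i g x) = - (LINT x|lborel. partial_deriv i f x * g x)"
proof -
  have fg: "(\<lambda>x. f x * g x) \<in> test_functions"
    by (rule test_function_mult[OF g test_functionD(1)[OF f]])
  have 1: "(\<lambda>x. f x * partial_deriv i g x) \<in> test_functions" "(\<lambda>x. partial_deriv i f x * g x) \<in> test_functions"
    using test_function_mult[OF test_function_partial_deriv[OF g] test_functionD(1)[OF f]]
      test_function_mult[OF g test_functionD(1)[OF test_function_partial_deriv[OF f]]] by auto
  have eq: "partial_deriv i (\<lambda>x. f x * g x) = (\<lambda>x. f x * partial_deriv i g x + partial_deriv i f x * g x)"
    using partial_deriv_mult f g test_functionD(3) by blast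
  have "(LINT x|lborel. partial_deriv i (\<lambda>x. f x * g x) x) = 0"
    using fg test_function_partial_deriv[OF fg]
    by (intro integral_directional_derivative_eq_0[where F = "\<lambda>x. f x * g x" and b = "axis i 1"]
        test_function_integrable test_functionD(4)
        has_vector_derivative_partial_deriv[of "\<lambda>x. f x * g x"] test_functionD(3)[OF fg])
  then show ?thesis
    unfolding eq using 1 by (simp add: test_function_integrable add_eq_0_iff2)
qed

section \<open>Smooth bumps and the fundamental lemma of the calculus of variations\<close>

text \<open>The classical flat functions. With \<open>s = 1/t\<close>, differentiation acts on the factor \<open>p\<close> of
  \<open>p(s) exp(-s)\<close> as \<open>p \<mapsto> s\<^sup>2 (p - p')\<close>, so the family is closed under differentiation, and therefore
  every member is smooth, including at \<open>0\<close>.\<close>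

definition flat :: "real poly \<Rightarrow> real \<Rightarrow> real" where
  "flat p t = (if t > 0 then poly p (1 / t) * exp (- (1 / t)) else 0)"

lemma tendsto_poly_times_exp_minus: "((\<lambda>s. poly p s * exp (- s)) \<longlongrightarrow> (0::real)) at_top"
proof -
  have "((\<lambda>s. \<Sum>i\<le>degree p. coeff p i * (s ^ i / exp s)) \<longlongrightarrow> (\<Sum>i\<le>degree p. coeff p i * 0)) at_top"
    by (intro tendsto_sum tendsto_mult tendsto_const tendsto_power_div_exp_0)
  moreover have "(\<lambda>s. \<Sum>i\<le>degree p. coeff p i * (s ^ i / exp s)) = (\<lambda>s. poly p s * exp (- s))"
    by (auto simp: poly_altdef exp_minus field_simps sum_distrib_left sum_distrib_right)
  ultimately show ?thesis by simp
qed

lemma flat_has_real_derivative: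
  "(flat p has_real_derivative flat (monom 1 2 * (p - pderiv p)) t) (at t)"
proof -
  consider "t > 0" | "t < 0" | "t = 0" by linarith
  then show ?thesis
  proof cases
    case 1
    have "((\<lambda>t. poly p (1 / t) * exp (- (1 / t))) has_real_derivative
        flat (monom 1 2 * (p - pderiv p)) t) (at t)"
      using 1 by (auto intro!: derivative_eq_intros DERIV_chain2[OF poly_DERIV]
          simp: flat_def poly_monom field_simps power2_eq_square)
    then show ?thesis
      by (rule has_field_derivative_transform_within_open[where S = "{0<..}"]) (use 1 in \<open>auto simp: flat_def\<close>)
  next
    case 2
    have "((\<lambda>t. 0) has_real_derivative flat (monom 1 2 * (p - pderiv p)) t) (at t)"
      using 2 by (simp add: flat_def)
    then show ?thesis
      by (rule has_field_derivative_transform_within_open[where S = "{..<0}"]) (use 2 in \<open>auto simp: flat_def\<close>)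
  next
    case 3
    have "((\<lambda>y. flat p y / y) \<longlongrightarrow> 0) (at_left 0)"
      by (rule tendsto_eventually) (auto simp: flat_def eventually_at_filter)
    moreover have "((\<lambda>y. flat p y / y) \<longlongrightarrow> 0) (at_right 0)"
      unfolding filterlim_at_right_to_top
    proof (rule Lim_transform_eventually)
      show "((\<lambda>s. poly (pCons 0 p) s * exp (- s)) \<longlongrightarrow> (0::real)) at_top"
        by (rule tendsto_poly_times_exp_minus)
      show "\<forall>\<^sub>F s in at_top. poly (pCons 0 p) s * exp (- s) = flat p (inverse s) / inverse s"
        using eventually_gt_at_top[of 0]
        by eventually_elim (auto simp: flat_def field_simps)
    qed
    ultimately have "((\<lambda>y. flat p y / y) \<longlongrightarrow> 0) (at 0)"
      by (simp add: filterlim_split_at)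
    then show ?thesis
      using 3 by (simp add: has_field_derivative_iff flat_def)
  qed
qed

lemma C_diff_flat: "C_diff k (\<lambda>x :: real ^ 'n::finite. of_real (flat p (\<sigma> * x $ i + c)))"
proof (induction k arbitrary: p)
  let ?f = "\<lambda>p (x :: real ^ 'n). complex_of_real (flat p (\<sigma> * x $ i + c))"
  have d: "(?f p has_derivative (\<lambda>h. of_real (flat (monom 1 2 * (p - pderiv p)) (\<sigma> * x $ i + c) * (\<sigma> * h $ i)))) (at x)"
    for p and x :: "real ^ 'n"
  proof -
    have "((\<lambda>x::real^'n. \<sigma> * x $ i + c) has_derivative (\<lambda>h. \<sigma> * h $ i)) (at x)"
      by (auto intro!: derivative_eq_intros bounded_linear.has_derivative[OF bounded_linear_vec_nth])
    from has_derivative_compose[OF this flat_has_real_derivative[of p "\<sigma> * x $ i + c", unfolded has_field_derivative_def]]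
    show ?thesis by (rule has_derivative_of_real)
  qed
  then have diff: "?f p differentiable_on UNIV" for p
    by (auto simp: differentiable_on_def differentiable_def)
  {
    case 0
    then show ?case using diff[THEN differentiable_imp_continuous_on] by simp
  next
    case (Suc k)
    have "partial_deriv j (?f p) = (\<lambda>x. of_real (\<sigma> * axis j 1 $ i) * ?f (monom 1 2 * (p - pderiv p)) x)" for j
      using partial_deriv_eq[OF d[of p]] by (auto simp: field_simps)
    then show ?case using diff Suc by (auto intro!: C_diff_mult C_diff_const)
  }
qed

text \<open>If \<open>\<theta>\<close> is a bump that is positive exactly on the box and takes values in \<open>[0, 1]\<close>, then the
  smooth functions \<open>1 - (1 - \<theta>)\<^sup>n\<close> increase to the indicator function of the box.\<close>

lemma box_indicator_approximation:
  fixes a b :: "real ^ 'n::finite"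
  obtains \<theta> :: "nat \<Rightarrow> real ^ 'n \<Rightarrow> complex" where
    "\<And>n. \<theta> n \<in> test_functions" "\<And>n x. cmod (\<theta> n x) \<le> indicator (box a b) x"
    "\<And>x. (\<lambda>n. \<theta> n x) \<longlonglongrightarrow> indicator (box a b) x"
proof -
  define h where "h = flat [:1:]"
  have h: "0 \<le> h t" "h t \<le> 1" "h t > 0 \<longleftrightarrow> t > 0" for t
    by (auto simp: h_def flat_def)
  define r where "r x = (\<Prod>i\<in>UNIV. h (x $ i - a $ i) * h (b $ i - x $ i))" for x
  have r: "0 \<le> r x" "r x \<le> 1" for x
    unfolding r_def using h by (auto intro!: prod_nonneg prod_le_1 mult_le_one)
  have r0: "r x = 0" if xb: "x \<notin> box a b" for x
  proof -
    obtain i where "\<not> (a $ i < x $ i \<and> x $ i < b $ i)" using xb unfolding mem_box_cart by blast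
    then have "h (x $ i - a $ i) * h (b $ i - x $ i) = 0"
      using h(1,3)[of "x $ i - a $ i"] h(1,3)[of "b $ i - x $ i"] by auto
    then show ?thesis unfolding r_def by (auto intro!: prod_zero)
  qed
  have rpos: "r x > 0" if "x \<in> box a b" for x
    unfolding r_def using that h by (auto intro!: prod_pos mult_pos_pos simp: mem_box_cart)
  define \<theta> where "\<theta> n x = complex_of_real (1 - (1 - r x) ^ n)" for n x
  show ?thesis
  proof
    fix n
    show "\<theta> n \<in> test_functions"
    proof (rule test_functionI)
      fix k
      have C: "C_diff k (\<lambda>x. of_real (h (x $ i - a $ i)))" "C_diff k (\<lambda>x. of_real (h (b $ i - x $ i)))" for i
        using C_diff_flat[of k "[:1:]" 1 i "- a $ i"] C_diff_flat[of k "[:1:]" "-1" i "b $ i"]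
        unfolding h_def by simp_all
      have "C_diff k (\<lambda>x. \<Prod>i\<in>UNIV. of_real (h (x $ i - a $ i)) * of_real (h (b $ i - x $ i)))"
        by (intro C_diff_prod C_diff_mult C)
      then have "C_diff k (\<lambda>x. 1 + (-1) * (1 + (-1) * (\<Prod>i\<in>UNIV. of_real (h (x $ i - a $ i)) * of_real (h (b $ i - x $ i)))) ^ n)"
        by (intro C_diff_add C_diff_mult C_diff_const C_diff_power)
      then show "C_diff k (\<theta> n)"
        by (simp add: \<theta>_def[abs_def] r_def)
      have "{x. \<theta> n x \<noteq> 0} \<subseteq> box a b" using r0 by (force simp: \<theta>_def)
      then show "bounded {x. \<theta> n x \<noteq> 0}" using bounded_box bounded_subset by blast
    qed
  next
    fix n x
    have "\<bar>1 - (1 - r x) ^ n\<bar> \<le> 1"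
      using r[of x] power_le_one[of "1 - r x" n] by auto
    then show "cmod (\<theta> n x) \<le> indicator (box a b) x"
      using r0 by (cases "x \<in> box a b") (auto simp: \<theta>_def simp del: of_real_diff of_real_power)
  next
    fix x
    show "(\<lambda>n. \<theta> n x) \<longlonglongrightarrow> indicator (box a b) x"
    proof (cases "x \<in> box a b")
      case True
      have "(\<lambda>n. complex_of_real (1 - (1 - r x) ^ n)) \<longlonglongrightarrow> of_real (1 - 0)"
        using rpos[OF True] r(2)[of x] by (intro tendsto_intros LIMSEQ_realpow_zero) auto
      then show ?thesis using True by (simp add: \<theta>_def)
    next
      case False
      then show ?thesis using r0 by (simp add: \<theta>_def)
    qed
  qed
qed

lemma box_Int_box_ex: "\<exists>p q. box a b \<inter> box c d = (box p q :: 'a::euclidean_space set)"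
  by (simp only: box_Int_box) blast

text \<open>For a fixed box \<open>Q\<close>, the sets \<open>A\<close> with \<open>\<integral>\<^sub>A 1\<^sub>Q g = 0\<close> form a Dynkin system. It contains the boxes,
  which are stable under intersection and generate the Borel sets.\<close>

lemma set_integral_box_eq_0_imp_AE_eq_0:
  fixes g :: "real ^ 'n::finite \<Rightarrow> complex"
  assumes g: "\<And>c d. set_integrable lborel (box c d) g"
    and zero: "\<And>a b. (LINT x:box a b|lborel. g x) = 0"
  shows "AE x in lborel. g x = 0"
proof -
  let ?E = "range (\<lambda>(a, b). box a b :: (real ^ 'n) set)"
  have sets_E: "sigma_sets UNIV ?E = sets (lborel :: (real ^ 'n) measure)"
    by (simp add: borel_eq_box)
  have Q: "AE x in lborel. x \<in> Q \<longrightarrow> g x = 0" if Qdef: "Q = box c d" for c d Q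
  proof -
    let ?h = "\<lambda>x. indicator Q x *\<^sub>R g x"
    have hi: "integrable lborel ?h" using g[of c d] by (simp add: set_integrable_def Qdef)
    have hiA: "integrable lborel (\<lambda>x. indicator A x *\<^sub>R ?h x)" if "A \<in> sets lborel" for A
      using integrable_mult_indicator[OF that hi] .
    have "(LINT x|lborel. indicator A x *\<^sub>R ?h x) = 0" if "A \<in> sets lborel" for A
    proof -
      have "Int_stable ?E"
      proof (rule Int_stableI)
        fix A B assume "A \<in> ?E" "B \<in> ?E"
        then obtain a b c d where "A = box a b" "B = box c d" by auto
        then have "\<exists>p q. A \<inter> B = box p q" using box_Int_box_ex by simp
        then show "A \<inter> B \<in> ?E" by auto
      qed
      moreover have "?E \<subseteq> Pow UNIV" by simp
      moreover have "A \<in> sigma_sets UNIV ?E" using that sets_E by auto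
      ultimately show ?thesis
      proof (induction rule: sigma_sets_induct_disjoint)
        case (basic A)
        then obtain a b where A: "A = box a b" by auto
        obtain a' b' where ab: "box a b \<inter> Q = box a' b'"
          using box_Int_box_ex Qdef by metis
        have "(\<lambda>x. indicator A x *\<^sub>R ?h x) = (\<lambda>x. indicator (box a' b') x *\<^sub>R g x)"
          unfolding ab[symmetric] A by (auto simp: indicator_def)
        then show ?case using zero[of a' b'] by (simp add: set_lebesgue_integral_def)
      next
        case empty
        then show ?case by simp
      next
        case (compl A)
        then have A: "A \<in> sets lborel" using sets_E by simp
        have u: "integral\<^sup>L lborel ?h = 0" using zero[of c d] by (simp add: set_lebesgue_integral_def Qdef)
        have "(LINT x|lborel. indicator (UNIV - A) x *\<^sub>R ?h x) = (LINT x|lborel. ?h x - indicator A x *\<^sub>R ?h x)"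
          by (intro Bochner_Integration.integral_cong) (auto simp: indicator_def)
        also have "\<dots> = 0"
          using hi hiA[OF A] u compl by simp
        finally show ?case .
      next
        case (union A)
        then have A: "A i \<in> sets lborel" for i using sets_E by auto
        have "set_lebesgue_integral lborel (\<Union>i. A i) ?h = (\<Sum>i. set_lebesgue_integral lborel (A i) ?h)"
          using union(1) A hiA by (intro lebesgue_integral_countable_add)
            (auto simp: disjoint_family_on_def set_integrable_def)
        then show ?case using union by (simp add: set_lebesgue_integral_def)
      qed
    qed
    then have "AE x in lborel. ?h x = 0"
      by (intro sigma_finite_measure.density_zero[OF sigma_finite_lborel hi]) (simp add: set_lebesgue_integral_def)
    then show ?thesis by eventually_elim (simp add: indicator_def)
  qed
  have "AE x in lborel. \<forall>n::nat. x \<in> box (- of_nat n *\<^sub>R One) (of_nat n *\<^sub>R One) \<longrightarrow> g x = 0"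
    unfolding AE_all_countable by (intro allI Q[OF refl])
  then show ?thesis
  proof (rule AE_mp, intro AE_I2 impI)
    fix x :: "real ^ 'n"
    assume *: "\<forall>n::nat. x \<in> box (- of_nat n *\<^sub>R One) (of_nat n *\<^sub>R One) \<longrightarrow> g x = 0"
    have "x \<in> (\<Union>n::nat. box (- (real n *\<^sub>R One)) (real n *\<^sub>R One))"
      unfolding UN_box_eq_UNIV by (rule UNIV_I)
    then obtain n :: nat where "x \<in> box (- real n *\<^sub>R One) (real n *\<^sub>R One)"
      unfolding UN_iff scaleR_minus_left by blast
    with * show "g x = 0" by blast
  qed
qed

lemma test_function_supported_cbox:
  assumes "f \<in> test_functions"
  obtains a where "\<And>x. x \<notin> cbox (-a) a \<Longrightarrow> f x = 0"
proof -
  obtain a where "{x. f x \<noteq> 0} \<subseteq> cbox (-a) a"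
    using bounded_subset_cbox_symmetric[OF test_functionD(2)[OF assms]] by blast
  then show ?thesis by (intro that[of a]) auto
qed

text \<open>Testing against the smooth approximations of the indicator function of a box shows that the
  integral of \<open>g\<close> over every box vanishes.\<close>

lemma AE_eq_0_if_test_integrals_eq_0:
  fixes g :: "real ^ 'n::finite \<Rightarrow> complex"
  assumes g: "\<And>c d. set_integrable lborel (box c d) g"
    and zero: "\<And>\<phi>. \<phi> \<in> test_functions \<Longrightarrow> (LINT x|lborel. g x * \<phi> x) = 0"
  shows "AE x in lborel. g x = 0"
proof (rule set_integral_box_eq_0_imp_AE_eq_0[OF g])
  fix a b :: "real ^ 'n"
  obtain \<theta> :: "nat \<Rightarrow> real ^ 'n \<Rightarrow> complex" where \<theta>:
    "\<And>n. \<theta> n \<in> test_functions" "\<And>n x. cmod (\<theta> n x) \<le> indicator (box a b) x"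
    "\<And>x. (\<lambda>n. \<theta> n x) \<longlonglongrightarrow> indicator (box a b) x"
    by (rule box_indicator_approximation[of a b], rule that)
  have \<theta>0: "\<theta> n x = 0" if "x \<notin> box a b" for n x using \<theta>(2)[of n x] that by simp
  let ?h = "\<lambda>x. indicator (box a b) x *\<^sub>R g x"
  have hi: "integrable lborel ?h" using g[of a b] by (simp add: set_integrable_def)
  have "(\<lambda>n. LINT x|lborel. \<theta> n x * ?h x) \<longlonglongrightarrow> (LINT x|lborel. indicator (box a b) x * ?h x)"
  proof (rule integral_dominated_convergence[where w = "\<lambda>x. norm (?h x)"])
    show "AE x in lborel. (\<lambda>n. \<theta> n x * ?h x) \<longlonglongrightarrow> indicator (box a b) x * ?h x"
      by (intro AE_I2 tendsto_intros \<theta>)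
    show "AE x in lborel. norm (\<theta> n x * ?h x) \<le> norm (?h x)" for n
    proof (intro AE_I2)
      fix x
      have "cmod (\<theta> n x) \<le> 1" using \<theta>(2)[of n x] by (cases "x \<in> box a b") auto
      then show "norm (\<theta> n x * ?h x) \<le> norm (?h x)"
        unfolding norm_mult by (rule mult_left_le_one_le[rotated 2]) auto
    qed
    show "integrable lborel (\<lambda>x. norm (?h x))" by (rule integrable_norm[OF hi])
    show "(\<lambda>x. indicator (box a b) x * ?h x) \<in> borel_measurable lborel"
      using borel_measurable_integrable[OF hi] by (intro borel_measurable_times) auto
    show "(\<lambda>x. \<theta> n x * ?h x) \<in> borel_measurable lborel" for n
      using borel_measurable_integrable[OF hi] \<theta>(1)[of n] by (intro borel_measurable_times) auto
  qed
  moreover have "(LINT x|lborel. \<theta> n x * ?h x) = 0" for n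
  proof -
    have "(\<lambda>x. \<theta> n x * ?h x) = (\<lambda>x. g x * \<theta> n x)"
      using \<theta>0 by (auto simp: indicator_def)
    then show ?thesis using zero[OF \<theta>(1)[of n]] by simp
  qed
  moreover have "(LINT x|lborel. indicator (box a b) x * ?h x) = (LINT x:box a b|lborel. g x)"
    unfolding set_lebesgue_integral_def
    by (intro Bochner_Integration.integral_cong) (auto simp: indicator_def)
  ultimately show "(LINT x:box a b|lborel. g x) = 0"
    using LIMSEQ_unique by (simp add: LIMSEQ_const_iff)
qed

section \<open>Weak derivatives and the weak eigenvalue equation\<close>

lemma lebesgue_ex_borel_version:
  fixes f :: "'a::euclidean_space \<Rightarrow> complex"
  assumes "f \<in> borel_measurable lebesgue"
  obtains g where "g \<in> borel_measurable borel" "AE x in lebesgue. f x = g x"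
proof -
  have "(\<lambda>x. Re (f x)) \<in> borel_measurable lebesgue" "(\<lambda>x. Im (f x)) \<in> borel_measurable lebesgue"
    using assms by measurable
  from this[THEN completion_ex_borel_measurable_real]
  obtain r s where rs: "r \<in> borel_measurable lborel" "AE x in lborel. Re (f x) = r x"
      "s \<in> borel_measurable lborel" "AE x in lborel. Im (f x) = s x"
    by blast
  have "AE x in lborel. f x = Complex (r x) (s x)"
    using rs(2,4) by eventually_elim (auto simp: complex_eq_iff)
  then have "AE x in lebesgue. f x = Complex (r x) (s x)"
    by (rule AE_completion)
  moreover have "(\<lambda>x. Complex (r x) (s x)) \<in> borel_measurable borel"
    using rs(1,3) by (simp add: borel_measurable_complex_iff)
  ultimately show ?thesis using that by blast
qed

lemma lebesgue_integral_eq_lborel: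
  fixes f g :: "'a::euclidean_space \<Rightarrow> complex"
  assumes "AE x in lebesgue. f x = g x" "f \<in> borel_measurable lebesgue" "g \<in> borel_measurable borel"
  shows "(LINT x|lebesgue. f x) = (LINT x|lborel. g x)"
proof -
  have "(LINT x|lebesgue. f x) = (LINT x|lebesgue. g x)"
    using assms by (intro integral_cong_AE) (auto simp: measurable_completion)
  also have "\<dots> = (LINT x|lborel. g x)"
    using assms by (intro integral_completion) auto
  finally show ?thesis .
qed

lemma L2_measurable [measurable_dest]: "f \<in> L2 \<Longrightarrow> f \<in> borel_measurable lebesgue"
  by (simp add: L2_def)

text \<open>The Borel counterpart of \<^const>\<open>L2\<close>. Fubini's theorem applies to Borel functions on a product
  without completing the product measure.\<close>

definition sq_integrable :: "('a::euclidean_space \<Rightarrow> complex) \<Rightarrow> bool" where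
  "sq_integrable f \<longleftrightarrow> f \<in> borel_measurable borel \<and> integrable lborel (\<lambda>x. (cmod (f x))\<^sup>2)"

lemma sq_integrableD:
  assumes "sq_integrable f"
  shows "f \<in> borel_measurable borel" "integrable lborel (\<lambda>x. (cmod (f x))\<^sup>2)"
  using assms by (auto simp: sq_integrable_def)

lemma norm_mult_le_sum_squares: "cmod (a * b) \<le> (cmod a)\<^sup>2 + (cmod b)\<^sup>2"
proof -
  have "2 * (cmod a * cmod b) \<le> (cmod a)\<^sup>2 + (cmod b)\<^sup>2"
    using sum_squares_bound[of "cmod a" "cmod b"] by simp
  moreover have "0 \<le> cmod a * cmod b" by simp
  ultimately show ?thesis unfolding norm_mult by linarith
qed

lemma sq_integrable_mult:
  assumes "sq_integrable f" "sq_integrable g"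
  shows "integrable lborel (\<lambda>x. f x * g x)"
proof (rule integrable_dominated)
  show "integrable lborel (\<lambda>x. (cmod (f x))\<^sup>2 + (cmod (g x))\<^sup>2)"
    using assms by (intro Bochner_Integration.integrable_add sq_integrableD)
  show "(\<lambda>x. f x * g x) \<in> borel_measurable lborel"
    using assms[THEN sq_integrableD(1)] by simp
qed (rule norm_mult_le_sum_squares)

lemma sq_integrable_cmult: "sq_integrable f \<Longrightarrow> sq_integrable (\<lambda>x. c * f x)"
  by (auto simp: sq_integrable_def norm_mult power_mult_distrib intro: borel_measurable_times)

lemma sq_integrable_add:
  assumes f: "sq_integrable f" and g: "sq_integrable g"
  shows "sq_integrable (\<lambda>x. f x + g x)"
  unfolding sq_integrable_def
proof
  have [measurable]: "f \<in> borel_measurable borel" "g \<in> borel_measurable borel"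
    using f g by (auto dest: sq_integrableD)
  show "(\<lambda>x. f x + g x) \<in> borel_measurable borel" by measurable
  show "integrable lborel (\<lambda>x. (cmod (f x + g x))\<^sup>2)"
  proof (rule integrable_dominated)
    show "integrable lborel (\<lambda>x. 2 * (cmod (f x))\<^sup>2 + 2 * (cmod (g x))\<^sup>2)"
      using sq_integrableD(2)[OF f] sq_integrableD(2)[OF g] by simp
    show "norm ((cmod (f x + g x))\<^sup>2) \<le> 2 * (cmod (f x))\<^sup>2 + 2 * (cmod (g x))\<^sup>2" for x
    proof -
      have "(cmod (f x + g x))\<^sup>2 \<le> (cmod (f x) + cmod (g x))\<^sup>2" by (intro power_mono norm_triangle_ineq) auto
      also have "\<dots> \<le> 2 * (cmod (f x))\<^sup>2 + 2 * (cmod (g x))\<^sup>2"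
        using sum_squares_bound[of "cmod (f x)" "cmod (g x)"] by (simp add: power2_sum)
      finally show ?thesis by simp
    qed
  qed measurable
qed

lemma sq_integrable_sum:
  assumes "\<And>i. i \<in> I \<Longrightarrow> sq_integrable (f i)"
  shows "sq_integrable (\<lambda>x. \<Sum>i\<in>I. f i x)"
proof (cases "finite I")
  case True
  then show ?thesis using assms
    by (induction I) (auto intro: sq_integrable_add simp: sq_integrable_def[of "\<lambda>_. 0"])
qed (simp add: sq_integrable_def)

lemma test_function_sq_integrable:
  assumes "\<phi> \<in> test_functions"
  shows "sq_integrable \<phi>"
proof -
  have [measurable]: "\<phi> \<in> borel_measurable borel" using assms by (rule test_function_measurable)
  obtain B where B: "B > 0" "\<And>x. cmod (\<phi> x) \<le> B" using test_function_bounded[OF assms] by blast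
  have "integrable lborel (\<lambda>x. complex_of_real ((cmod (\<phi> x))\<^sup>2))"
  proof (rule integrable_bounded_support)
    show "cmod (complex_of_real ((cmod (\<phi> x))\<^sup>2)) \<le> B\<^sup>2" for x
      using B(2)[of x] by (simp add: norm_power power_mono)
  qed (use test_functionD(2)[OF assms] in auto)
  from integrable_Re[OF this] show ?thesis unfolding sq_integrable_def Re_complex_of_real by simp
qed

lemma sq_integrable_indicator_box: "sq_integrable (\<lambda>x. indicator (box c d) x)"
proof -
  have "(\<lambda>x. (cmod (indicator (box c d) x))\<^sup>2) = (indicator (box c d) :: _ \<Rightarrow> real)"
    by (auto simp: indicator_def)
  then show ?thesis
    using emeasure_lborel_box_finite[of c d] by (simp add: sq_integrable_def)
qed

lemma sq_integrable_imp_set_integrable_box: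
  assumes "sq_integrable f"
  shows "set_integrable lborel (box c d) f"
proof -
  have "set_integrable lborel (box c d) f \<longleftrightarrow> integrable lborel (\<lambda>x. indicator (box c d) x * f x)"
    unfolding set_integrable_def by (intro Bochner_Integration.integrable_cong) (auto simp: indicator_def)
  then show ?thesis using sq_integrable_mult[OF sq_integrable_indicator_box assms] by simp
qed

lemma L2_borel_version:
  assumes "f \<in> L2"
  obtains g where "sq_integrable g" "AE x in lebesgue. f x = g x"
proof -
  obtain g where g: "g \<in> borel_measurable borel" "AE x in lebesgue. f x = g x"
    using lebesgue_ex_borel_version[OF L2_measurable[OF assms]] .
  have "integrable lebesgue (\<lambda>x. (cmod (f x))\<^sup>2)" using assms by (simp add: L2_def)
  moreover have "AE x in lebesgue. (cmod (f x))\<^sup>2 = (cmod (g x))\<^sup>2"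
    using g(2) by eventually_elim simp
  ultimately have "integrable lebesgue (\<lambda>x. (cmod (g x))\<^sup>2)"
    using g(1) L2_measurable[OF assms] by (subst (asm) integrable_cong_AE) (auto simp: measurable_completion)
  then have "integrable lborel (\<lambda>x. (cmod (g x))\<^sup>2)"
    using g(1) by (subst (asm) integrable_completion) auto
  with g show ?thesis using that by (auto simp: sq_integrable_def)
qed

lemma sq_integrable_imp_L2: "sq_integrable f \<Longrightarrow> f \<in> L2"
  by (auto simp: sq_integrable_def L2_def measurable_completion integrable_completion)

lemma L2_cong_AE:
  assumes "f \<in> L2" "AE x in lebesgue. f x = g x"
  shows "g \<in> L2"
proof -
  have [measurable]: "f \<in> borel_measurable lebesgue" using assms(1) by (rule L2_measurable)
  have g [measurable]: "g \<in> borel_measurable lebesgue"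
    using borel_measurable_AE[OF _ assms(2)] by simp
  have "integrable lebesgue (\<lambda>x. (cmod (g x))\<^sup>2) \<longleftrightarrow> integrable lebesgue (\<lambda>x. (cmod (f x))\<^sup>2)"
    using assms(2) by (intro integrable_cong_AE) (auto elim: eventually_mono)
  then show ?thesis using assms(1) g by (simp add: L2_def)
qed

lemma L2_test_integral:
  assumes "f \<in> L2" "AE x in lebesgue. f x = g x" "g \<in> borel_measurable borel" "\<phi> \<in> test_functions"
  shows "(LINT x|lebesgue. f x * \<phi> x) = (LINT x|lborel. g x * \<phi> x)"
proof (rule lebesgue_integral_eq_lborel)
  show "AE x in lebesgue. f x * \<phi> x = g x * \<phi> x"
    using assms(2) by eventually_elim simp
  show "(\<lambda>x. f x * \<phi> x) \<in> borel_measurable lebesgue"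
    using L2_measurable[OF assms(1)] test_function_measurable[OF assms(4)]
    by (intro borel_measurable_times) (auto simp: measurable_completion)
qed (use assms test_function_measurable[OF assms(4)] in auto)

lemma has_weak_partial_unique:
  assumes "has_weak_partial i f g" "has_weak_partial i f h"
  shows "AE x in lebesgue. g x = h x"
proof -
  have L: "g \<in> L2" "h \<in> L2" using assms by (auto simp: has_weak_partial_def)
  obtain g' where g': "sq_integrable g'" "AE x in lebesgue. g x = g' x" using L2_borel_version[OF L(1)] .
  obtain h' where h': "sq_integrable h'" "AE x in lebesgue. h x = h' x" using L2_borel_version[OF L(2)] .
  have "AE x in lborel. g' x - h' x = 0"
  proof (rule AE_eq_0_if_test_integrals_eq_0)
    show "set_integrable lborel (box c d) (\<lambda>x. g' x - h' x)" for c d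
      using g'(1) h'(1) by (intro set_integral_diff sq_integrable_imp_set_integrable_box)
    fix \<phi> :: "real ^ 'a \<Rightarrow> complex" assume \<phi>: "\<phi> \<in> test_functions"
    have "(LINT x|lebesgue. g x * \<phi> x) = (LINT x|lebesgue. h x * \<phi> x)"
      using assms \<phi> unfolding has_weak_partial_def by (metis neg_equal_iff_equal)
    then have "(LINT x|lborel. g' x * \<phi> x) = (LINT x|lborel. h' x * \<phi> x)"
      using L2_test_integral[OF L(1) g'(2) sq_integrableD(1)[OF g'(1)] \<phi>]
        L2_test_integral[OF L(2) h'(2) sq_integrableD(1)[OF h'(1)] \<phi>] by simp
    moreover have "integrable lborel (\<lambda>x. g' x * \<phi> x)" "integrable lborel (\<lambda>x. h' x * \<phi> x)"
      using g'(1) h'(1) test_function_sq_integrable[OF \<phi>] by (auto intro: sq_integrable_mult)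
    ultimately show "(LINT x|lborel. (g' x - h' x) * \<phi> x) = 0"
      by (simp add: left_diff_distrib)
  qed
  then have "AE x in lebesgue. g' x - h' x = 0" by (rule AE_completion)
  with g'(2) h'(2) show ?thesis by eventually_elim simp
qed

lemma has_weak_partial_cong:
  assumes "has_weak_partial i f g" "AE x in lebesgue. f x = f' x"
  shows "has_weak_partial i f' g"
proof -
  have f: "f \<in> L2" using assms(1) by (simp add: has_weak_partial_def)
  have f': "f' \<in> L2" using L2_cong_AE[OF f assms(2)] .
  obtain h where h: "sq_integrable h" "AE x in lebesgue. f x = h x" using L2_borel_version[OF f] .
  have h': "AE x in lebesgue. f' x = h x" using h(2) assms(2) by eventually_elim simp
  have "(LINT x|lebesgue. f' x * \<phi> x) = (LINT x|lebesgue. f x * \<phi> x)" if "\<phi> \<in> test_functions" for \<phi>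
    using L2_test_integral[OF f h(2) sq_integrableD(1)[OF h(1)] that]
      L2_test_integral[OF f' h' sq_integrableD(1)[OF h(1)] that] by simp
  then show ?thesis
    using assms(1) f' test_function_partial_deriv unfolding has_weak_partial_def by metis
qed

lemma has_weak_partial_weak_partial:
  "has_weak_partial i f g \<Longrightarrow> has_weak_partial i f (weak_partial i f)"
  unfolding weak_partial_def by (rule someI[of "has_weak_partial i f"])

lemma sobolev_imp_L2: "f \<in> sobolev k \<Longrightarrow> f \<in> L2"
  by (cases k) auto

lemma H2_has_weak_partials:
  assumes "f \<in> H2"
  shows "has_weak_partial i f (weak_partial i f)"
    "has_weak_partial i (weak_partial i f) (weak_partial i (weak_partial i f))"
proof -
  have "f \<in> sobolev (Suc (Suc 0))" using assms by (simp add: numeral_2_eq_2)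
  then obtain g where g: "g \<in> sobolev (Suc 0)" "has_weak_partial i f g"
    unfolding sobolev.simps(2)[of "Suc 0"] by blast
  then obtain h where h: "has_weak_partial i g h" by auto
  show 1: "has_weak_partial i f (weak_partial i f)"
    using has_weak_partial_weak_partial g(2) .
  have "has_weak_partial i (weak_partial i f) h"
    by (rule has_weak_partial_cong[OF h has_weak_partial_unique[OF g(2) 1]])
  then show "has_weak_partial i (weak_partial i f) (weak_partial i (weak_partial i f))"
    by (rule has_weak_partial_weak_partial)
qed

lemma test_function_has_weak_partial:
  assumes "\<phi> \<in> test_functions"
  shows "has_weak_partial i \<phi> (partial_deriv i \<phi>)"
  unfolding has_weak_partial_def
proof (intro conjI ballI)
  have d: "partial_deriv i \<phi> \<in> test_functions" using assms by (rule test_function_partial_deriv)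
  show L: "\<phi> \<in> L2" "partial_deriv i \<phi> \<in> L2"
    using assms d by (auto intro: sq_integrable_imp_L2 test_function_sq_integrable)
  fix \<eta> :: "real ^ 'a \<Rightarrow> complex" assume \<eta>: "\<eta> \<in> test_functions"
  show "(LINT x|lebesgue. \<phi> x * partial_deriv i \<eta> x) = - (LINT x|lebesgue. partial_deriv i \<phi> x * \<eta> x)"
    using L2_test_integral[OF L(1) _ test_function_measurable[OF assms] test_function_partial_deriv[OF \<eta>]]
      L2_test_integral[OF L(2) _ test_function_measurable[OF d] \<eta>]
      test_function_integration_by_parts[OF assms \<eta>] by simp
qed

lemma test_function_sobolev: "\<phi> \<in> test_functions \<Longrightarrow> \<phi> \<in> sobolev k"
proof (induction k arbitrary: \<phi>)
  case 0
  then show ?case by (simp add: sq_integrable_imp_L2 test_function_sq_integrable)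
next
  case (Suc k)
  then show ?case
    by (auto intro: sq_integrable_imp_L2 test_function_sq_integrable test_function_has_weak_partial
        test_function_partial_deriv)
qed

text \<open>The chosen weak derivatives agree almost everywhere with the classical ones, because weak
  derivatives are unique.\<close>

lemma laplacian_test_function:
  assumes "\<phi> \<in> test_functions"
  shows "AE x in lebesgue. laplacian \<phi> x = lap \<phi> x"
proof -
  have "AE x in lebesgue. weak_partial i (weak_partial i \<phi>) x = partial_deriv i (partial_deriv i \<phi>) x" for i
  proof -
    note w = H2_has_weak_partials[OF test_function_sobolev[OF assms]]
    have "has_weak_partial i (weak_partial i \<phi>) (partial_deriv i (partial_deriv i \<phi>))"
      by (rule has_weak_partial_cong[OF test_function_has_weak_partial[OF test_function_partial_deriv[OF assms]]
            has_weak_partial_unique[OF test_function_has_weak_partial[OF assms] w(1)]])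
    from has_weak_partial_unique[OF w(2) this] show ?thesis .
  qed
  then have "AE x in lebesgue. \<forall>i. weak_partial i (weak_partial i \<phi>) x = partial_deriv i (partial_deriv i \<phi>) x"
    by (simp add: AE_all_countable)
  then show ?thesis by eventually_elim (simp add: laplacian_def lap_def)
qed

lemma H2_weak_laplacian:
  assumes "f \<in> H2" "AE x in lebesgue. f x = u x" "u \<in> borel_measurable borel"
  obtains U where "sq_integrable U" "AE x in lebesgue. laplacian f x = U x"
    "\<And>\<phi>. \<phi> \<in> test_functions \<Longrightarrow> (LINT x|lborel. u x * lap \<phi> x) = (LINT x|lborel. U x * \<phi> x)"
proof -
  note w = H2_has_weak_partials[OF assms(1)]
  have L: "f \<in> L2" "weak_partial i f \<in> L2" "weak_partial i (weak_partial i f) \<in> L2" for i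
    using w[of i] by (auto simp: has_weak_partial_def)
  have "\<forall>i. \<exists>v. sq_integrable v \<and> (AE x in lebesgue. weak_partial i (weak_partial i f) x = v x)"
  proof
    fix i
    obtain v where "sq_integrable v" "AE x in lebesgue. weak_partial i (weak_partial i f) x = v x"
      using L2_borel_version[OF L(3)] .
    then show "\<exists>v. sq_integrable v \<and> (AE x in lebesgue. weak_partial i (weak_partial i f) x = v x)" by blast
  qed
  from choice[OF this] obtain v where v: "\<And>i. sq_integrable (v i)"
      "\<And>i. AE x in lebesgue. weak_partial i (weak_partial i f) x = v i x" by blast
  define U where "U x = (\<Sum>i\<in>UNIV. v i x)" for x
  have [measurable]: "v i \<in> borel_measurable borel" for i by (rule sq_integrableD(1)[OF v(1)])
  have sqU: "sq_integrable U"
    unfolding U_def[abs_def] using v(1) by (rule sq_integrable_sum)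
  have AEU: "AE x in lebesgue. laplacian f x = U x"
  proof -
    have "AE x in lebesgue. \<forall>i. weak_partial i (weak_partial i f) x = v i x"
      using v(2) by (simp add: AE_all_countable)
    then show ?thesis by eventually_elim (simp add: laplacian_def U_def)
  qed
  have "(LINT x|lborel. u x * lap \<phi> x) = (LINT x|lborel. U x * \<phi> x)" if \<phi>: "\<phi> \<in> test_functions" for \<phi>
  proof -
    note d = test_function_partial_deriv
    obtain u' where u': "sq_integrable u'" "AE x in lebesgue. f x = u' x" using L2_borel_version[OF L(1)] .
    have int: "integrable lborel (\<lambda>x. u x * partial_deriv i (partial_deriv i \<phi>) x)" for i
    proof -
      have "AE x in lebesgue. u x = u' x" using u'(2) assms(2) by eventually_elim simp
      then have "AE x in lborel. u x = u' x" by (rule AE_completion_iff[THEN iffD1])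
      then have "AE x in lborel. u' x * partial_deriv i (partial_deriv i \<phi>) x = u x * partial_deriv i (partial_deriv i \<phi>) x"
        by eventually_elim simp
      then show ?thesis
        using sq_integrable_mult[OF u'(1) test_function_sq_integrable[OF d[OF d[OF \<phi>]]], of i i]
          assms(3) sq_integrableD(1)[OF u'(1)] test_function_measurable[OF d[OF d[OF \<phi>]]]
        by (subst (asm) integrable_cong_AE) auto
    qed
    have intv: "integrable lborel (\<lambda>x. v i x * \<phi> x)" for i
      by (rule sq_integrable_mult[OF v(1) test_function_sq_integrable[OF \<phi>]])
    have "(LINT x|lborel. u x * partial_deriv i (partial_deriv i \<phi>) x) = (LINT x|lborel. v i x * \<phi> x)" for i
    proof -
      have "(LINT x|lborel. u x * partial_deriv i (partial_deriv i \<phi>) x)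
          = (LINT x|lebesgue. f x * partial_deriv i (partial_deriv i \<phi>) x)"
        using L2_test_integral[OF L(1) assms(2,3) d[OF d[OF \<phi>]]] by simp
      also have "\<dots> = - (LINT x|lebesgue. weak_partial i f x * partial_deriv i \<phi> x)"
        using w(1)[of i] d[OF \<phi>, of i] by (simp add: has_weak_partial_def)
      also have "\<dots> = (LINT x|lebesgue. weak_partial i (weak_partial i f) x * \<phi> x)"
        using w(2)[of i] \<phi> by (simp add: has_weak_partial_def)
      also have "\<dots> = (LINT x|lborel. v i x * \<phi> x)"
        by (rule L2_test_integral[OF L(3) v(2) _ \<phi>]) measurable
      finally show ?thesis .
    qed
    then show ?thesis
      using int intv by (simp add: lap_def U_def sum_distrib_left sum_distrib_right)
  qed
  with sqU AEU show ?thesis by (rule that)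
qed

text \<open>All that is used of an eigenfunction from here on: a Borel representative \<open>u\<close> with weak Laplacian \<open>U\<close>,
  a Borel representative \<open>W\<close> of the potential, and the eigenvalue equation with all four derivatives
  moved to the test function. The form is evaluated at the conjugate of \<open>\<phi>\<close>, so that no conjugates remain.\<close>

lemma eigenfunction_weak_equations:
  fixes V :: "real ^ 'n::finite \<Rightarrow> complex"
  assumes V: "integrable lebesgue V" and z: "z \<in> point_spectrum V"
  obtains u U W :: "real ^ 'n \<Rightarrow> complex" where "sq_integrable u" "sq_integrable U" "integrable lborel W"
    "\<not> (AE x in lborel. u x = 0)" "(LINT x|lborel. cmod (W x)) = L1_norm V"
    "\<And>\<phi>. \<phi> \<in> test_functions \<Longrightarrow> (LINT x|lborel. u x * lap \<phi> x) = (LINT x|lborel. U x * \<phi> x)"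
    "\<And>\<phi>. \<phi> \<in> test_functions \<Longrightarrow>
      (LINT x|lborel. u x * lap (lap \<phi>) x) + (LINT x|lborel. W x * u x * \<phi> x) = z * (LINT x|lborel. u x * \<phi> x)"
proof -
  obtain \<psi> where \<psi>: "\<not> (AE x in lebesgue. \<psi> x = 0)" "\<psi> \<in> H2"
    "\<And>\<phi>. \<phi> \<in> H2 \<Longrightarrow> form_h V \<phi> \<psi> = (LINT x|lebesgue. cnj (\<phi> x) * (z * \<psi> x))"
    using z by (auto simp: point_spectrum_def operator_graph_def)
  have L: "\<psi> \<in> L2" using \<psi>(2) sobolev_imp_L2 by blast
  obtain u where u: "sq_integrable u" "AE x in lebesgue. \<psi> x = u x" using L2_borel_version[OF L] .
  note mu [measurable] = sq_integrableD(1)[OF u(1)]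
  obtain U where U: "sq_integrable U" "AE x in lebesgue. laplacian \<psi> x = U x"
    "\<And>\<phi>. \<phi> \<in> test_functions \<Longrightarrow> (LINT x|lborel. u x * lap \<phi> x) = (LINT x|lborel. U x * \<phi> x)"
    using H2_weak_laplacian[OF \<psi>(2) u(2) mu] by blast
  have LU: "laplacian \<psi> \<in> L2"
    using L2_cong_AE[OF sq_integrable_imp_L2[OF U(1)]] U(2) by (simp add: eq_commute)
  obtain W where W [measurable]: "W \<in> borel_measurable borel" and AEW: "AE x in lebesgue. V x = W x"
    using lebesgue_ex_borel_version[OF borel_measurable_integrable[OF V]] .
  have "integrable lebesgue W"
    using V by (rule integrable_cong_AE_imp) (use AEW in \<open>auto simp: measurable_completion eq_commute\<close>)
  then have iW: "integrable lborel W" by (subst (asm) integrable_completion) auto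
  have nW: "(LINT x|lborel. cmod (W x)) = L1_norm V"
  proof -
    have "L1_norm V = (LINT x|lebesgue. cmod (W x))"
      unfolding L1_norm_def using V AEW
      by (intro integral_cong_AE) (auto simp: measurable_completion elim: eventually_mono)
    then show ?thesis by (simp add: integral_completion)
  qed
  have nz: "\<not> (AE x in lborel. u x = 0)"
  proof
    assume "AE x in lborel. u x = 0"
    then have "AE x in lebesgue. u x = 0" by (rule AE_completion)
    with u(2) have "AE x in lebesgue. \<psi> x = 0" by eventually_elim simp
    with \<psi>(1) show False by simp
  qed
  have eq: "(LINT x|lborel. u x * lap (lap \<phi>) x) + (LINT x|lborel. W x * u x * \<phi> x) = z * (LINT x|lborel. u x * \<phi> x)"
    if \<phi>: "\<phi> \<in> test_functions" for \<phi>
  proof -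
    let ?\<phi> = "\<lambda>x. cnj (\<phi> x)"
    have \<phi>': "?\<phi> \<in> test_functions" using \<phi> by (rule test_function_cnj)
    have m [measurable]: "\<phi> \<in> borel_measurable borel" "lap \<phi> \<in> borel_measurable borel"
      using \<phi> test_function_lap[OF \<phi>] by (auto intro: test_function_measurable)
    have m' [measurable]: "\<phi> \<in> borel_measurable lebesgue" "V \<in> borel_measurable lebesgue" "\<psi> \<in> borel_measurable lebesgue"
      using V L by (auto simp: measurable_completion L2_measurable)
    have AEl: "AE x in lebesgue. cnj (laplacian ?\<phi> x) = lap \<phi> x"
      using laplacian_test_function[OF \<phi>'] unfolding lap_cnj[OF \<phi>] by eventually_elim simp
    have "(LINT x|lebesgue. cnj (laplacian ?\<phi> x) * laplacian \<psi> x) = (LINT x|lborel. U x * lap \<phi> x)"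
    proof (rule lebesgue_integral_eq_lborel)
      show AE: "AE x in lebesgue. cnj (laplacian ?\<phi> x) * laplacian \<psi> x = U x * lap \<phi> x"
        using AEl U(2) by eventually_elim simp
      have mm: "(\<lambda>x. U x * lap \<phi> x) \<in> borel_measurable borel"
        using sq_integrableD(1)[OF U(1)] by measurable
      then show "(\<lambda>x. U x * lap \<phi> x) \<in> borel_measurable borel" .
      show "(\<lambda>x. cnj (laplacian ?\<phi> x) * laplacian \<psi> x) \<in> borel_measurable lebesgue"
      proof (rule borel_measurable_AE)
        show "AE x in lebesgue. U x * lap \<phi> x = cnj (laplacian ?\<phi> x) * laplacian \<psi> x"
          using AE by eventually_elim simp
        show "(\<lambda>x. U x * lap \<phi> x) \<in> borel_measurable lebesgue"
          using mm by (simp add: measurable_completion)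
      qed
    qed
    also have "\<dots> = (LINT x|lborel. u x * lap (lap \<phi>) x)"
      using U(3)[OF test_function_lap[OF \<phi>]] by simp
    finally have 1: "(LINT x|lebesgue. cnj (laplacian ?\<phi> x) * laplacian \<psi> x) = (LINT x|lborel. u x * lap (lap \<phi>) x)" .
    have 2: "(LINT x|lebesgue. V x * cnj (?\<phi> x) * \<psi> x) = (LINT x|lborel. W x * u x * \<phi> x)"
    proof (rule lebesgue_integral_eq_lborel)
      show "AE x in lebesgue. V x * cnj (?\<phi> x) * \<psi> x = W x * u x * \<phi> x"
        using AEW u(2) by eventually_elim simp
    qed auto
    have 3: "(LINT x|lebesgue. cnj (?\<phi> x) * (z * \<psi> x)) = (LINT x|lborel. z * (u x * \<phi> x))"
    proof (rule lebesgue_integral_eq_lborel)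
      show "AE x in lebesgue. cnj (?\<phi> x) * (z * \<psi> x) = z * (u x * \<phi> x)"
        using u(2) by eventually_elim simp
    qed auto
    have "?\<phi> \<in> H2" using \<phi>' by (rule test_function_sobolev)
    from \<psi>(3)[OF this] show ?thesis
      unfolding form_h_def 1 2 3 by simp
  qed
  show ?thesis using that[OF u(1) U(1) iW nz nW] U(3) eq by blast
qed

section \<open>Representing a weak solution by a fundamental solution\<close>

lemma lborel_reflect:
  fixes f :: "'a::euclidean_space \<Rightarrow> 'b::{banach, second_countable_topology}"
  assumes [measurable]: "f \<in> borel_measurable borel"
  shows "integrable lborel (\<lambda>y. f (x - y)) \<longleftrightarrow> integrable lborel f"
    "(LINT y|lborel. f (x - y)) = integral\<^sup>L lborel f"
proof -
  have "(lborel :: 'a measure) = density (distr lborel borel (\<lambda>y. x + (-1) *\<^sub>R y)) (\<lambda>_. ennreal (\<bar>-1\<bar> ^ DIM('a)))"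
    by (rule lborel_affine) simp
  also have "\<dots> = distr lborel borel (\<lambda>y. x - y)"
    by (simp add: density_1)
  finally have d: "(lborel :: 'a measure) = distr lborel borel (\<lambda>y. x - y)" .
  have "integral\<^sup>L (distr lborel borel (\<lambda>y. x - y)) f = (LINT y|lborel. f (x - y))"
    by (subst integral_distr) auto
  then show "(LINT y|lborel. f (x - y)) = integral\<^sup>L lborel f"
    unfolding d[symmetric] by (rule sym)
  have "integrable (distr lborel borel (\<lambda>y. x - y)) f = integrable lborel (\<lambda>y. f (x - y))"
    by (subst integrable_distr_eq) auto
  then show "integrable lborel (\<lambda>y. f (x - y)) \<longleftrightarrow> integrable lborel f"
    unfolding d[symmetric] by (rule sym)
qed

lemma integrable_pair_of_section_bound:
  fixes H :: "'a::euclidean_space \<Rightarrow> 'b::euclidean_space \<Rightarrow> complex"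
  assumes G: "integrable lborel G"
    and H: "(\<lambda>(y, z). H y z) \<in> borel_measurable (lborel \<Otimes>\<^sub>M lborel)"
    and sec: "\<And>y. integrable lborel (H y)"
    and bound: "\<And>y. (LINT z|lborel. cmod (H y z)) \<le> cmod (G y) * B"
  shows "integrable (lborel \<Otimes>\<^sub>M lborel) (\<lambda>(y, z). H y z)"
proof (rule lborel_pair.Fubini_integrable[OF H])
  have "integrable lborel (\<lambda>y. LINT z|lborel. cmod (H y z))"
  proof (rule Bochner_Integration.integrable_bound)
    show "integrable lborel (\<lambda>y. cmod (G y) * B)" using G by simp
    have "(\<lambda>p. cmod (case p of (y, z) \<Rightarrow> H y z)) \<in> borel_measurable (lborel \<Otimes>\<^sub>M lborel)"
      using H by measurable
    then have "(\<lambda>(y, z). cmod (H y z)) \<in> borel_measurable (lborel \<Otimes>\<^sub>M lborel)"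
      by (simp add: split_beta')
    then show "(\<lambda>y. LINT z|lborel. cmod (H y z)) \<in> borel_measurable lborel"
      by (rule lborel.borel_measurable_lebesgue_integral)
    have "norm (LINT z|lborel. cmod (H y z)) \<le> norm (cmod (G y) * B)" for y
      using bound[of y] by (auto intro: order_trans)
    then show "AE y in lborel. norm (LINT z|lborel. cmod (H y z)) \<le> norm (cmod (G y) * B)"
      by (intro AE_I2)
  qed
  then show "integrable lborel (\<lambda>y. LINT z|lborel. norm (case (y, z) of (y, z) \<Rightarrow> H y z))" by simp
  show "AE y in lborel. integrable lborel (\<lambda>z. case (y, z) of (y, z) \<Rightarrow> H y z)"
    using sec by simp
qed

text \<open>The bound \<open>K\<close> is uniform in the translation \<open>y\<close>. After multiplication by an integrable \<open>G(y)\<close> this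
  gives integrability in \<open>(y, z)\<close>, which is what Fubini's theorem needs.\<close>

lemma L1_plus_L2_section_bound:
  fixes w1 w2 \<eta> :: "'a::euclidean_space \<Rightarrow> complex"
  assumes w1: "integrable lborel w1" and w2: "sq_integrable w2"
    and \<eta>: "sq_integrable \<eta>" "\<And>x. cmod (\<eta> x) \<le> B"
  defines "K \<equiv> B * (LINT z|lborel. cmod (w1 z)) + ((LINT z|lborel. (cmod (w2 z))\<^sup>2) + (LINT z|lborel. (cmod (\<eta> z))\<^sup>2))"
  shows "integrable lborel (\<lambda>z. (w1 z + w2 z) * \<eta> (z + y))"
    and "(LINT z|lborel. cmod ((w1 z + w2 z) * \<eta> (z + y))) \<le> K"
proof -
  have [measurable]: "w1 \<in> borel_measurable borel" "w2 \<in> borel_measurable borel" "\<eta> \<in> borel_measurable borel"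
    using w1 sq_integrableD(1)[OF w2] sq_integrableD(1)[OF \<eta>(1)] by auto
  let ?b = "\<lambda>z. B * cmod (w1 z) + ((cmod (w2 z))\<^sup>2 + (cmod (\<eta> (z + y)))\<^sup>2)"
  have i\<eta>: "integrable lborel (\<lambda>z. (cmod (\<eta> (z + y)))\<^sup>2)"
    "(LINT z|lborel. (cmod (\<eta> (z + y)))\<^sup>2) = (LINT z|lborel. (cmod (\<eta> z))\<^sup>2)"
    using lborel_translate[of "\<lambda>z. (cmod (\<eta> z))\<^sup>2" y] sq_integrableD(2)[OF \<eta>(1)] by auto
  have ib: "integrable lborel ?b"
    using w1 sq_integrableD(2)[OF w2] i\<eta>(1) by auto
  have le: "cmod ((w1 z + w2 z) * \<eta> (z + y)) \<le> ?b z" for z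
  proof -
    have "cmod ((w1 z + w2 z) * \<eta> (z + y)) \<le> cmod (w1 z * \<eta> (z + y)) + cmod (w2 z * \<eta> (z + y))"
      unfolding distrib_right by (rule norm_triangle_ineq)
    also have "cmod (w1 z * \<eta> (z + y)) \<le> B * cmod (w1 z)"
      using mult_right_mono[OF \<eta>(2)[of "z + y"], of "cmod (w1 z)"] by (simp add: norm_mult mult.commute)
    also have "cmod (w2 z * \<eta> (z + y)) \<le> (cmod (w2 z))\<^sup>2 + (cmod (\<eta> (z + y)))\<^sup>2"
      by (rule norm_mult_le_sum_squares)
    finally show ?thesis by simp
  qed
  show int: "integrable lborel (\<lambda>z. (w1 z + w2 z) * \<eta> (z + y))"
    by (rule integrable_dominated[OF ib _ le]) measurable
  have "(LINT z|lborel. cmod ((w1 z + w2 z) * \<eta> (z + y))) \<le> (LINT z|lborel. ?b z)"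
    using int ib le by (intro integral_mono) auto
  also have "\<dots> = K"
    using w1 sq_integrableD(2)[OF w2] i\<eta> by (simp add: K_def)
  finally show "(LINT z|lborel. cmod ((w1 z + w2 z) * \<eta> (z + y))) \<le> K" .
qed

text \<open>Let \<open>L\<close> be translation invariant with fundamental solution \<open>G\<close>. If \<open>u\<close> solves \<open>L u = w\<close> weakly,
  then \<open>u = G * w\<close>. Testing with \<open>\<phi>\<close> and writing \<open>\<phi>(z) = \<integral>G(y) (L\<phi>)(z + y) dy\<close> gives
  \<open>\<integral>u \<phi> = \<integral>G(y) \<integral>u(z) (L\<phi>)(z + y) dz dy = \<integral>G(y) \<integral>w(z) \<phi>(z + y) dz dy\<close> by Fubini's theorem, and the last
  expression is \<open>\<integral>(G * w) \<phi>\<close>.\<close>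

lemma weak_solution_eq_convolution:
  fixes L :: "(real ^ 'n::finite \<Rightarrow> complex) \<Rightarrow> real ^ 'n \<Rightarrow> complex"
  assumes G: "integrable lborel G"
    and u: "sq_integrable u" and w1: "integrable lborel w1" and w2: "sq_integrable w2"
    and L: "\<And>\<phi>. \<phi> \<in> test_functions \<Longrightarrow> L \<phi> \<in> test_functions"
      "\<And>\<phi> c x. \<phi> \<in> test_functions \<Longrightarrow> L (\<lambda>x. \<phi> (x + c)) x = L \<phi> (x + c)"
    and fund: "\<And>\<phi>. \<phi> \<in> test_functions \<Longrightarrow> (LINT y|lborel. G y * L \<phi> y) = \<phi> 0"
    and weak: "\<And>\<phi>. \<phi> \<in> test_functions \<Longrightarrow>
      (LINT z|lborel. u z * L \<phi> z) = (LINT z|lborel. (w1 z + w2 z) * \<phi> z)"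
  shows "AE x in lborel. u x = (LINT y|lborel. G y * (w1 (x - y) + w2 (x - y)))"
proof -
  have [measurable]: "G \<in> borel_measurable borel" "u \<in> borel_measurable borel"
    "w1 \<in> borel_measurable borel" "w2 \<in> borel_measurable borel"
    using G w1 sq_integrableD(1)[OF w2] sq_integrableD(1)[OF u] by auto
  define w where "w z = w1 z + w2 z" for z
  have [measurable]: "w \<in> borel_measurable borel" unfolding w_def by measurable
  define v where "v x = (LINT y|lborel. G y * w (x - y))" for x
  have pair: "integrable (lborel \<Otimes>\<^sub>M lborel) (\<lambda>(y, x). G y * (w (x - y) * \<eta> x))"
    if \<eta>: "sq_integrable \<eta>" "\<And>x. cmod (\<eta> x) \<le> B" for \<eta> B
  proof (rule integrable_pair_of_section_bound[OF G])
    have [measurable]: "\<eta> \<in> borel_measurable borel" using \<eta>(1) by (rule sq_integrableD)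
    note b = L1_plus_L2_section_bound[OF w1 w2 \<eta>, folded w_def]
    show "(\<lambda>(y, x). G y * (w (x - y) * \<eta> x)) \<in> borel_measurable (lborel \<Otimes>\<^sub>M lborel)"
      by (simp add: split_beta')
    fix y
    have "integrable lborel (\<lambda>x. w (x - y) * \<eta> x)"
      using lborel_translate(1)[of "\<lambda>x. w x * \<eta> (x + y)" "- y"] b(1)[of y] by simp
    then show "integrable lborel (\<lambda>x. G y * (w (x - y) * \<eta> x))" by simp
    have "(LINT x|lborel. cmod (w (x - y) * \<eta> x)) \<le> B * (LINT z|lborel. cmod (w1 z))
      + ((LINT z|lborel. (cmod (w2 z))\<^sup>2) + (LINT z|lborel. (cmod (\<eta> z))\<^sup>2))"
      using lborel_translate(2)[of "\<lambda>x. cmod (w x * \<eta> (x + y))" "- y"] b(2)[of y] by simp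
    then show "(LINT x|lborel. cmod (G y * (w (x - y) * \<eta> x))) \<le> cmod (G y) * (B * (LINT z|lborel. cmod (w1 z))
      + ((LINT z|lborel. (cmod (w2 z))\<^sup>2) + (LINT z|lborel. (cmod (\<eta> z))\<^sup>2)))"
      unfolding norm_mult[of "G y"] by (simp add: mult_left_mono)
  qed
  have v\<eta>: "integrable lborel (\<lambda>x. v x * \<eta> x)"
    "(LINT x|lborel. v x * \<eta> x) = (LINT y|lborel. G y * (LINT x|lborel. w (x - y) * \<eta> x))"
    if \<eta>: "sq_integrable \<eta>" "\<And>x. cmod (\<eta> x) \<le> B" for \<eta> B
  proof -
    note p = pair[OF \<eta>]
    have eq: "(LINT y|lborel. G y * (w (x - y) * \<eta> x)) = v x * \<eta> x" for x
      unfolding v_def mult.assoc[symmetric] by simp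
    show "integrable lborel (\<lambda>x. v x * \<eta> x)"
      using lborel_pair.integrable_snd[OF p] unfolding eq .
    show "(LINT x|lborel. v x * \<eta> x) = (LINT y|lborel. G y * (LINT x|lborel. w (x - y) * \<eta> x))"
      using lborel_pair.Fubini_integral[OF p] unfolding eq by simp
  qed
  have "AE x in lborel. u x - v x = 0"
  proof (rule AE_eq_0_if_test_integrals_eq_0)
    fix c d :: "real ^ 'n"
    have "integrable lborel (\<lambda>x. v x * indicator (box c d) x)"
      by (rule v\<eta>(1)[OF sq_integrable_indicator_box, of _ _ 1]) (auto simp: indicator_def)
    then have "set_integrable lborel (box c d) v"
      unfolding set_integrable_def by (rule Bochner_Integration.integrable_cong[THEN iffD1, rotated 2]) (auto simp: indicator_def)
    then show "set_integrable lborel (box c d) (\<lambda>x. u x - v x)"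
      using sq_integrable_imp_set_integrable_box[OF u] by (intro set_integral_diff)
  next
    fix \<phi> :: "real ^ 'n \<Rightarrow> complex" assume \<phi>: "\<phi> \<in> test_functions"
    have [measurable]: "\<phi> \<in> borel_measurable borel" "L \<phi> \<in> borel_measurable borel"
      using test_function_measurable \<phi> L(1)[OF \<phi>] by auto
    obtain B where B: "\<And>x. cmod (\<phi> x) \<le> B" using test_function_bounded[OF \<phi>] by blast
    obtain B' where B': "\<And>x. cmod (L \<phi> x) \<le> B'" using test_function_bounded[OF L(1)[OF \<phi>]] by blast
    note sq\<phi> = test_function_sq_integrable[OF \<phi>] and sqL\<phi> = test_function_sq_integrable[OF L(1)[OF \<phi>]]
    have "integrable (lborel \<Otimes>\<^sub>M lborel) (\<lambda>(y, z). G y * (u z * L \<phi> (z + y)))"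
    proof (rule integrable_pair_of_section_bound[OF G])
      note b = L1_plus_L2_section_bound[OF integrable_zero u sqL\<phi> B', simplified]
      show "(\<lambda>(y, z). G y * (u z * L \<phi> (z + y))) \<in> borel_measurable (lborel \<Otimes>\<^sub>M lborel)"
        by (simp add: split_beta')
      fix y
      show "integrable lborel (\<lambda>z. G y * (u z * L \<phi> (z + y)))" using b(1) by simp
      show "(LINT z|lborel. cmod (G y * (u z * L \<phi> (z + y)))) \<le> cmod (G y)
          * ((LINT z|lborel. (cmod (u z))\<^sup>2) + (LINT z|lborel. (cmod (L \<phi> z))\<^sup>2))"
        unfolding norm_mult[of "G y"] using b(2)[of y] by (simp add: mult_left_mono)
    qed
    from lborel_pair.Fubini_integral[OF this]
    have swap: "(LINT z|lborel. (LINT y|lborel. G y * (u z * L \<phi> (z + y))))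
        = (LINT y|lborel. (LINT z|lborel. G y * (u z * L \<phi> (z + y))))" by simp
    have inner_y: "(LINT y|lborel. G y * (u z * L \<phi> (z + y))) = u z * \<phi> z" for z
    proof -
      have "(LINT y|lborel. G y * (u z * L \<phi> (z + y))) = (LINT y|lborel. u z * (G y * L (\<lambda>x. \<phi> (x + z)) y))"
        by (simp add: L(2)[OF \<phi>] ac_simps)
      also have "\<dots> = u z * \<phi> (0 + z)"
        using fund[OF test_function_translate[OF \<phi>, of z]] by (simp only: integral_mult_right_zero)
      finally show ?thesis by simp
    qed
    have inner_z: "(LINT z|lborel. G y * (u z * L \<phi> (z + y))) = G y * (LINT x|lborel. w (x - y) * \<phi> x)" for y
    proof -
      have "(LINT z|lborel. u z * L \<phi> (z + y)) = (LINT z|lborel. w z * \<phi> (z + y))"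
        using weak[OF test_function_translate[OF \<phi>, of y]] by (simp add: L(2)[OF \<phi>] w_def)
      also have "\<dots> = (LINT x|lborel. w (x - y) * \<phi> x)"
        using lborel_translate(2)[of "\<lambda>x. w x * \<phi> (x + y)" "- y"] by simp
      finally show ?thesis by simp
    qed
    have "(LINT z|lborel. u z * \<phi> z) = (LINT x|lborel. v x * \<phi> x)"
      using swap unfolding inner_y inner_z v\<eta>(2)[OF sq\<phi> B] .
    then show "(LINT x|lborel. (u x - v x) * \<phi> x) = 0"
      using v\<eta>(1)[OF sq\<phi> B] sq_integrable_mult[OF u sq\<phi>] by (simp add: left_diff_distrib)
  qed
  then show ?thesis by eventually_elim (simp add: v_def w_def)
qed

text \<open>A distributional fundamental solution of \<open>m - \<Delta>\<close>; below, \<open>m\<close> is always a square \<open>\<kappa>\<^sup>2\<close> with \<open>Re \<kappa> > 0\<close>.\<close>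

definition fundamental_solution :: "complex \<Rightarrow> (real ^ 'n::finite \<Rightarrow> complex) \<Rightarrow> bool" where
  "fundamental_solution m g \<longleftrightarrow> integrable lborel g \<and>
    (\<forall>\<phi>\<in>test_functions. (LINT y|lborel. g y * (m * \<phi> y - lap \<phi> y)) = \<phi> 0)"

text \<open>The Sobolev embedding \<open>H\<^sup>2 \<subseteq> L\<^sup>\<infinity>\<close>: here \<open>u = g * (u - U)\<close> is a convolution of two \<open>L\<^sup>2\<close> functions. A
  square integrable kernel of \<open>(1 - \<Delta>)\<^sup>-\<^sup>1\<close> exists exactly in dimension at most 3.\<close>

lemma H2_essentially_bounded:
  fixes g u U :: "real ^ 'n::finite \<Rightarrow> complex"
  assumes g: "fundamental_solution 1 g" "sq_integrable g"
    and u: "sq_integrable u" and U: "sq_integrable U"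
    and weak: "\<And>\<phi>. \<phi> \<in> test_functions \<Longrightarrow> (LINT x|lborel. u x * lap \<phi> x) = (LINT x|lborel. U x * \<phi> x)"
  obtains M where "M > 0" "AE x in lborel. cmod (u x) \<le> M"
proof -
  have [measurable]: "g \<in> borel_measurable borel" "u \<in> borel_measurable borel" "U \<in> borel_measurable borel"
    using g(2) u U by (auto dest: sq_integrableD)
  define w where "w z = u z - U z" for z
  have w: "sq_integrable w"
    using sq_integrable_add[OF u sq_integrable_cmult[OF U, of "-1"]] by (simp add: w_def[abs_def])
  have [measurable]: "w \<in> borel_measurable borel" using w by (rule sq_integrableD)
  have "AE x in lborel. u x = (LINT y|lborel. g y * (0 + w (x - y)))"
  proof (rule weak_solution_eq_convolution[where L = "\<lambda>\<phi> x. 1 * \<phi> x - lap \<phi> x"])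
    show "integrable lborel g" using g(1) by (simp add: fundamental_solution_def)
    fix \<phi> :: "real ^ 'n \<Rightarrow> complex" assume \<phi>: "\<phi> \<in> test_functions"
    show "(\<lambda>x. 1 * \<phi> x - lap \<phi> x) \<in> test_functions"
      using test_function_add[OF \<phi> test_function_cmult[OF test_function_lap[OF \<phi>], of "-1"]] by simp
    show "1 * \<phi> (x + c) - lap (\<lambda>x. \<phi> (x + c)) x = 1 * \<phi> (x + c) - lap \<phi> (x + c)" for x c
      by (simp add: lap_translate[OF \<phi>])
    show "(LINT y|lborel. g y * (1 * \<phi> y - lap \<phi> y)) = \<phi> 0"
      using g(1) \<phi> by (simp add: fundamental_solution_def)
    have "integrable lborel (\<lambda>x. u x * \<phi> x)" "integrable lborel (\<lambda>x. U x * \<phi> x)" "integrable lborel (\<lambda>x. u x * lap \<phi> x)"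
      using u U test_function_sq_integrable[OF \<phi>] test_function_sq_integrable[OF test_function_lap[OF \<phi>]]
      by (auto intro: sq_integrable_mult)
    then show "(LINT z|lborel. u z * (1 * \<phi> z - lap \<phi> z)) = (LINT z|lborel. (0 + w z) * \<phi> z)"
      using weak[OF \<phi>] by (simp add: w_def left_diff_distrib right_diff_distrib)
  qed (use u w in auto)
  moreover define M where "M = 1 + ((LINT y|lborel. (cmod (g y))\<^sup>2) + (LINT y|lborel. (cmod (w y))\<^sup>2))"
  have "cmod (LINT y|lborel. g y * (0 + w (x - y))) \<le> M" for x
  proof -
    have r: "integrable lborel (\<lambda>y. (cmod (w (x - y)))\<^sup>2)"
      "(LINT y|lborel. (cmod (w (x - y)))\<^sup>2) = (LINT y|lborel. (cmod (w y))\<^sup>2)"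
      using lborel_reflect[of "\<lambda>y. (cmod (w y))\<^sup>2" x] sq_integrableD(2)[OF w] by auto
    have "cmod (LINT y|lborel. g y * (0 + w (x - y))) \<le> (LINT y|lborel. (cmod (g y))\<^sup>2 + (cmod (w (x - y)))\<^sup>2)"
      using r(1) sq_integrableD(2)[OF g(2)]
      by (intro Bochner_Integration.integral_norm_bound_integral) (auto intro!: norm_mult_le_sum_squares sq_integrable_mult simp: sq_integrable_def)
    then show ?thesis
      using r sq_integrableD(2)[OF g(2)] by (simp add: M_def)
  qed
  ultimately have "AE x in lborel. cmod (u x) \<le> M" by (auto elim: eventually_mono)
  moreover have "M > 0" unfolding M_def by (intro add_pos_nonneg) auto
  ultimately show ?thesis using that by blast
qed

section \<open>From a bounded kernel to the eigenvalue bound\<close>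

text \<open>Split \<open>u\<close> by the size of its values: the part where \<open>\<bar>u\<bar> > d\<close> lies in \<open>L\<^sup>1\<close> and is paired with
  \<open>\<parallel>G\<parallel>\<^sub>\<infinity> \<le> A\<close>, and for small \<open>d\<close> the remaining part has \<open>L\<^sup>2\<close> norm below \<open>e\<close> and is paired with
  \<open>\<parallel>G\<parallel>\<^sub>2 \<le> (A \<parallel>G\<parallel>\<^sub>1)\<^sup>1\<^sup>/\<^sup>2\<close>. The constant \<open>K\<close> depends on \<open>u\<close> and \<open>e\<close>, not on \<open>G\<close>.\<close>

lemma convolution_bound_small_L2:
  fixes u :: "'a::euclidean_space \<Rightarrow> complex"
  assumes u: "sq_integrable u" and e: "e > 0"
  obtains K where "K \<ge> 0" "\<And>G A J x. integrable lborel G \<Longrightarrow> (\<And>y. cmod (G y) \<le> A) \<Longrightarrow>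
    (LINT y|lborel. cmod (G y)) \<le> J \<Longrightarrow> A > 0 \<Longrightarrow> J > 0 \<Longrightarrow>
    cmod (LINT y|lborel. G y * u (x - y)) \<le> A * K + e * sqrt (A * J)"
proof -
  have [measurable]: "u \<in> borel_measurable borel" using u by (rule sq_integrableD)
  define small where "small d x = (if cmod (u x) \<le> d then (cmod (u x))\<^sup>2 else 0)" for d x
  have [measurable]: "small d \<in> borel_measurable borel" for d unfolding small_def[abs_def] by measurable
  have small_le: "0 \<le> small d x" "small d x \<le> (cmod (u x))\<^sup>2" for d x by (auto simp: small_def)
  have small_int: "integrable lborel (small d)" for d
    by (rule Bochner_Integration.integrable_bound[OF sq_integrableD(2)[OF u]]) (auto simp: small_le)
  have "(\<lambda>n. LINT x|lborel. small (1 / Suc n) x) \<longlonglongrightarrow> (LINT x|(lborel :: 'a measure). (0 :: real))"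
  proof (rule integral_dominated_convergence[OF _ _ sq_integrableD(2)[OF u]])
    have "(\<lambda>n. small (1 / Suc n) x) \<longlonglongrightarrow> 0" for x
    proof (cases "u x = 0")
      case True
      then show ?thesis by (simp add: small_def)
    next
      case False
      have "\<forall>\<^sub>F n in sequentially. 1 / Suc n < cmod (u x)"
        using order_tendstoD(2)[OF LIMSEQ_inverse_real_of_nat, of "cmod (u x)"] False by (simp add: inverse_eq_divide)
      then have "\<forall>\<^sub>F n in sequentially. small (1 / Suc n) x = 0"
        by eventually_elim (simp add: small_def)
      then show ?thesis by (rule tendsto_eventually)
    qed
    then show "AE x in lborel. (\<lambda>n. small (1 / Suc n) x) \<longlonglongrightarrow> 0" by simp
    show "AE x in lborel. norm (small (1 / Suc n) x) \<le> (cmod (u x))\<^sup>2" for n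
      using small_le by simp
  qed auto
  then have "(\<lambda>n. LINT x|lborel. small (1 / Suc n) x) \<longlonglongrightarrow> 0" by simp
  from order_tendstoD(2)[OF this, of "e\<^sup>2"] e
  have "\<forall>\<^sub>F n in sequentially. (LINT x|lborel. small (1 / Suc n) x) < e\<^sup>2" by simp
  then obtain n :: nat where n: "(LINT x|lborel. small (1 / Suc n) x) < e\<^sup>2"
    by (auto simp: eventually_sequentially)
  define d where "d = 1 / real (Suc n)"
  have d: "d > 0" "(LINT x|lborel. small d x) < e\<^sup>2" using n by (auto simp: d_def)
  define large where "large x = (if cmod (u x) \<le> d then 0 else cmod (u x))" for x
  have [measurable]: "large \<in> borel_measurable borel" unfolding large_def[abs_def] by measurable
  have large0: "0 \<le> large x" for x by (simp add: large_def)
  have large_int: "integrable lborel large"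
  proof (rule Bochner_Integration.integrable_bound)
    show "integrable lborel (\<lambda>x. (cmod (u x))\<^sup>2 / d)" using sq_integrableD(2)[OF u] by simp
    have "large x \<le> (cmod (u x))\<^sup>2 / d" for x
    proof (cases "cmod (u x) \<le> d")
      case False
      then have "d * cmod (u x) \<le> cmod (u x) * cmod (u x)" by (intro mult_right_mono) auto
      then show ?thesis using d(1) False by (simp add: large_def field_simps power2_eq_square)
    qed (use d in \<open>simp add: large_def\<close>)
    then show "AE x in lborel. norm (large x) \<le> norm ((cmod (u x))\<^sup>2 / d)"
      using large0 d(1) by (intro AE_I2) (simp add: abs_of_nonneg)
  qed simp
  define K where "K = (LINT x|lborel. large x)"
  have "cmod (LINT y|lborel. G y * u (x - y)) \<le> A * K + e * sqrt (A * J)"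
    if G: "integrable lborel G" and A: "\<And>y. cmod (G y) \<le> A" and J: "(LINT y|lborel. cmod (G y)) \<le> J"
      and pos: "A > 0" "J > 0" for G :: "'a \<Rightarrow> complex" and A J x
  proof -
    have [measurable]: "G \<in> borel_measurable borel" using G by auto
    \<comment> \<open>the weight that optimises the arithmetic-geometric mean bound of the \<open>L\<^sup>2\<close> pairing\<close>
    define t where "t = e / sqrt (A * J)"
    have t: "t > 0" using e pos by (simp add: t_def)
    let ?b = "\<lambda>y. A * large (x - y) + (t * A * cmod (G y) + small d (x - y) / t) / 2"
    have le: "cmod (G y * u (x - y)) \<le> ?b y" for y
    proof (cases "cmod (u (x - y)) \<le> d")
      case True
      define a b where "a = cmod (G y)" and "b = cmod (u (x - y))"
      have "0 \<le> (t * a - b)\<^sup>2" by simp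
      then have "2 * (t * (a * b)) \<le> t * (t * (a * a)) + b * b"
        by (simp add: power2_eq_square algebra_simps)
      then have "2 * (a * b) \<le> t * (a * a) + b * b / t"
        using t by (simp add: field_simps)
      also have "a * a \<le> A * a" using A[of y] by (intro mult_right_mono) (auto simp: a_def)
      finally have "2 * (a * b) \<le> t * (A * a) + b * b / t" using t by simp
      then show ?thesis using True
        by (simp add: large_def small_def a_def b_def norm_mult power2_eq_square ac_simps)
    next
      case False
      have "cmod (G y * u (x - y)) \<le> A * cmod (u (x - y))"
        unfolding norm_mult using A by (intro mult_right_mono) auto
      moreover have "0 \<le> t * A * cmod (G y)" using t pos by simp
      ultimately show ?thesis using False by (simp add: large_def small_def)
    qed
    have rl: "integrable lborel (\<lambda>y. large (x - y))" "(LINT y|lborel. large (x - y)) = K"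
      using lborel_reflect[of large x] large_int by (auto simp: K_def)
    have rs: "integrable lborel (\<lambda>y. small d (x - y))" "(LINT y|lborel. small d (x - y)) = (LINT y|lborel. small d y)"
      using lborel_reflect[of "small d" x] small_int by auto
    have ib: "integrable lborel ?b" using rl(1) rs(1) G by auto
    have "integrable lborel (\<lambda>y. G y * u (x - y))"
      by (rule integrable_dominated[OF ib _ le]) measurable
    then have "cmod (LINT y|lborel. G y * u (x - y)) \<le> (LINT y|lborel. ?b y)"
      using ib le by (intro Bochner_Integration.integral_norm_bound_integral) auto
    also have "\<dots> = A * K + (t * A * (LINT y|lborel. cmod (G y)) + (LINT y|lborel. small d y) / t) / 2"
      using rl rs G by simp
    also have "\<dots> \<le> A * K + (t * A * J + e\<^sup>2 / t) / 2"
      using J d(2) t pos by (intro add_left_mono divide_right_mono add_mono mult_left_mono) auto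
    also have "t * A * J = e * sqrt (A * J)"
    proof -
      have "t * sqrt (A * J) = e" using pos by (simp add: t_def)
      then have "t * (sqrt (A * J) * sqrt (A * J)) = e * sqrt (A * J)" by (metis mult.assoc)
      then show ?thesis using pos by (simp add: mult.assoc)
    qed
    also have "e\<^sup>2 / t = e * sqrt (A * J)"
      using e by (simp add: t_def power2_eq_square)
    finally show ?thesis by simp
  qed
  moreover have "K \<ge> 0" unfolding K_def using large0 by (intro integral_nonneg_AE) auto
  ultimately show ?thesis using that by blast
qed

text \<open>The factorisation \<open>\<Delta>\<^sup>2 - k\<^sup>4 = (-\<Delta> - k\<^sup>2)(-\<Delta> + k\<^sup>2)\<close> turns two second-order fundamental solutions
  into a fourth-order one by partial fractions.\<close>

lemma biharmonic_fundamental_solution: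
  fixes g1 g2 :: "real ^ 'n::finite \<Rightarrow> complex"
  assumes g: "fundamental_solution (- (k\<^sup>2)) g1" "fundamental_solution (k\<^sup>2) g2" and k: "k \<noteq> 0"
    and \<phi>: "\<phi> \<in> test_functions"
  shows "(LINT y|lborel. (g1 y - g2 y) / (2 * k\<^sup>2) * (lap (lap \<phi>) y + (- (k ^ 4)) * \<phi> y)) = \<phi> 0"
proof -
  let ?L = "\<lambda>y. lap (lap \<phi>) y + (- (k ^ 4)) * \<phi> y"
  have lap\<phi>: "lap \<phi> \<in> test_functions" using \<phi> by (rule test_function_lap)
  define \<eta> where "\<eta> c = (\<lambda>x. c * \<phi> x + (-1) * lap \<phi> x)" for c
  have \<eta>: "\<eta> c \<in> test_functions" for c
    unfolding \<eta>_def by (intro test_function_add test_function_cmult \<phi> lap\<phi>)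
  have lap\<eta>: "lap (\<eta> c) = (\<lambda>x. c * lap \<phi> x + (-1) * lap (lap \<phi>) x)" for c
    unfolding \<eta>_def lap_add[OF test_function_cmult[OF \<phi>] test_function_cmult[OF lap\<phi>]]
    lap_cmult[OF \<phi>] lap_cmult[OF lap\<phi>] ..
  have L: "?L \<in> test_functions"
    by (intro test_function_add test_function_cmult test_function_lap lap\<phi> \<phi>)
  have factor: "- (k\<^sup>2) * \<eta> (k\<^sup>2) y - lap (\<eta> (k\<^sup>2)) y = ?L y"
    "k\<^sup>2 * \<eta> (- (k\<^sup>2)) y - lap (\<eta> (- (k\<^sup>2))) y = ?L y" for y
    unfolding lap\<eta> by (simp_all add: \<eta>_def algebra_simps power2_eq_square power4_eq_xxxx)
  have 1: "(LINT y|lborel. g1 y * ?L y) = \<eta> (k\<^sup>2) 0"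
  proof -
    have "(LINT y|lborel. g1 y * (- (k\<^sup>2) * \<eta> (k\<^sup>2) y - lap (\<eta> (k\<^sup>2)) y)) = \<eta> (k\<^sup>2) 0"
      using g(1) \<eta>[of "k\<^sup>2"] unfolding fundamental_solution_def by blast
    then show ?thesis unfolding factor .
  qed
  have 2: "(LINT y|lborel. g2 y * ?L y) = \<eta> (- (k\<^sup>2)) 0"
  proof -
    have "(LINT y|lborel. g2 y * (k\<^sup>2 * \<eta> (- (k\<^sup>2)) y - lap (\<eta> (- (k\<^sup>2))) y)) = \<eta> (- (k\<^sup>2)) 0"
      using g(2) \<eta>[of "- (k\<^sup>2)"] unfolding fundamental_solution_def by blast
    then show ?thesis unfolding factor .
  qed
  obtain B where B: "\<And>x. cmod (?L x) \<le> B" using test_function_bounded[OF L] by blast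
  have int: "integrable lborel (\<lambda>y. h y * ?L y)" if "integrable lborel h" for h
    using that B test_function_measurable[OF L] by (intro integrable_mult_bounded) auto
  have "(LINT y|lborel. (g1 y - g2 y) / (2 * k\<^sup>2) * ?L y)
      = (LINT y|lborel. (g1 y * ?L y - g2 y * ?L y) / (2 * k\<^sup>2))"
    by (intro Bochner_Integration.integral_cong) (auto simp: field_simps)
  also have "\<dots> = (\<eta> (k\<^sup>2) 0 - \<eta> (- (k\<^sup>2)) 0) / (2 * k\<^sup>2)"
    using int g by (simp only: integral_divide_zero Bochner_Integration.integral_diff 1 2 fundamental_solution_def)
  also have "\<dots> = \<phi> 0"
    using k by (simp add: \<eta>_def)
  finally show ?thesis .
qed

text \<open>With \<open>G\<close> the fundamental solution of \<open>\<Delta>\<^sup>2 - k\<^sup>4\<close>, the eigenvalue equation reads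
  \<open>u = - G * (W u) + (z - k\<^sup>4) (G * u)\<close>. The first term is at most \<open>\<parallel>G\<parallel>\<^sub>\<infinity> \<parallel>W\<parallel>\<^sub>1 \<parallel>u\<parallel>\<^sub>\<infinity>\<close>; the second is an error
  term.\<close>

lemma eigenfunction_pointwise_bound:
  fixes u W g1 g2 :: "real ^ 'n::finite \<Rightarrow> complex"
  assumes u: "sq_integrable u" and W: "integrable lborel W"
    and weak: "\<And>\<phi>. \<phi> \<in> test_functions \<Longrightarrow>
      (LINT x|lborel. u x * lap (lap \<phi>) x) + (LINT x|lborel. W x * u x * \<phi> x) = z * (LINT x|lborel. u x * \<phi> x)"
    and M: "AE x in lborel. cmod (u x) \<le> M" "M \<ge> 0"
    and g: "fundamental_solution (- (k\<^sup>2)) g1" "fundamental_solution (k\<^sup>2) g2" and k: "k \<noteq> 0"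
    and A: "\<And>x. cmod (g1 x - g2 x) \<le> 2 * A * (cmod k)\<^sup>2" "A > 0"
    and J: "(LINT x|lborel. cmod (g1 x)) \<le> J * (cmod k)\<^sup>2" "(LINT x|lborel. cmod (g2 x)) \<le> J * (cmod k)\<^sup>2" "J > 0"
    and K: "\<And>G x. integrable lborel G \<Longrightarrow> (\<And>y. cmod (G y) \<le> A) \<Longrightarrow> (LINT y|lborel. cmod (G y)) \<le> J \<Longrightarrow>
      cmod (LINT y|lborel. G y * u (x - y)) \<le> B"
  shows "AE x in lborel. cmod (u x) \<le> A * (LINT x|lborel. cmod (W x)) * M + cmod (z - k ^ 4) * B"
proof -
  have [measurable]: "u \<in> borel_measurable borel" "W \<in> borel_measurable borel"
    using sq_integrableD(1)[OF u] W by auto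
  have ig: "integrable lborel g1" "integrable lborel g2" using g by (auto simp: fundamental_solution_def)
  define G where "G y = (g1 y - g2 y) / (2 * k\<^sup>2)" for y
  have iG: "integrable lborel G" unfolding G_def using ig by simp
  then have [measurable]: "G \<in> borel_measurable borel" by auto
  have Gle: "cmod (G y) \<le> A" for y
    using A(1)[of y] k by (simp add: G_def norm_divide norm_mult norm_power field_simps)
  have GJ: "(LINT y|lborel. cmod (G y)) \<le> J"
  proof -
    have "(LINT y|lborel. cmod (G y)) \<le> (LINT y|lborel. (cmod (g1 y) + cmod (g2 y)) / (2 * (cmod k)\<^sup>2))"
      using iG ig by (intro integral_mono)
        (auto simp: G_def norm_divide norm_mult norm_power intro!: divide_right_mono norm_triangle_ineq4)
    also have "\<dots> = ((LINT y|lborel. cmod (g1 y)) + (LINT y|lborel. cmod (g2 y))) / (2 * (cmod k)\<^sup>2)"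
      using ig by simp
    also have "\<dots> \<le> (J * (cmod k)\<^sup>2 + J * (cmod k)\<^sup>2) / (2 * (cmod k)\<^sup>2)"
      using J by (intro divide_right_mono add_mono) auto
    also have "\<dots> = J" using k by simp
    finally show ?thesis .
  qed
  have sqG: "sq_integrable G"
    unfolding sq_integrable_def
  proof
    show "integrable lborel (\<lambda>y. (cmod (G y))\<^sup>2)"
    proof (rule Bochner_Integration.integrable_bound)
      show "integrable lborel (\<lambda>y. A * cmod (G y))" using iG by simp
      show "AE y in lborel. norm ((cmod (G y))\<^sup>2) \<le> norm (A * cmod (G y))"
        using Gle A(2) by (intro AE_I2) (auto simp: power2_eq_square intro!: mult_right_mono)
    qed measurable
  qed measurable
  define w1 where "w1 x = - (W x * u x)" for x
  define w2 where "w2 x = (z - k ^ 4) * u x" for x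
  have w1le: "AE x in lborel. cmod (w1 x) \<le> M * cmod (W x)"
    using M(1) by eventually_elim (simp add: w1_def norm_mult mult.commute[of M] mult_left_mono)
  have iw1: "integrable lborel w1"
  proof (rule Bochner_Integration.integrable_bound)
    show "integrable lborel (\<lambda>x. M * cmod (W x))" using W by simp
    show "AE x in lborel. cmod (w1 x) \<le> norm (M * cmod (W x))"
      using w1le by eventually_elim (use M(2) in simp)
  qed (simp add: w1_def[abs_def])
  then have [measurable]: "w1 \<in> borel_measurable borel" by auto
  have sqw2: "sq_integrable w2"
    using sq_integrableD(2)[OF u] by (simp add: sq_integrable_def w2_def[abs_def] norm_mult power_mult_distrib)
  have rep: "AE x in lborel. u x = (LINT y|lborel. G y * (w1 (x - y) + w2 (x - y)))"
  proof (rule weak_solution_eq_convolution[where L = "\<lambda>\<phi> x. lap (lap \<phi>) x + (- (k ^ 4)) * \<phi> x", OF iG u iw1 sqw2])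
    fix \<phi> :: "real ^ 'n \<Rightarrow> complex" assume \<phi>: "\<phi> \<in> test_functions"
    note lap\<phi> = test_function_lap[OF \<phi>]
    note laplap\<phi> = test_function_lap[OF lap\<phi>]
    show "(\<lambda>x. lap (lap \<phi>) x + (- (k ^ 4)) * \<phi> x) \<in> test_functions"
      by (intro test_function_add test_function_cmult laplap\<phi> \<phi>)
    show "lap (lap (\<lambda>x. \<phi> (x + c))) x + (- (k ^ 4)) * \<phi> (x + c) = lap (lap \<phi>) (x + c) + (- (k ^ 4)) * \<phi> (x + c)" for c x
      by (simp only: lap_translate[OF \<phi>] lap_translate[OF lap\<phi>])
    show "(LINT y|lborel. G y * (lap (lap \<phi>) y + (- (k ^ 4)) * \<phi> y)) = \<phi> 0"
      unfolding G_def by (rule biharmonic_fundamental_solution[OF g k \<phi>])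
    have i1: "integrable lborel (\<lambda>x. u x * lap (lap \<phi>) x)" "integrable lborel (\<lambda>x. u x * \<phi> x)"
      using u \<phi> laplap\<phi> by (auto intro: sq_integrable_mult test_function_sq_integrable)
    obtain b where b: "\<And>x. cmod (\<phi> x) \<le> b" using test_function_bounded[OF \<phi>] by blast
    have i2: "integrable lborel (\<lambda>x. W x * u x * \<phi> x)"
    proof -
      have "integrable lborel (\<lambda>x. - w1 x * \<phi> x)"
        using iw1 b test_function_measurable[OF \<phi>] by (intro integrable_mult_bounded) auto
      then show ?thesis by (simp add: w1_def)
    qed
    have "(LINT x|lborel. u x * (lap (lap \<phi>) x + (- (k ^ 4)) * \<phi> x))
        = (LINT x|lborel. u x * lap (lap \<phi>) x + (- (k ^ 4)) * (u x * \<phi> x))"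
      by (intro Bochner_Integration.integral_cong) (auto simp: algebra_simps)
    also have "\<dots> = (LINT x|lborel. u x * lap (lap \<phi>) x) + (- (k ^ 4)) * (LINT x|lborel. u x * \<phi> x)"
      using i1 by simp
    also have "\<dots> = (z - k ^ 4) * (LINT x|lborel. u x * \<phi> x) - (LINT x|lborel. W x * u x * \<phi> x)"
      using weak[OF \<phi>] by (simp add: algebra_simps)
    also have "\<dots> = (LINT x|lborel. (z - k ^ 4) * (u x * \<phi> x) - W x * u x * \<phi> x)"
      using i1 i2 by simp
    also have "\<dots> = (LINT x|lborel. (w1 x + w2 x) * \<phi> x)"
      by (intro Bochner_Integration.integral_cong) (auto simp: w1_def w2_def algebra_simps)
    finally show "(LINT x|lborel. u x * (lap (lap \<phi>) x + (- (k ^ 4)) * \<phi> x)) = (LINT x|lborel. (w1 x + w2 x) * \<phi> x)" .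
  qed
  have bound: "cmod (LINT y|lborel. G y * (w1 (x - y) + w2 (x - y)))
      \<le> A * (LINT x|lborel. cmod (W x)) * M + cmod (z - k ^ 4) * B" for x
  proof -
    have r1: "integrable lborel (\<lambda>y. w1 (x - y))" using lborel_reflect(1)[of w1 x] iw1 by simp
    have r1': "(LINT y|lborel. cmod (w1 (x - y))) = (LINT y|lborel. cmod (w1 y))"
      using lborel_reflect(2)[of "\<lambda>y. cmod (w1 y)" x] by simp
    have le1: "cmod (G y * w1 (x - y)) \<le> A * cmod (w1 (x - y))" for y
      unfolding norm_mult using Gle by (intro mult_right_mono) auto
    have i1: "integrable lborel (\<lambda>y. G y * w1 (x - y))"
      by (rule integrable_dominated[OF _ _ le1]) (use r1 in auto)
    have "sq_integrable (\<lambda>y. u (x - y))"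
      using lborel_reflect(1)[of "\<lambda>y. (cmod (u y))\<^sup>2" x] sq_integrableD(2)[OF u] by (simp add: sq_integrable_def)
    from sq_integrable_mult[OF sqG this] have i2: "integrable lborel (\<lambda>y. G y * u (x - y))" .
    have "(LINT y|lborel. G y * (w1 (x - y) + w2 (x - y)))
        = (LINT y|lborel. G y * w1 (x - y) + (z - k ^ 4) * (G y * u (x - y)))"
      by (intro Bochner_Integration.integral_cong) (auto simp: w2_def algebra_simps)
    also have "\<dots> = (LINT y|lborel. G y * w1 (x - y)) + (z - k ^ 4) * (LINT y|lborel. G y * u (x - y))"
      using i1 i2 by simp
    finally have "cmod (LINT y|lborel. G y * (w1 (x - y) + w2 (x - y)))
        \<le> cmod (LINT y|lborel. G y * w1 (x - y)) + cmod (z - k ^ 4) * cmod (LINT y|lborel. G y * u (x - y))"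
      using norm_triangle_ineq[of "LINT y|lborel. G y * w1 (x - y)" "(z - k ^ 4) * (LINT y|lborel. G y * u (x - y))"]
      by (simp only: norm_mult)
    also have "cmod (LINT y|lborel. G y * w1 (x - y)) \<le> (LINT y|lborel. A * cmod (w1 (x - y)))"
      using i1 r1 le1 by (intro Bochner_Integration.integral_norm_bound_integral) auto
    also have "\<dots> = A * (LINT y|lborel. cmod (w1 y))"
      using r1' by simp
    also have "(LINT y|lborel. cmod (w1 y)) \<le> (LINT y|lborel. M * cmod (W y))"
      using iw1 W w1le by (intro integral_mono_AE) auto
    also have "\<dots> = (LINT y|lborel. cmod (W y)) * M" by simp
    also have "cmod (LINT y|lborel. G y * u (x - y)) \<le> B"
      by (rule K[OF iG Gle GJ])
    finally show ?thesis using A(2) by (simp add: mult.assoc mult_left_mono)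
  qed
  show ?thesis using rep by eventually_elim (use bound in simp)
qed

lemma norm_power4_diff_le:
  fixes a b :: complex
  assumes "cmod a \<le> R" "cmod b \<le> R"
  shows "cmod (a ^ 4 - b ^ 4) \<le> 4 * R ^ 3 * cmod (a - b)"
proof -
  have R: "0 \<le> R" using assms(1) norm_ge_zero order_trans by blast
  have eq: "a ^ 4 - b ^ 4 = (a - b) * (a ^ 3 + a ^ 2 * b + a * b ^ 2 + b ^ 3)"
    by (simp add: algebra_simps power2_eq_square power3_eq_cube power4_eq_xxxx)
  have "cmod (a ^ 3 + a ^ 2 * b + a * b ^ 2 + b ^ 3)
      \<le> cmod a ^ 3 + cmod a ^ 2 * cmod b + cmod a * cmod b ^ 2 + cmod b ^ 3"
    by (intro norm_triangle_le add_mono) (auto simp: norm_mult norm_power)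
  also have "\<dots> \<le> R ^ 3 + R ^ 2 * R + R * R ^ 2 + R ^ 3"
    using assms R by (intro add_mono mult_mono power_mono) auto
  also have "\<dots> = 4 * R ^ 3" by (simp add: power2_eq_square power3_eq_cube)
  finally show ?thesis
    unfolding eq norm_mult by (simp add: mult.commute mult_left_mono)
qed

text \<open>Let \<open>k\<^sub>0\<close> be the fourth root of the eigenvalue \<open>z\<close> in the closed first quadrant. If \<open>z > 0\<close>, then \<open>z\<close>
  lies in the spectrum of \<open>\<Delta>\<^sup>2\<close>, and \<open>\<Delta>\<^sup>2 - z\<close> has no fundamental solution in \<open>L\<^sup>1\<close> or \<open>L\<^sup>2\<close>. Therefore \<open>k\<^sub>0\<close>
  is approximated by \<open>k = k\<^sub>0 + (1 + i) t\<close> with \<open>t \<rightarrow> 0\<close>. Here \<open>\<parallel>G\<^sub>k\<parallel>\<^sub>1 = O(t\<^sup>-\<^sup>2)\<close>, hence \<open>\<parallel>G\<^sub>k\<parallel>\<^sub>2 = O(t\<^sup>-\<^sup>1)\<close>,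
  while \<open>z - k\<^sup>4 = O(t)\<close>. So the error term \<open>(z - k\<^sup>4) (G\<^sub>k * u)\<close> stays bounded, and it tends to \<open>0\<close> because
  \<open>u\<close> is the sum of an \<open>L\<^sup>1\<close> function and a function of arbitrarily small \<open>L\<^sup>2\<close> norm. What remains is
  \<open>\<parallel>u\<parallel>\<^sub>\<infinity> \<le> A \<parallel>V\<parallel>\<^sub>1 \<parallel>u\<parallel>\<^sub>\<infinity>\<close>, and \<open>u\<close> is bounded and does not vanish almost everywhere.\<close>

lemma eigenvalue_bound_of_kernels:
  fixes V :: "real ^ 'n::finite \<Rightarrow> complex" and g :: "complex \<Rightarrow> real ^ 'n \<Rightarrow> complex"
  assumes V: "integrable lebesgue V" and z: "z \<in> point_spectrum V" and r: "cmod z = r ^ 4" "r > 0"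
    and fs: "\<And>\<kappa>. Re \<kappa> > 0 \<Longrightarrow> fundamental_solution (\<kappa>\<^sup>2) (g \<kappa>)"
    and L1: "\<And>\<kappa>. Re \<kappa> > 0 \<Longrightarrow> (LINT x|lborel. cmod (g \<kappa> x)) \<le> 1 / (Re \<kappa>)\<^sup>2"
    and sq: "sq_integrable (g 1)"
    and A: "\<And>k x. Re k > 0 \<Longrightarrow> Im k > 0 \<Longrightarrow> cmod k \<ge> r \<Longrightarrow> cmod (g (- \<i> * k) x - g k x) \<le> 2 * A * (cmod k)\<^sup>2"
      "A > 0"
  shows "1 \<le> A * L1_norm V"
proof (rule ccontr)
  assume "\<not> 1 \<le> A * L1_norm V"
  obtain u U W :: "real ^ 'n \<Rightarrow> complex" where uUW: "sq_integrable u" "sq_integrable U" "integrable lborel W"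
    "\<not> (AE x in lborel. u x = 0)" "(LINT x|lborel. cmod (W x)) = L1_norm V"
    "\<And>\<phi>. \<phi> \<in> test_functions \<Longrightarrow> (LINT x|lborel. u x * lap \<phi> x) = (LINT x|lborel. U x * \<phi> x)"
    "\<And>\<phi>. \<phi> \<in> test_functions \<Longrightarrow>
      (LINT x|lborel. u x * lap (lap \<phi>) x) + (LINT x|lborel. W x * u x * \<phi> x) = z * (LINT x|lborel. u x * \<phi> x)"
    using eigenfunction_weak_equations[OF V z] by blast
  have fs1: "fundamental_solution 1 (g 1)" using fs[of 1] by simp
  obtain M where M: "M > 0" "AE x in lborel. cmod (u x) \<le> M"
    using H2_essentially_bounded[OF fs1 sq uUW(1,2,6)] by blast
  define q where "q = A * L1_norm V"
  have q: "0 \<le> q" "q < 1"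
    using \<open>\<not> 1 \<le> A * L1_norm V\<close> A(2) by (auto simp: q_def L1_norm_def intro!: mult_nonneg_nonneg integral_nonneg_AE)
  define k0 where "k0 = of_real r * cis (Arg2pi z / 4)"
  have z0: "z \<noteq> 0" using r by auto
  have k0: "k0 ^ 4 = z" "cmod k0 = r" "Re k0 \<ge> 0" "Im k0 \<ge> 0"
  proof -
    have "cis (Arg2pi z / 4) ^ 4 = cis (Arg2pi z)"
      by (subst Complex.DeMoivre) simp
    then have "k0 ^ 4 = of_real (r ^ 4) * cis (Arg2pi z)"
      by (simp add: k0_def power_mult_distrib)
    also have "\<dots> = z"
      using Arg2pi_eq[of z] r(1)[symmetric] by (simp add: cis_conv_exp mult.commute)
    finally show "k0 ^ 4 = z" .
    show "cmod k0 = r" using r(2) by (simp add: k0_def norm_mult)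
    have "0 \<le> Arg2pi z / 4" "Arg2pi z / 4 < pi / 2"
      using Arg2pi_ge_0[of z] Arg2pi_lt_2pi[of z] by auto
    then show "Re k0 \<ge> 0" "Im k0 \<ge> 0"
      using r(2) cos_ge_zero[of "Arg2pi z / 4"] sin_ge_zero[of "Arg2pi z / 4"] by (auto simp: k0_def)
  qed
  define D where "D = 4 * (r + 2) ^ 3 * 2"
  have D: "D > 0" using r(2) by (simp add: D_def)
  have one_step: "AE x in lborel. cmod (u x) \<le> q * m + D * (t * (A * K) + e * sqrt A / r)"
    if m: "AE x in lborel. cmod (u x) \<le> m" "m \<ge> 0" and e: "e > 0" and t: "0 < t" "t \<le> 1" and K: "K \<ge> 0"
      "\<And>G A J x. integrable lborel G \<Longrightarrow> (\<And>y. cmod (G y) \<le> A) \<Longrightarrow>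
        (LINT y|lborel. cmod (G y)) \<le> J \<Longrightarrow> A > 0 \<Longrightarrow> J > 0 \<Longrightarrow>
        cmod (LINT y|lborel. G y * u (x - y)) \<le> A * K + e * sqrt (A * J)"
    for m e t K
  proof -
    define k where "k = k0 + of_real t * (1 + \<i>)"
    have k: "Re k \<ge> t" "Im k \<ge> t" "cmod k \<ge> r" "cmod k \<le> r + 2" "k \<noteq> 0"
    proof -
      show 1: "Re k \<ge> t" "Im k \<ge> t" using k0 by (auto simp: k_def)
      have "(Re k0)\<^sup>2 \<le> (Re k)\<^sup>2" "(Im k0)\<^sup>2 \<le> (Im k)\<^sup>2"
        using k0 t by (auto simp: k_def intro!: power_mono)
      then have "cmod k0 \<le> cmod k" unfolding cmod_def by (intro real_sqrt_le_mono add_mono)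
      then show "cmod k \<ge> r" using k0(2) by simp
      show "k \<noteq> 0" using 1 t by auto
      have "cmod (of_real t * (1 + \<i>)) \<le> 1 * 2"
        unfolding norm_mult using t norm_triangle_ineq[of 1 \<i>] by (intro mult_mono) auto
      then show "cmod k \<le> r + 2"
        using norm_triangle_ineq[of k0 "of_real t * (1 + \<i>)"] k0(2) by (simp add: k_def)
    qed
    define J where "J = 1 / (t * r)\<^sup>2"
    have J: "J > 0" using t r(2) by (simp add: J_def)
    have L1J: "(LINT x|lborel. cmod (g \<kappa> x)) \<le> J * (cmod k)\<^sup>2" if "Re \<kappa> \<ge> t" for \<kappa>
    proof -
      have "(LINT x|lborel. cmod (g \<kappa> x)) \<le> 1 / (Re \<kappa>)\<^sup>2" using L1[of \<kappa>] that t by simp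
      also have "\<dots> \<le> 1 / t\<^sup>2" using that t by (intro divide_left_mono power_mono mult_pos_pos) auto
      also have "\<dots> = J * r\<^sup>2" using r(2) by (simp add: J_def power_mult_distrib)
      also have "\<dots> \<le> J * (cmod k)\<^sup>2" using k(3) r(2) J by (intro mult_left_mono power_mono) auto
      finally show ?thesis .
    qed
    have fs': "fundamental_solution (- (k\<^sup>2)) (g (- \<i> * k))" "fundamental_solution (k\<^sup>2) (g k)"
      using fs[of "- \<i> * k"] fs[of k] k(1,2) t by (auto simp: power_mult_distrib)
    have pointwise: "AE x in lborel. cmod (u x) \<le> A * (LINT x|lborel. cmod (W x)) * m + cmod (z - k ^ 4) * (A * K + e * sqrt (A * J))"
    proof (rule eigenfunction_pointwise_bound[OF uUW(1,3,7) m fs' k(5) _ A(2) _ _ J])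
      show "cmod (g (- \<i> * k) x - g k x) \<le> 2 * A * (cmod k)\<^sup>2" for x
        using A(1)[of k x] k t by simp
      show "(LINT x|lborel. cmod (g (- \<i> * k) x)) \<le> J * (cmod k)\<^sup>2" "(LINT x|lborel. cmod (g k x)) \<le> J * (cmod k)\<^sup>2"
        using k by (auto intro!: L1J)
      show "cmod (LINT y|lborel. G y * u (x - y)) \<le> A * K + e * sqrt (A * J)"
        if "integrable lborel G" "\<And>y. cmod (G y) \<le> A" "(LINT y|lborel. cmod (G y)) \<le> J" for G x
        by (rule K(2)[OF that A(2) J])
    qed
    have error: "cmod (z - k ^ 4) * (A * K + e * sqrt (A * J)) \<le> D * (t * (A * K) + e * sqrt A / r)"
    proof -
      have "cmod (k0 - k) \<le> t * 2"
      proof -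
        have "cmod (k0 - k) = t * cmod (1 + \<i>)" using t by (simp add: k_def norm_mult norm_minus_commute)
        then show ?thesis using t norm_triangle_ineq[of 1 \<i>] by simp
      qed
      moreover have "cmod (z - k ^ 4) \<le> 4 * (r + 2) ^ 3 * cmod (k0 - k)"
        unfolding k0(1)[symmetric] using k k0 r by (intro norm_power4_diff_le) auto
      moreover have "4 * (r + 2) ^ 3 * cmod (k0 - k) \<le> 4 * (r + 2) ^ 3 * (t * 2)"
        using r(2) by (intro mult_left_mono calculation(1)) auto
      moreover have "4 * (r + 2) ^ 3 * (t * 2) = D * t" by (simp add: D_def)
      ultimately have "cmod (z - k ^ 4) \<le> D * t" by linarith
      then have "cmod (z - k ^ 4) * (A * K + e * sqrt (A * J)) \<le> D * t * (A * K + e * sqrt (A * J))"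
        using A(2) J K(1) e by (intro mult_right_mono add_nonneg_nonneg) auto
      also have "D * t * (A * K + e * sqrt (A * J)) = D * t * (A * K + e * (sqrt A / (t * r)))"
        using t r(2) by (simp add: J_def real_sqrt_divide real_sqrt_mult)
      also have "D * t * (A * K + e * (sqrt A / (t * r))) = D * (t * (A * K) + e * sqrt A / r)"
        using t r(2) by (simp add: field_simps)
      finally show ?thesis .
    qed
    show ?thesis
      using pointwise by eventually_elim (use error in \<open>simp add: q_def uUW(5)\<close>)
  qed
  have vanishing: "a \<le> b" if "\<And>n::nat. a \<le> b + c / real (Suc n)" for a b c :: real
  proof (rule LIMSEQ_le_const[of "\<lambda>n. b + c * (1 / real (Suc n))"])
    have "(\<lambda>n. b + c * (1 / real (Suc n))) \<longlonglongrightarrow> b + c * 0"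
      using LIMSEQ_inverse_real_of_nat by (intro tendsto_intros) (simp add: inverse_eq_divide)
    then show "(\<lambda>n. b + c * (1 / real (Suc n))) \<longlonglongrightarrow> b" by simp
    show "\<exists>N. \<forall>n\<ge>N. a \<le> b + c * (1 / real (Suc n))" using that by auto
  qed
  have contraction: "AE x in lborel. cmod (u x) \<le> q * m"
    if m: "AE x in lborel. cmod (u x) \<le> m" "m \<ge> 0" for m
  proof -
    have "AE x in lborel. cmod (u x) \<le> q * m + D * sqrt A / r / real (Suc j)" for j
    proof -
      define e where "e = 1 / real (Suc j)"
      have e: "e > 0" by (simp add: e_def)
      obtain K where K: "K \<ge> 0" "\<And>G A J x. integrable lborel G \<Longrightarrow> (\<And>y. cmod (G y) \<le> A) \<Longrightarrow>
        (LINT y|lborel. cmod (G y)) \<le> J \<Longrightarrow> A > 0 \<Longrightarrow> J > 0 \<Longrightarrow>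
        cmod (LINT y|lborel. G y * u (x - y)) \<le> A * K + e * sqrt (A * J)"
        using convolution_bound_small_L2[OF uUW(1) e] by blast
      have "AE x in lborel. \<forall>n::nat. cmod (u x) \<le> q * m + D * (1 / real (Suc n) * (A * K) + e * sqrt A / r)"
        unfolding AE_all_countable
      proof
        fix n :: nat
        show "AE x in lborel. cmod (u x) \<le> q * m + D * (1 / real (Suc n) * (A * K) + e * sqrt A / r)"
          by (rule one_step[OF m e _ _ K]) auto
      qed
      then show ?thesis
      proof eventually_elim
        case (elim x)
        show ?case
        proof (rule vanishing[where c = "D * (A * K)"])
          fix n :: nat
          show "cmod (u x) \<le> q * m + D * sqrt A / r / real (Suc j) + D * (A * K) / real (Suc n)"
            using elim[rule_format, of n] by (simp add: e_def algebra_simps)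
        qed
      qed
    qed
    then have "AE x in lborel. \<forall>j. cmod (u x) \<le> q * m + D * sqrt A / r / real (Suc j)"
      unfolding AE_all_countable by blast
    then show ?thesis by eventually_elim (blast intro: vanishing)
  qed
  have "AE x in lborel. cmod (u x) \<le> q ^ j * M" for j
  proof (induction j)
    case 0
    then show ?case using M by simp
  next
    case (Suc j)
    then show ?case using contraction[of "q ^ j * M"] q M(1) by (simp add: mult.assoc)
  qed
  then have "AE x in lborel. \<forall>j. cmod (u x) \<le> q ^ j * M"
    unfolding AE_all_countable by blast
  then have "AE x in lborel. u x = 0"
  proof eventually_elim
    case (elim x)
    have "(\<lambda>j. q ^ j * M) \<longlonglongrightarrow> 0 * M"
      using q by (intro tendsto_intros LIMSEQ_realpow_zero) auto
    then have "cmod (u x) \<le> 0 * M"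
      by (rule LIMSEQ_le_const) (use elim in blast)
    then show ?case by simp
  qed
  with uUW(4) show False by simp
qed

section \<open>Radial integration in dimension three\<close>

text \<open>Both measures give \<open>{..a}\<close> the volume of the ball of radius \<open>a\<close>.\<close>

lemma distr_lborel_norm_3:
  assumes "DIM('a::euclidean_space) = 3"
  shows "distr (lborel :: 'a measure) borel norm = density lborel (\<lambda>r. ennreal (4 * pi * r\<^sup>2) * indicator {0..} r)"
    (is "?M = ?N")
proof (rule measure_eqI_generator_eq[where A = "\<lambda>n. {..real n}" and \<Omega> = UNIV])
  show "Int_stable (range atMost :: real set set)"
    by (auto simp: Int_stable_def)
  show "sets ?M = sigma_sets UNIV (range atMost)" "sets ?N = sigma_sets UNIV (range atMost)"
    by (auto simp: borel_eq_atMost)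
  show "(\<Union>i. {..real i}) = UNIV" by (auto intro: real_arch_simple)
  have M: "emeasure ?M {..a} = (if a \<ge> 0 then ennreal (4 / 3 * pi * a ^ 3) else 0)" for a
  proof -
    have "emeasure ?M {..a} = emeasure lborel (norm -` {..a} :: 'a set)"
      by (subst emeasure_distr) auto
    also have "norm -` {..a} = (cball 0 a :: 'a set)" by auto
    also have "emeasure lborel (cball 0 a :: 'a set) = (if a \<ge> 0 then ennreal (4 / 3 * pi * a ^ 3) else 0)"
    proof (cases "a \<ge> 0")
      case True
      have "emeasure lborel (cball 0 a :: 'a set) = ennreal (unit_ball_vol (real DIM('a)) * a ^ DIM('a))"
        by (rule emeasure_cball) (fact True)
      also have "\<dots> = ennreal (unit_ball_vol 3 * a ^ 3)" by (simp add: assms)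
      also have "unit_ball_vol 3 * a ^ 3 = 4 / 3 * pi * a ^ 3" by (simp add: unit_ball_vol_3)
      finally show ?thesis using True by simp
    qed simp
    finally show ?thesis .
  qed
  show "emeasure ?M {..real i} \<noteq> \<infinity>" for i by (simp add: M)
  fix X :: "real set" assume "X \<in> range atMost"
  then obtain a where X: "X = {..a}" by auto
  have "emeasure ?N {..a} = (\<integral>\<^sup>+r. ennreal (4 * pi * r\<^sup>2) * indicator {0..a} r \<partial>lborel)"
    by (subst emeasure_density) (auto intro!: nn_integral_cong simp: indicator_def)
  also have "\<dots> = (if a \<ge> 0 then ennreal (4 / 3 * pi * a ^ 3) else 0)"
  proof (cases "a \<ge> 0")
    case True
    have "(\<integral>\<^sup>+r. ennreal (4 * pi * r\<^sup>2) * indicator {0..a} r \<partial>lborel) = ennreal (4 / 3 * pi * a ^ 3 - 4 / 3 * pi * 0 ^ 3)"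
      using True by (intro nn_integral_FTC_Icc) (auto intro!: derivative_eq_intros)
    then show ?thesis using True by simp
  qed simp
  finally show "emeasure ?M X = emeasure ?N X" unfolding X M ..
qed auto

text \<open>Integration in polar coordinates with a primitive \<open>F\<close> of the radial density. The density \<open>w\<close> is kept
  apart from \<open>r\<^sup>2 f(r)\<close> because of integrands such as \<open>exp (-\<beta> r) / r\<^sup>2\<close>: since \<open>x / 0 = 0\<close>, the product jumps
  at \<open>0\<close>, whereas the derivative \<open>w\<close> of \<open>F\<close> cannot.\<close>

lemma has_bochner_integral_radial_3:
  fixes f F w :: "real \<Rightarrow> real"
  assumes dim: "DIM('a::euclidean_space) = 3"
    and [measurable]: "f \<in> borel_measurable borel" "w \<in> borel_measurable borel"
    and deriv: "\<And>r. 0 \<le> r \<Longrightarrow> (F has_real_derivative w r) (at r)"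
    and w: "\<And>r. 0 < r \<Longrightarrow> w r = r\<^sup>2 * f r" "0 \<le> w 0"
    and nonneg: "\<And>r. 0 \<le> r \<Longrightarrow> 0 \<le> f r"
    and lim: "(F \<longlongrightarrow> T) at_top"
  shows "has_bochner_integral lborel (\<lambda>x::'a. f (norm x)) (4 * pi * (T - F 0))"
proof -
  have w_nonneg: "0 \<le> w r" if "0 \<le> r" for r
    using that w nonneg[of r] by (cases "r = 0") auto
  have T: "F 0 \<le> T"
  proof (rule tendsto_lowerbound[OF lim])
    show "\<forall>\<^sub>F r in at_top. F 0 \<le> F r"
      using eventually_ge_at_top[of 0]
    proof eventually_elim
      case (elim r)
      show ?case
        by (rule DERIV_nonneg_imp_nondecreasing[OF elim]) (use deriv w_nonneg in blast)
    qed
  qed simp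
  have "(\<integral>\<^sup>+x. ennreal (f (norm (x::'a))) \<partial>lborel) = (\<integral>\<^sup>+r. ennreal (f r) \<partial>distr (lborel :: 'a measure) borel norm)"
    by (subst nn_integral_distr) auto
  also have "\<dots> = (\<integral>\<^sup>+r. ennreal (4 * pi * r\<^sup>2) * indicator {0..} r * ennreal (f r) \<partial>lborel)"
    unfolding distr_lborel_norm_3[OF dim] by (subst nn_integral_density) auto
  also have "\<dots> = (\<integral>\<^sup>+r. ennreal (4 * pi * w r) * indicator {0..} r \<partial>lborel)"
  proof (rule nn_integral_cong_AE)
    show "AE r in lborel. ennreal (4 * pi * r\<^sup>2) * indicator {0..} r * ennreal (f r) = ennreal (4 * pi * w r) * indicator {0..} r"
      using AE_lborel_singleton[of 0]
      by eventually_elim (auto simp: indicator_def ennreal_mult[symmetric] nonneg w mult.assoc)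
  qed
  also have "\<dots> = ennreal (4 * pi * T - 4 * pi * F 0)"
    using deriv w_nonneg lim
    by (intro nn_integral_FTC_atLeast) (auto intro!: DERIV_cmult tendsto_intros)
  finally have "(\<integral>\<^sup>+x. ennreal (f (norm (x::'a))) \<partial>lborel) = ennreal (4 * pi * (T - F 0))"
    by (simp add: algebra_simps)
  then show ?thesis
    using T nonneg by (intro has_bochner_integral_nn_integral) auto
qed

lemma tendsto_power_times_exp_minus:
  assumes "\<beta> > (0::real)"
  shows "((\<lambda>r. r ^ n * exp (- \<beta> * r)) \<longlongrightarrow> 0) at_top"
proof -
  have "((\<lambda>r. (\<beta> * r) ^ n / exp (\<beta> * r)) \<longlongrightarrow> 0) at_top"
    by (rule filterlim_compose[OF tendsto_power_div_exp_0])
      (use assms in \<open>auto intro: filterlim_tendsto_pos_mult_at_top[OF tendsto_const _ filterlim_ident]\<close>)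
  from tendsto_mult_left[OF this, of "1 / \<beta> ^ n"] show ?thesis
    using assms by (simp add: power_mult_distrib exp_minus field_simps)
qed

lemma yukawa_integral_3:
  assumes dim: "DIM('a::euclidean_space) = 3" and \<beta>: "\<beta> > 0"
  shows "has_bochner_integral lborel (\<lambda>x::'a. exp (- \<beta> * norm x) / norm x) (4 * pi / \<beta>\<^sup>2)"
proof -
  let ?F = "\<lambda>r. - (r ^ 1 * exp (- \<beta> * r)) / \<beta> - r ^ 0 * exp (- \<beta> * r) / \<beta>\<^sup>2"
  have "(?F \<longlongrightarrow> - 0 / \<beta> - 0 / \<beta>\<^sup>2) at_top"
    using \<beta> by (intro tendsto_intros tendsto_power_times_exp_minus) auto
  moreover have "(?F has_real_derivative r * exp (- \<beta> * r)) (at r)" for r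
    using \<beta> by (auto intro!: derivative_eq_intros simp: field_simps power2_eq_square)
  ultimately have "has_bochner_integral lborel (\<lambda>x::'a. exp (- \<beta> * norm x) / norm x) (4 * pi * ((- 0 / \<beta> - 0 / \<beta>\<^sup>2) - ?F 0))"
    by (intro has_bochner_integral_radial_3[OF dim, where w = "\<lambda>r. r * exp (- \<beta> * r)"]) (auto simp: power2_eq_square)
  then show ?thesis by simp
qed

lemma integrable_exp_norm_3:
  assumes dim: "DIM('a::euclidean_space) = 3" and \<beta>: "\<beta> > 0"
  shows "integrable lborel (\<lambda>x::'a. exp (- \<beta> * norm x))"
proof -
  let ?F = "\<lambda>r. - (r ^ 2 * exp (- \<beta> * r)) / \<beta> - 2 * (r ^ 1 * exp (- \<beta> * r)) / \<beta>\<^sup>2 - 2 * (r ^ 0 * exp (- \<beta> * r)) / \<beta> ^ 3"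
  have "(?F \<longlongrightarrow> - 0 / \<beta> - 2 * 0 / \<beta>\<^sup>2 - 2 * 0 / \<beta> ^ 3) at_top"
    using \<beta> by (intro tendsto_intros tendsto_power_times_exp_minus) auto
  moreover have "(?F has_real_derivative r\<^sup>2 * exp (- \<beta> * r)) (at r)" for r
    using \<beta> by (auto intro!: derivative_eq_intros simp: field_simps power2_eq_square power3_eq_cube)
  ultimately have "has_bochner_integral lborel (\<lambda>x::'a. exp (- \<beta> * norm x)) (4 * pi * ((- 0 / \<beta> - 2 * 0 / \<beta>\<^sup>2 - 2 * 0 / \<beta> ^ 3) - ?F 0))"
    by (intro has_bochner_integral_radial_3[OF dim, where w = "\<lambda>r. r\<^sup>2 * exp (- \<beta> * r)"]) auto
  then show ?thesis by (rule has_bochner_integral_iff[THEN iffD1, THEN conjunct1])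
qed

lemma integrable_exp_norm_over_square_3:
  assumes dim: "DIM('a::euclidean_space) = 3" and \<beta>: "\<beta> > 0"
  shows "integrable lborel (\<lambda>x::'a. exp (- \<beta> * norm x) / (norm x)\<^sup>2)"
proof -
  let ?F = "\<lambda>r. - (r ^ 0 * exp (- \<beta> * r)) / \<beta>"
  have "(?F \<longlongrightarrow> - 0 / \<beta>) at_top"
    using \<beta> by (intro tendsto_intros tendsto_power_times_exp_minus) auto
  moreover have "(?F has_real_derivative exp (- \<beta> * r)) (at r)" for r
    using \<beta> by (auto intro!: derivative_eq_intros)
  ultimately have "has_bochner_integral lborel (\<lambda>x::'a. exp (- \<beta> * norm x) / (norm x)\<^sup>2) (4 * pi * (- 0 / \<beta> - ?F 0))"
    by (intro has_bochner_integral_radial_3[OF dim, where w = "\<lambda>r. exp (- \<beta> * r)"]) auto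
  then show ?thesis by (rule has_bochner_integral_iff[THEN iffD1, THEN conjunct1])
qed

lemma regularised_delta_mass_3:
  assumes dim: "DIM('a::euclidean_space) = 3"
  shows "has_bochner_integral lborel (\<lambda>x::'a. 3 / sqrt ((norm x)\<^sup>2 + 1) ^ 5) (4 * pi)"
proof -
  let ?F = "\<lambda>r::real. r ^ 3 / sqrt (r\<^sup>2 + 1) ^ 3"
  have lim: "(?F \<longlongrightarrow> 1) at_top" by real_asymp
  have deriv: "(?F has_real_derivative r\<^sup>2 * (3 / sqrt (r\<^sup>2 + 1) ^ 5)) (at r)" for r
  proof -
    define S where "S r = sqrt (r\<^sup>2 + 1)" for r :: real
    have pos: "0 < r\<^sup>2 + 1" by (simp add: add_nonneg_pos)
    then have s: "S r > 0" "(S r)\<^sup>2 = r\<^sup>2 + 1" by (auto simp: S_def)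
    have "((\<lambda>r. r\<^sup>2 + 1) has_real_derivative 2 * r) (at r)"
      by (auto intro!: derivative_eq_intros)
    from DERIV_chain2[OF DERIV_real_sqrt[OF pos] this]
    have dS: "(S has_real_derivative r / S r) (at r)"
      by (simp add: S_def[abs_def] field_simps)
    have "((\<lambda>r. r ^ 3 / S r ^ 3) has_real_derivative (3 * r\<^sup>2 * S r ^ 3 - r ^ 3 * (3 * (S r)\<^sup>2 * (r / S r))) / (S r ^ 3 * S r ^ 3)) (at r)"
      using s(1) by (auto intro!: derivative_eq_intros dS)
    also have "(3 * r\<^sup>2 * S r ^ 3 - r ^ 3 * (3 * (S r)\<^sup>2 * (r / S r))) / (S r ^ 3 * S r ^ 3) = r\<^sup>2 * (3 * ((S r)\<^sup>2 - r\<^sup>2) / S r ^ 5)"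
      using s(1) by (simp add: field_simps power2_eq_square power3_eq_cube power4_eq_xxxx eval_nat_numeral)
    also have "(S r)\<^sup>2 - r\<^sup>2 = 1" using s(2) by simp
    finally show ?thesis by (simp add: S_def)
  qed
  have "has_bochner_integral lborel (\<lambda>x::'a. 3 / sqrt ((norm x)\<^sup>2 + 1) ^ 5) (4 * pi * (1 - ?F 0))"
    using deriv lim by (intro has_bochner_integral_radial_3[OF dim, where w = "\<lambda>r. r\<^sup>2 * (3 / sqrt (r\<^sup>2 + 1) ^ 5)"]) auto
  then show ?thesis by simp
qed

section \<open>The fundamental solution in dimension three\<close>

text \<open>As functions of the radius, \<open>yukawa\<close> is the kernel \<open>exp (-\<kappa> r) / (4 \<pi> r)\<close>, and the other two arise
  from it by applying \<open>(1/r) d/dr\<close> once and twice.\<close>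

definition yukawa :: "complex \<Rightarrow> complex \<Rightarrow> complex" where
  "yukawa \<kappa> w = exp (- \<kappa> * w) / (4 * of_real pi * w)"

definition yukawa' :: "complex \<Rightarrow> complex \<Rightarrow> complex" where
  "yukawa' \<kappa> w = - (\<kappa> / w ^ 2 + 1 / w ^ 3) * exp (- \<kappa> * w) / (4 * of_real pi)"

definition yukawa'' :: "complex \<Rightarrow> complex \<Rightarrow> complex" where
  "yukawa'' \<kappa> w = (\<kappa>\<^sup>2 / w ^ 3 + 3 * \<kappa> / w ^ 4 + 3 / w ^ 5) * exp (- \<kappa> * w) / (4 * of_real pi)"

lemma yukawa_derivs:
  assumes "w \<noteq> 0"
  shows "(yukawa \<kappa> has_field_derivative w * yukawa' \<kappa> w) (at w)"
    "(yukawa' \<kappa> has_field_derivative w * yukawa'' \<kappa> w) (at w)"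
  using assms unfolding yukawa_def[abs_def] yukawa'_def[abs_def] yukawa''_def[abs_def]
  by (auto intro!: derivative_eq_intros simp: field_simps eval_nat_numeral)

lemma yukawa_radial_equation:
  assumes "w \<noteq> 0"
  shows "3 * yukawa' \<kappa> w + (w\<^sup>2 - e) * yukawa'' \<kappa> w = \<kappa>\<^sup>2 * yukawa \<kappa> w - e * yukawa'' \<kappa> w"
  using assms by (simp add: yukawa_def yukawa'_def yukawa''_def field_simps eval_nat_numeral)

lemma norm_exp_decay: "s \<ge> r \<Longrightarrow> Re \<kappa> > 0 \<Longrightarrow> cmod (exp (- \<kappa> * of_real s)) \<le> exp (- Re \<kappa> * r)"
  by simp

lemma norm_yukawa_le:
  assumes "0 < r" "r \<le> s" "Re \<kappa> > 0"
  shows "cmod (yukawa \<kappa> (of_real s)) \<le> exp (- Re \<kappa> * r) / (4 * pi * r)"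
  unfolding yukawa_def norm_divide norm_mult[of "4 * _"] norm_mult[of 4]
  using assms norm_exp_decay[of r s \<kappa>] by (intro frac_le) auto

context
  fixes \<epsilon> :: real
  assumes \<epsilon>: "\<epsilon> > 0"
begin

text \<open>With \<open>(\<bar>x\<bar>\<^sup>2 + \<epsilon>\<^sup>2)\<^sup>1\<^sup>/\<^sup>2\<close> in place of the norm, the kernel is smooth, and classical integration by parts
  applies to it.\<close>

definition regnorm :: "'a::euclidean_space \<Rightarrow> real" where
  "regnorm x = sqrt ((norm x)\<^sup>2 + \<epsilon>\<^sup>2)"

lemma regnorm_bounds: "norm x \<le> regnorm x" "\<epsilon> \<le> regnorm x" "0 < regnorm x"
proof -
  show 1: "norm x \<le> regnorm x" "\<epsilon> \<le> regnorm x"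
    using \<epsilon> by (auto simp: regnorm_def intro!: real_le_rsqrt)
  show "0 < regnorm x" using 1(2) \<epsilon> by linarith
qed

lemma regnorm_square: "(regnorm x)\<^sup>2 = (norm x)\<^sup>2 + \<epsilon>\<^sup>2"
  by (simp add: regnorm_def)

lemma continuous_on_regnorm: "continuous_on A regnorm"
  unfolding regnorm_def[abs_def] by (intro continuous_intros)

lemma regnorm_deriv:
  "((\<lambda>t. regnorm (x + t *\<^sub>R b)) has_real_derivative ((x + t *\<^sub>R b) \<bullet> b) / regnorm (x + t *\<^sub>R b)) (at t)"
proof -
  have pos: "0 < (norm y)\<^sup>2 + \<epsilon>\<^sup>2" for y :: 'a using \<epsilon> by (simp add: add_nonneg_pos)
  have "((\<lambda>t. (norm (x + t *\<^sub>R b))\<^sup>2 + \<epsilon>\<^sup>2) has_real_derivative 2 * ((x + t *\<^sub>R b) \<bullet> b)) (at t)"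
    unfolding power2_norm_eq_inner
    by (auto intro!: derivative_eq_intros simp: inner_add_left inner_add_right inner_commute algebra_simps)
  from DERIV_chain2[OF DERIV_real_sqrt[OF pos] this] show ?thesis
    by (simp add: regnorm_def field_simps)
qed

lemma radial_deriv:
  fixes h h' :: "complex \<Rightarrow> complex"
  assumes "\<And>w. w \<noteq> 0 \<Longrightarrow> (h has_field_derivative w * h' w) (at w)"
  shows "((\<lambda>t. h (of_real (regnorm (x + t *\<^sub>R b)))) has_vector_derivative
    h' (of_real (regnorm (x + t *\<^sub>R b))) * of_real ((x + t *\<^sub>R b) \<bullet> b)) (at t)"
proof -
  let ?w = "complex_of_real (regnorm (x + t *\<^sub>R b))"
  have w: "?w \<noteq> 0" using regnorm_bounds(3)[of "x + t *\<^sub>R b"] by simp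
  have "((\<lambda>t. complex_of_real (regnorm (x + t *\<^sub>R b))) has_vector_derivative
      of_real (((x + t *\<^sub>R b) \<bullet> b) / regnorm (x + t *\<^sub>R b))) (at t)"
    using has_vector_derivative_of_real[OF regnorm_deriv[of x b t]] .
  from field_vector_diff_chain_at[OF this assms[OF w]] show ?thesis
    using w by (simp add: o_def mult.commute)
qed

definition yukawa_reg :: "complex \<Rightarrow> 'a::euclidean_space \<Rightarrow> complex" where
  "yukawa_reg \<kappa> x = yukawa \<kappa> (of_real (regnorm x))"

definition yukawa_reg' :: "complex \<Rightarrow> 'a::euclidean_space \<Rightarrow> 'a \<Rightarrow> complex" where
  "yukawa_reg' \<kappa> b x = yukawa' \<kappa> (of_real (regnorm x)) * of_real (x \<bullet> b)"

definition yukawa_reg'' :: "complex \<Rightarrow> 'a::euclidean_space \<Rightarrow> 'a \<Rightarrow> complex" where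
  "yukawa_reg'' \<kappa> b x = yukawa'' \<kappa> (of_real (regnorm x)) * of_real ((x \<bullet> b)\<^sup>2) + yukawa' \<kappa> (of_real (regnorm x)) * of_real (b \<bullet> b)"

lemma yukawa_reg_derivs:
  "((\<lambda>t. yukawa_reg \<kappa> (x + t *\<^sub>R b)) has_vector_derivative yukawa_reg' \<kappa> b (x + t *\<^sub>R b)) (at t)"
  "((\<lambda>t. yukawa_reg' \<kappa> b (x + t *\<^sub>R b)) has_vector_derivative yukawa_reg'' \<kappa> b (x + t *\<^sub>R b)) (at t)"
proof -
  show "((\<lambda>t. yukawa_reg \<kappa> (x + t *\<^sub>R b)) has_vector_derivative yukawa_reg' \<kappa> b (x + t *\<^sub>R b)) (at t)"
    unfolding yukawa_reg_def yukawa_reg'_def by (rule radial_deriv[OF yukawa_derivs(1)])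
  have "((\<lambda>t. (x + t *\<^sub>R b) \<bullet> b) has_real_derivative b \<bullet> b) (at t)"
    by (auto intro!: derivative_eq_intros simp: inner_add_left)
  then have "((\<lambda>t. complex_of_real ((x + t *\<^sub>R b) \<bullet> b)) has_vector_derivative of_real (b \<bullet> b)) (at t)"
    by (rule has_vector_derivative_of_real)
  from has_vector_derivative_mult[OF radial_deriv[OF yukawa_derivs(2), of \<kappa> x b t] this]
  show "((\<lambda>t. yukawa_reg' \<kappa> b (x + t *\<^sub>R b)) has_vector_derivative yukawa_reg'' \<kappa> b (x + t *\<^sub>R b)) (at t)"
    unfolding yukawa_reg'_def yukawa_reg''_def by (simp add: power2_eq_square ac_simps)
qed

text \<open>Away from the regularisation, \<open>\<Delta>\<close> acts as multiplication by \<open>\<kappa>\<^sup>2\<close>. The defect \<open>\<epsilon>\<^sup>2 yukawa''\<close> is an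
  approximation of the unit mass at the origin.\<close>

lemma sum_yukawa_reg'':
  assumes "DIM('a::euclidean_space) = 3"
  shows "(\<Sum>b\<in>Basis. yukawa_reg'' \<kappa> b (x::'a)) = \<kappa>\<^sup>2 * yukawa_reg \<kappa> x - of_real (\<epsilon>\<^sup>2) * yukawa'' \<kappa> (of_real (regnorm x))"
proof -
  let ?w = "complex_of_real (regnorm x)"
  have w: "?w \<noteq> 0" using regnorm_bounds(3)[of x] by simp
  have "(\<Sum>b\<in>Basis. (x \<bullet> b)\<^sup>2) = (norm x)\<^sup>2"
    unfolding power2_norm_eq_inner euclidean_inner[of x x] by (simp add: power2_eq_square)
  also have "\<dots> = (regnorm x)\<^sup>2 - \<epsilon>\<^sup>2" by (simp add: regnorm_square)
  finally have sq: "(\<Sum>b\<in>Basis. (x \<bullet> b)\<^sup>2) = (regnorm x)\<^sup>2 - \<epsilon>\<^sup>2" .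
  have "(\<Sum>b\<in>Basis. yukawa_reg'' \<kappa> b x)
      = yukawa'' \<kappa> ?w * of_real (\<Sum>b\<in>Basis. (x \<bullet> b)\<^sup>2) + yukawa' \<kappa> ?w * of_real (\<Sum>b\<in>Basis. (b::'a) \<bullet> b)"
    by (simp add: yukawa_reg''_def sum.distrib sum_distrib_left)
  also have "(\<Sum>b\<in>Basis. (b::'a) \<bullet> b) = 3" using assms by simp
  also have "yukawa'' \<kappa> ?w * of_real (\<Sum>b\<in>Basis. (x \<bullet> b)\<^sup>2) + yukawa' \<kappa> ?w * of_real 3
      = 3 * yukawa' \<kappa> ?w + (?w\<^sup>2 - of_real (\<epsilon>\<^sup>2)) * yukawa'' \<kappa> ?w"
    unfolding sq by (simp add: algebra_simps)
  also have "\<dots> = \<kappa>\<^sup>2 * yukawa \<kappa> ?w - of_real (\<epsilon>\<^sup>2) * yukawa'' \<kappa> ?w"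
    by (rule yukawa_radial_equation[OF w])
  finally show ?thesis by (simp add: yukawa_reg_def)
qed

lemma continuous_on_yukawa_reg:
  fixes b :: "'a::euclidean_space"
  shows "continuous_on UNIV (yukawa_reg \<kappa> :: 'a \<Rightarrow> complex)" "continuous_on UNIV (yukawa_reg' \<kappa> b)" "continuous_on UNIV (yukawa_reg'' \<kappa> b)"
proof -
  have c: "continuous_on UNIV (\<lambda>x :: 'a. complex_of_real (regnorm x))"
    by (intro continuous_intros continuous_on_regnorm)
  have nz: "regnorm x \<noteq> 0" for x :: 'a using regnorm_bounds(3)[of x] by simp
  have "continuous_on UNIV (\<lambda>x :: 'a. yukawa \<kappa> (of_real (regnorm x)))" "continuous_on UNIV (\<lambda>x :: 'a. yukawa' \<kappa> (of_real (regnorm x)))"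
    "continuous_on UNIV (\<lambda>x :: 'a. yukawa'' \<kappa> (of_real (regnorm x)))"
    unfolding yukawa_def yukawa'_def yukawa''_def using nz by (auto intro!: continuous_intros c)
  then show "continuous_on UNIV (yukawa_reg \<kappa> :: 'a \<Rightarrow> complex)" "continuous_on UNIV (yukawa_reg' \<kappa> b)" "continuous_on UNIV (yukawa_reg'' \<kappa> b)"
    unfolding yukawa_reg_def[abs_def] yukawa_reg'_def[abs_def] yukawa_reg''_def[abs_def]
    by (auto intro!: continuous_intros)
qed

text \<open>The powers of \<open>1 / \<rho>\<close> are bounded by powers of \<open>1 / \<epsilon>\<close>, so the kernel and its derivatives decay
  exponentially, with a constant that depends on \<open>\<epsilon>\<close>.\<close>

lemma yukawa_reg_bounds:
  assumes \<kappa>: "Re \<kappa> > 0"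
  obtains C where "C > 0" "\<And>x :: 'a::euclidean_space. cmod (yukawa_reg \<kappa> x) \<le> C * exp (- Re \<kappa> * norm x)"
    "\<And>b x :: 'a. b \<in> Basis \<Longrightarrow> cmod (yukawa_reg' \<kappa> b x) \<le> C * exp (- Re \<kappa> * norm x)"
    "\<And>b x :: 'a. b \<in> Basis \<Longrightarrow> cmod (yukawa_reg'' \<kappa> b x) \<le> C * exp (- Re \<kappa> * norm x)"
proof -
  define d where "d = inverse \<epsilon>"
  define K where "K = cmod \<kappa>"
  have d: "d > 0" using \<epsilon> by (simp add: d_def)
  have K: "K \<ge> 0" by (simp add: K_def)
  define C where "C = d + (K * d + d\<^sup>2) + ((K\<^sup>2 * d + 3 * K * d\<^sup>2 + 3 * d ^ 3) + (K * d\<^sup>2 + d ^ 3))"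
  have C: "d \<le> C" "K * d + d\<^sup>2 \<le> C" "(K\<^sup>2 * d + 3 * K * d\<^sup>2 + 3 * d ^ 3) + (K * d\<^sup>2 + d ^ 3) \<le> C" "C > 0"
    unfolding C_def using d K by (auto intro!: add_nonneg_nonneg add_pos_nonneg)
  have main: "cmod (yukawa \<kappa> (of_real s)) \<le> d * exp (- Re \<kappa> * r)"
    "cmod (yukawa' \<kappa> (of_real s)) * s \<le> (K * d + d\<^sup>2) * exp (- Re \<kappa> * r)"
    "cmod (yukawa' \<kappa> (of_real s)) \<le> (K * d\<^sup>2 + d ^ 3) * exp (- Re \<kappa> * r)"
    "cmod (yukawa'' \<kappa> (of_real s)) * s\<^sup>2 \<le> (K\<^sup>2 * d + 3 * K * d\<^sup>2 + 3 * d ^ 3) * exp (- Re \<kappa> * r)"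
    if s: "s \<ge> \<epsilon>" "s \<ge> r" for s r
  proof -
    define j where "j = inverse s"
    have s0: "s > 0" using s \<epsilon> by linarith
    have j: "0 \<le> j" "j \<le> d" using s \<epsilon> by (auto simp: j_def d_def intro: le_imp_inverse_le)
    have e: "cmod (exp (- \<kappa> * of_real s)) \<le> exp (- Re \<kappa> * r)" (is "?e \<le> ?E")
      using norm_exp_decay[of r s \<kappa>] s \<kappa> by simp
    have e0: "0 \<le> ?e" by simp
    have pi4: "1 / (4 * pi) \<le> 1" using pi_gt3 by simp
    have scale: "a / (4 * pi) * ?e \<le> b * ?E" if "0 \<le> a" "a \<le> b" for a b
    proof -
      have "a / (4 * pi) \<le> b" using mult_left_mono[OF pi4, of a] that by simp
      then show ?thesis using that e by (intro mult_mono) auto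
    qed
    have n1: "cmod (yukawa \<kappa> (of_real s)) = j / (4 * pi) * ?e"
      using s0 by (simp add: yukawa_def norm_divide norm_mult j_def field_simps)
    show "cmod (yukawa \<kappa> (of_real s)) \<le> d * ?E"
      unfolding n1 using j by (intro scale)
    have jj: "j ^ n \<le> d ^ n" for n using j by (intro power_mono)
    have n2: "cmod (yukawa' \<kappa> (of_real s)) \<le> (K * j\<^sup>2 + j ^ 3) / (4 * pi) * ?e"
    proof -
      have "cmod (\<kappa> / of_real s ^ 2 + 1 / of_real s ^ 3) \<le> cmod (\<kappa> / of_real s ^ 2) + cmod (1 / of_real s ^ 3)"
        by (rule norm_triangle_ineq)
      also have "\<dots> = K * j\<^sup>2 + j ^ 3"
        using s0 by (simp add: norm_mult norm_inverse norm_power K_def j_def divide_inverse power_inverse)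
      finally show ?thesis
        unfolding yukawa'_def norm_divide norm_mult norm_minus_cancel
        by (simp add: divide_right_mono mult_right_mono)
    qed
    show "cmod (yukawa' \<kappa> (of_real s)) \<le> (K * d\<^sup>2 + d ^ 3) * ?E"
      by (rule order_trans[OF n2 scale]) (use j K jj in \<open>auto intro!: add_mono mult_left_mono add_nonneg_nonneg\<close>)
    have sj: "s * j = 1" using s0 by (simp add: j_def)
    have "cmod (yukawa' \<kappa> (of_real s)) * s \<le> (K * j\<^sup>2 + j ^ 3) / (4 * pi) * ?e * s"
      using n2 s0 by (intro mult_right_mono) auto
    also have "\<dots> = (K * j * (s * j) + j\<^sup>2 * (s * j)) / (4 * pi) * ?e"
      by (simp add: algebra_simps power2_eq_square power3_eq_cube)
    also have "\<dots> = (K * j + j\<^sup>2) / (4 * pi) * ?e" unfolding sj by simp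
    also have "\<dots> \<le> (K * d + d\<^sup>2) * ?E"
      by (rule scale) (use j K jj in \<open>auto intro!: add_mono mult_left_mono add_nonneg_nonneg\<close>)
    finally show "cmod (yukawa' \<kappa> (of_real s)) * s \<le> (K * d + d\<^sup>2) * ?E" .
    have n3: "cmod (yukawa'' \<kappa> (of_real s)) \<le> (K\<^sup>2 * j ^ 3 + 3 * K * j ^ 4 + 3 * j ^ 5) / (4 * pi) * ?e"
    proof -
      have "cmod (\<kappa>\<^sup>2 / of_real s ^ 3 + 3 * \<kappa> / of_real s ^ 4 + 3 / of_real s ^ 5)
          \<le> cmod (\<kappa>\<^sup>2 / of_real s ^ 3) + cmod (3 * \<kappa> / of_real s ^ 4) + cmod (3 / of_real s ^ 5)"
        by (intro norm_triangle_le add_mono) auto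
      also have "\<dots> = K\<^sup>2 * j ^ 3 + 3 * K * j ^ 4 + 3 * j ^ 5"
        using s0 by (simp add: norm_mult norm_inverse norm_power K_def j_def divide_inverse power_inverse)
      finally show ?thesis
        unfolding yukawa''_def norm_divide norm_mult by (simp add: divide_right_mono mult_right_mono)
    qed
    have "cmod (yukawa'' \<kappa> (of_real s)) * s\<^sup>2 \<le> (K\<^sup>2 * j ^ 3 + 3 * K * j ^ 4 + 3 * j ^ 5) / (4 * pi) * ?e * s\<^sup>2"
      using n3 by (intro mult_right_mono) auto
    also have "\<dots> = (K\<^sup>2 * j * (s * j)\<^sup>2 + 3 * K * j\<^sup>2 * (s * j)\<^sup>2 + 3 * j ^ 3 * (s * j)\<^sup>2) / (4 * pi) * ?e"
      by (simp add: algebra_simps eval_nat_numeral)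
    also have "\<dots> = (K\<^sup>2 * j + 3 * K * j\<^sup>2 + 3 * j ^ 3) / (4 * pi) * ?e" unfolding sj by simp
    also have "\<dots> \<le> (K\<^sup>2 * d + 3 * K * d\<^sup>2 + 3 * d ^ 3) * ?E"
      by (rule scale) (use j K jj in \<open>auto intro!: add_mono mult_left_mono add_nonneg_nonneg\<close>)
    finally show "cmod (yukawa'' \<kappa> (of_real s)) * s\<^sup>2 \<le> (K\<^sup>2 * d + 3 * K * d\<^sup>2 + 3 * d ^ 3) * ?E" .
  qed
  have 0: "0 \<le> exp (- Re \<kappa> * norm x)" for x :: 'a by simp
  show ?thesis
  proof (rule that[OF C(4)])
    fix x :: 'a
    note m = main[OF regnorm_bounds(2)[of x] regnorm_bounds(1)[of x]]
    show "cmod (yukawa_reg \<kappa> x) \<le> C * exp (- Re \<kappa> * norm x)"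
      unfolding yukawa_reg_def by (rule order_trans[OF m(1) mult_right_mono[OF C(1) 0]])
    fix b :: 'a assume b: "b \<in> Basis"
    have xb: "\<bar>x \<bullet> b\<bar> \<le> regnorm x"
      using Basis_le_norm[OF b, of x] regnorm_bounds(1)[of x] by linarith
    have "cmod (yukawa_reg' \<kappa> b x) \<le> cmod (yukawa' \<kappa> (of_real (regnorm x))) * regnorm x"
      unfolding yukawa_reg'_def norm_mult using xb by (intro mult_left_mono) auto
    then show "cmod (yukawa_reg' \<kappa> b x) \<le> C * exp (- Re \<kappa> * norm x)"
      using order_trans[OF m(2) mult_right_mono[OF C(2) 0]] by linarith
    have "(x \<bullet> b)\<^sup>2 \<le> (regnorm x)\<^sup>2"
      using power_mono[OF xb, of 2] by simp
    then have "cmod (yukawa_reg'' \<kappa> b x) \<le> cmod (yukawa'' \<kappa> (of_real (regnorm x))) * (regnorm x)\<^sup>2 + cmod (yukawa' \<kappa> (of_real (regnorm x)))"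
      unfolding yukawa_reg''_def using b
      by (intro norm_triangle_le add_mono) (auto simp: norm_mult norm_power intro!: mult_left_mono)
    also have "\<dots> \<le> ((K\<^sup>2 * d + 3 * K * d\<^sup>2 + 3 * d ^ 3) + (K * d\<^sup>2 + d ^ 3)) * exp (- Re \<kappa> * norm x)"
      using m(3,4) by (simp only: distrib_right add_mono)
    also have "\<dots> \<le> C * exp (- Re \<kappa> * norm x)"
      by (rule mult_right_mono[OF C(3) 0])
    finally show "cmod (yukawa_reg'' \<kappa> b x) \<le> C * exp (- Re \<kappa> * norm x)" .
  qed
qed

end

lemma integrable_exp_decay:
  fixes f :: "'a::euclidean_space \<Rightarrow> complex"
  assumes dim: "DIM('a) = 3" and "continuous_on UNIV f" "\<beta> > 0" "\<And>x. cmod (f x) \<le> C * exp (- \<beta> * norm x)"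
  shows "integrable lborel f"
proof (rule integrable_dominated[OF _ _ assms(4)])
  show "integrable lborel (\<lambda>x::'a. C * exp (- \<beta> * norm x))"
    using integrable_exp_norm_3[OF dim assms(3)] by simp
  show "f \<in> borel_measurable lborel"
    using borel_measurable_continuous_onI[OF assms(2)] by simp
qed

text \<open>Green's identity for the regularised kernel. The class of functions \<open>\<phi>\<close> with bounded derivatives
  contains those that are independent of one coordinate, and dimension two relies on them.\<close>

lemma yukawa_reg_green:
  fixes \<phi> :: "'a::euclidean_space \<Rightarrow> complex" and D DD :: "'a \<Rightarrow> 'a \<Rightarrow> complex"
  assumes dim: "DIM('a) = 3" and \<epsilon>: "\<epsilon> > 0" and \<kappa>: "Re \<kappa> > 0"
    and cont: "continuous_on UNIV \<phi>" "\<And>b. b \<in> Basis \<Longrightarrow> continuous_on UNIV (D b)" "\<And>b. b \<in> Basis \<Longrightarrow> continuous_on UNIV (DD b)"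
    and bound: "\<And>x. cmod (\<phi> x) \<le> B" "\<And>b x. b \<in> Basis \<Longrightarrow> cmod (D b x) \<le> B" "\<And>b x. b \<in> Basis \<Longrightarrow> cmod (DD b x) \<le> B"
    and deriv: "\<And>b x t. b \<in> Basis \<Longrightarrow> ((\<lambda>t. \<phi> (x + t *\<^sub>R b)) has_vector_derivative D b (x + t *\<^sub>R b)) (at t)"
      "\<And>b x t. b \<in> Basis \<Longrightarrow> ((\<lambda>t. D b (x + t *\<^sub>R b)) has_vector_derivative DD b (x + t *\<^sub>R b)) (at t)"
  shows "(LINT x|lborel. yukawa_reg \<epsilon> \<kappa> x * (\<kappa>\<^sup>2 * \<phi> x - (\<Sum>b\<in>Basis. DD b x)))
    = (LINT x|lborel. of_real (\<epsilon>\<^sup>2) * yukawa'' \<kappa> (of_real (regnorm \<epsilon> x)) * \<phi> x)"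
proof -
  let ?U = "yukawa_reg \<epsilon> \<kappa> :: 'a \<Rightarrow> complex"
  let ?U' = "yukawa_reg' \<epsilon> \<kappa> :: 'a \<Rightarrow> 'a \<Rightarrow> complex"
  let ?U'' = "yukawa_reg'' \<epsilon> \<kappa> :: 'a \<Rightarrow> 'a \<Rightarrow> complex"
  obtain C where C: "C > 0" "\<And>x. cmod (?U x) \<le> C * exp (- Re \<kappa> * norm x)"
    "\<And>b x. b \<in> Basis \<Longrightarrow> cmod (?U' b x) \<le> C * exp (- Re \<kappa> * norm x)"
    "\<And>b x. b \<in> Basis \<Longrightarrow> cmod (?U'' b x) \<le> C * exp (- Re \<kappa> * norm x)"
    using yukawa_reg_bounds[OF \<epsilon> \<kappa>] by blast
  note cU = continuous_on_yukawa_reg[OF \<epsilon>]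
  have int: "integrable lborel (\<lambda>x. f x * h x)"
    if f: "continuous_on UNIV f" "\<And>x. cmod (f x) \<le> C * exp (- Re \<kappa> * norm x)"
      and h: "continuous_on UNIV h" "\<And>x. cmod (h x) \<le> B" for f h :: "'a \<Rightarrow> complex"
  proof (rule integrable_exp_decay[OF dim _ \<kappa>])
    show "continuous_on UNIV (\<lambda>x. f x * h x)" using f h by (intro continuous_intros)
    have "cmod (f x) * cmod (h x) \<le> (C * exp (- Re \<kappa> * norm x)) * B" for x
      using C(1) f h order_trans[OF norm_ge_zero h(2)] by (intro mult_mono) auto
    then show "cmod (f x * h x) \<le> C * B * exp (- Re \<kappa> * norm x)" for x
      by (simp add: norm_mult ac_simps)
  qed
  have i: "integrable lborel (\<lambda>x. ?U x * \<phi> x)"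
    "\<And>b. b \<in> Basis \<Longrightarrow> integrable lborel (\<lambda>x. ?U x * DD b x)" "\<And>b. b \<in> Basis \<Longrightarrow> integrable lborel (\<lambda>x. ?U x * D b x)"
    "\<And>b. b \<in> Basis \<Longrightarrow> integrable lborel (\<lambda>x. ?U' b x * \<phi> x)" "\<And>b. b \<in> Basis \<Longrightarrow> integrable lborel (\<lambda>x. ?U'' b x * \<phi> x)"
    by (rule int; use cU C cont bound in blast)+
  have zero: "(LINT x|lborel. ?U x * DD b x - ?U'' b x * \<phi> x) = 0" if b: "b \<in> Basis" for b
  proof (rule integral_directional_derivative_eq_0[where F = "\<lambda>x. ?U x * D b x - ?U' b x * \<phi> x" and b = b])
    show "integrable lborel (\<lambda>x. ?U x * D b x - ?U' b x * \<phi> x)" "integrable lborel (\<lambda>x. ?U x * DD b x - ?U'' b x * \<phi> x)"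
      using i b by auto
    show "continuous_on UNIV (\<lambda>x. ?U x * DD b x - ?U'' b x * \<phi> x)"
      using cU cont b by (intro continuous_intros) auto
    fix x t
    note d = yukawa_reg_derivs(1)[OF \<epsilon>, of \<kappa> x b t] yukawa_reg_derivs(2)[OF \<epsilon>, of \<kappa> b x t]
    show "((\<lambda>t. ?U (x + t *\<^sub>R b) * D b (x + t *\<^sub>R b) - ?U' b (x + t *\<^sub>R b) * \<phi> (x + t *\<^sub>R b)) has_vector_derivative
        ?U (x + t *\<^sub>R b) * DD b (x + t *\<^sub>R b) - ?U'' b (x + t *\<^sub>R b) * \<phi> (x + t *\<^sub>R b)) (at t)"
      using has_vector_derivative_diff[OF has_vector_derivative_mult[OF d(1) deriv(2)[OF b, of x t]]
          has_vector_derivative_mult[OF d(2) deriv(1)[OF b, of x t]]]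
      by (simp add: algebra_simps)
  qed
  have sum: "(LINT x|lborel. (\<Sum>b\<in>Basis. ?U x * DD b x - ?U'' b x * \<phi> x)) = 0"
    using zero i by simp
  have isum: "integrable lborel (\<lambda>x. \<Sum>b\<in>Basis. ?U x * DD b x - ?U'' b x * \<phi> x)"
    using i by simp
  have il: "integrable lborel (\<lambda>x. ?U x * (\<kappa>\<^sup>2 * \<phi> x - (\<Sum>b\<in>Basis. DD b x)))"
  proof -
    have "(\<lambda>x. ?U x * (\<kappa>\<^sup>2 * \<phi> x - (\<Sum>b\<in>Basis. DD b x))) = (\<lambda>x. \<kappa>\<^sup>2 * (?U x * \<phi> x) - (\<Sum>b\<in>Basis. ?U x * DD b x))"
      by (auto simp: algebra_simps sum_distrib_left)
    then show ?thesis using i by simp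
  qed
  have "of_real (\<epsilon>\<^sup>2) * yukawa'' \<kappa> (of_real (regnorm \<epsilon> x)) * \<phi> x
      = ?U x * (\<kappa>\<^sup>2 * \<phi> x - (\<Sum>b\<in>Basis. DD b x)) + (\<Sum>b\<in>Basis. ?U x * DD b x - ?U'' b x * \<phi> x)" for x
  proof -
    have q: "of_real (\<epsilon>\<^sup>2) * yukawa'' \<kappa> (of_real (regnorm \<epsilon> x)) = \<kappa>\<^sup>2 * ?U x - (\<Sum>b\<in>Basis. ?U'' b x)"
      using sum_yukawa_reg''[OF \<epsilon> dim, of \<kappa> x] by simp
    show ?thesis unfolding q by (simp add: sum_subtractf sum_distrib_left sum_distrib_right algebra_simps)
  qed
  then show ?thesis using sum isum il by simp
qed

lemma lborel_integral_scale_3: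
  fixes f :: "'a::euclidean_space \<Rightarrow> complex"
  assumes dim: "DIM('a) = 3" and c: "c > 0" and [measurable]: "f \<in> borel_measurable borel"
  shows "(LINT x|lborel. f x) = (LINT x|lborel. of_real (c ^ 3) * f (c *\<^sub>R x))"
proof -
  have "(lborel :: 'a measure) = density (distr lborel borel (\<lambda>x. 0 + c *\<^sub>R x)) (\<lambda>_. ennreal (\<bar>c\<bar> ^ DIM('a)))"
    by (rule lborel_affine) (use c in simp)
  also have "\<dots> = density (distr lborel borel (\<lambda>x. c *\<^sub>R x)) (\<lambda>_. ennreal (c ^ 3))"
    using c by (simp add: dim)
  finally have l: "(lborel :: 'a measure) = density (distr lborel borel (\<lambda>x. c *\<^sub>R x)) (\<lambda>_. ennreal (c ^ 3))" .
  have "integral\<^sup>L (density (distr lborel borel (\<lambda>x. c *\<^sub>R x)) (\<lambda>_. ennreal (c ^ 3))) f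
      = (LINT x|distr lborel borel (\<lambda>x. c *\<^sub>R x). c ^ 3 *\<^sub>R f x)"
    using c by (intro integral_density) auto
  also have "\<dots> = (LINT x|lborel. c ^ 3 *\<^sub>R f (c *\<^sub>R x))"
    by (subst integral_distr) auto
  finally show ?thesis unfolding l[symmetric] by (simp add: scaleR_conv_of_real)
qed

text \<open>The right-hand side of Green's identity concentrates at the origin. After rescaling by
  \<open>\<epsilon>\<close> its density is \<open>m(\<epsilon> \<sigma>) / (4 \<pi> \<sigma>\<^sup>5)\<close> with \<open>\<sigma> = (\<bar>w\<bar>\<^sup>2 + 1)\<^sup>1\<^sup>/\<^sup>2\<close> and \<open>m(s) = (\<kappa>\<^sup>2 s\<^sup>2 + 3 \<kappa> s + 3) exp (-\<kappa> s)\<close>, where \<open>m\<close> is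
  bounded and tends to \<open>3\<close> at \<open>0\<close>.\<close>

lemma regularised_delta_limit_3:
  fixes \<phi> :: "'a::euclidean_space \<Rightarrow> complex"
  assumes dim: "DIM('a) = 3" and \<kappa>: "Re \<kappa> > 0"
    and cont: "continuous_on UNIV \<phi>" and bound: "\<And>x. cmod (\<phi> x) \<le> B"
  shows "(\<lambda>n. LINT x|lborel. of_real ((1 / real (Suc n))\<^sup>2) * yukawa'' \<kappa> (of_real (regnorm (1 / real (Suc n)) x)) * \<phi> x) \<longlonglongrightarrow> \<phi> 0"
proof -
  define e where "e n = 1 / real (Suc n)" for n
  have e: "e n > 0" for n by (simp add: e_def)
  have e0: "e \<longlonglongrightarrow> 0" unfolding e_def[abs_def] by real_asymp
  define \<sigma> where "\<sigma> w = sqrt ((norm w)\<^sup>2 + 1)" for w :: 'a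
  have \<sigma>: "\<sigma> w > 0" for w by (simp add: \<sigma>_def add_nonneg_pos)
  define m where "m s = (\<kappa>\<^sup>2 * of_real (s\<^sup>2) + 3 * \<kappa> * of_real s + 3) * exp (- \<kappa> * of_real s)" for s
  have [measurable]: "\<phi> \<in> borel_measurable borel" "\<sigma> \<in> borel_measurable borel"
    using borel_measurable_continuous_onI[OF cont] by (auto simp: \<sigma>_def[abs_def])
  have [measurable]: "m \<in> borel_measurable borel"
    by (rule borel_measurable_continuous_onI) (auto simp: m_def[abs_def] intro!: continuous_intros)
  have mc: "m \<midarrow>0\<rightarrow> m 0" unfolding m_def[abs_def] by (intro tendsto_intros)
  obtain C where C: "\<And>s. s \<ge> 0 \<Longrightarrow> cmod (m s) \<le> C"
  proof
    fix s :: real assume s: "s \<ge> 0"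
    define \<beta> where "\<beta> = Re \<kappa>"
    define C where "C = 2 * (cmod \<kappa>)\<^sup>2 / \<beta>\<^sup>2 + 3 * cmod \<kappa> / \<beta> + 3"
    have \<beta>: "\<beta> > 0" using \<kappa> by (simp add: \<beta>_def)
    have "1 + \<beta> * s + (\<beta> * s)\<^sup>2 / 2 \<le> exp (\<beta> * s)"
      using s \<beta> by (intro exp_lower_Taylor_quadratic) auto
    moreover have "0 \<le> \<beta> * s" "0 \<le> (\<beta> * s)\<^sup>2" using s \<beta> by auto
    ultimately have ex: "1 \<le> exp (\<beta> * s)" "\<beta> * s \<le> exp (\<beta> * s)" "(\<beta> * s)\<^sup>2 \<le> 2 * exp (\<beta> * s)" by linarith+
    have "cmod (\<kappa>\<^sup>2 * of_real (s\<^sup>2) + 3 * \<kappa> * of_real s + 3) \<le> (cmod \<kappa>)\<^sup>2 * s\<^sup>2 + 3 * cmod \<kappa> * s + 3"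
      using s by (intro norm_triangle_le add_mono) (auto simp: norm_mult norm_power)
    also have "\<dots> = (cmod \<kappa>)\<^sup>2 / \<beta>\<^sup>2 * (\<beta> * s)\<^sup>2 + 3 * cmod \<kappa> / \<beta> * (\<beta> * s) + 3 * 1"
      using \<beta> by (simp add: power_mult_distrib)
    also have "\<dots> \<le> (cmod \<kappa>)\<^sup>2 / \<beta>\<^sup>2 * (2 * exp (\<beta> * s)) + 3 * cmod \<kappa> / \<beta> * exp (\<beta> * s) + 3 * exp (\<beta> * s)"
      using ex \<beta> by (intro add_mono mult_left_mono) auto
    also have "\<dots> = C * exp (\<beta> * s)" by (simp add: C_def algebra_simps)
    finally have le: "cmod (\<kappa>\<^sup>2 * of_real (s\<^sup>2) + 3 * \<kappa> * of_real s + 3) \<le> C * exp (\<beta> * s)" .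
    have "0 \<le> C" using \<beta> by (simp add: C_def)
    with le have "cmod (m s) \<le> C * exp (\<beta> * s) * exp (- \<beta> * s)"
      unfolding m_def norm_mult by (intro mult_mono) (auto simp: \<beta>_def)
    also have "\<dots> = C" by (simp add: mult.assoc flip: exp_add)
    finally show "cmod (m s) \<le> 2 * (cmod \<kappa>)\<^sup>2 / (Re \<kappa>)\<^sup>2 + 3 * cmod \<kappa> / Re \<kappa> + 3"
      by (simp add: C_def \<beta>_def)
  qed
  have C0: "0 \<le> C" using C[of 0] norm_ge_zero order_trans by blast
  have rescale: "(LINT x|lborel. of_real ((e n)\<^sup>2) * yukawa'' \<kappa> (of_real (regnorm (e n) x)) * \<phi> x)
      = (LINT w|lborel. m (e n * \<sigma> w) * (1 / of_real (4 * pi * \<sigma> w ^ 5)) * \<phi> (e n *\<^sub>R w))" for n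
  proof -
    have "regnorm (e n) x \<noteq> 0" for x :: 'a using regnorm_bounds(3)[OF e[of n], of x] by simp
    then have "continuous_on UNIV (\<lambda>x :: 'a. yukawa'' \<kappa> (of_real (regnorm (e n) x)))"
      unfolding yukawa''_def by (auto intro!: continuous_intros continuous_on_regnorm[OF e])
    then have [measurable]: "(\<lambda>x :: 'a. yukawa'' \<kappa> (of_real (regnorm (e n) x))) \<in> borel_measurable borel"
      by (rule borel_measurable_continuous_onI)
    have "(LINT x|lborel. of_real ((e n)\<^sup>2) * yukawa'' \<kappa> (of_real (regnorm (e n) x)) * \<phi> x)
      = (LINT w|lborel. of_real (e n ^ 3) * (of_real ((e n)\<^sup>2) * yukawa'' \<kappa> (of_real (regnorm (e n) (e n *\<^sub>R w))) * \<phi> (e n *\<^sub>R w)))"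
      by (rule lborel_integral_scale_3[OF dim e]) measurable
    also have "\<dots> = (LINT w|lborel. m (e n * \<sigma> w) * (1 / of_real (4 * pi * \<sigma> w ^ 5)) * \<phi> (e n *\<^sub>R w))"
    proof (rule Bochner_Integration.integral_cong[OF refl])
      fix w :: 'a
      have "(norm (e n *\<^sub>R w))\<^sup>2 + (e n)\<^sup>2 = (e n)\<^sup>2 * ((norm w)\<^sup>2 + 1)"
        by (simp add: power_mult_distrib algebra_simps)
      then have rn: "regnorm (e n) (e n *\<^sub>R w) = e n * \<sigma> w"
        using e[of n] by (simp add: regnorm_def[OF e] \<sigma>_def real_sqrt_mult)
      have "of_real (e n ^ 3) * (of_real ((e n)\<^sup>2) * yukawa'' \<kappa> (of_real (e n * \<sigma> w)))
          = m (e n * \<sigma> w) * (1 / of_real (4 * pi * \<sigma> w ^ 5))"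
        using e[of n] \<sigma>[of w] by (simp add: yukawa''_def m_def field_simps eval_nat_numeral)
      then show "of_real (e n ^ 3) * (of_real ((e n)\<^sup>2) * yukawa'' \<kappa> (of_real (regnorm (e n) (e n *\<^sub>R w))) * \<phi> (e n *\<^sub>R w))
          = m (e n * \<sigma> w) * (1 / of_real (4 * pi * \<sigma> w ^ 5)) * \<phi> (e n *\<^sub>R w)"
        unfolding rn by (simp add: mult.assoc[symmetric])
    qed
    finally show ?thesis .
  qed
  note mass = regularised_delta_mass_3[OF dim, folded \<sigma>_def]
  have "(\<lambda>n. LINT w|lborel. m (e n * \<sigma> w) * (1 / of_real (4 * pi * \<sigma> w ^ 5)) * \<phi> (e n *\<^sub>R w))
      \<longlonglongrightarrow> (LINT w|lborel. m 0 * (1 / of_real (4 * pi * \<sigma> w ^ 5)) * \<phi> 0)"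
  proof (rule integral_dominated_convergence)
    show "integrable lborel (\<lambda>w. C * B / (12 * pi) * (3 / \<sigma> w ^ 5))"
      using mass by (intro integrable_mult_right) (simp add: has_bochner_integral_iff)
    show "AE w in lborel. (\<lambda>n. m (e n * \<sigma> w) * (1 / of_real (4 * pi * \<sigma> w ^ 5)) * \<phi> (e n *\<^sub>R w))
        \<longlonglongrightarrow> m 0 * (1 / of_real (4 * pi * \<sigma> w ^ 5)) * \<phi> 0"
    proof (intro AE_I2 tendsto_mult tendsto_const)
      fix w
      have "(\<lambda>n. e n * \<sigma> w) \<longlonglongrightarrow> 0" using tendsto_mult_right[OF e0, of "\<sigma> w"] by simp
      then show "(\<lambda>n. m (e n * \<sigma> w)) \<longlonglongrightarrow> m 0"
        using isCont_tendsto_compose[of 0 m] mc by (simp add: isCont_def)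
      have "(\<lambda>n. e n *\<^sub>R w) \<longlonglongrightarrow> 0" using tendsto_scaleR[OF e0 tendsto_const, of w] by simp
      then show "(\<lambda>n. \<phi> (e n *\<^sub>R w)) \<longlonglongrightarrow> \<phi> 0"
        using isCont_tendsto_compose[of 0 \<phi>] cont by (simp add: continuous_on_eq_continuous_at)
    qed
    fix n
    show "AE w in lborel. cmod (m (e n * \<sigma> w) * (1 / of_real (4 * pi * \<sigma> w ^ 5)) * \<phi> (e n *\<^sub>R w)) \<le> C * B / (12 * pi) * (3 / \<sigma> w ^ 5)"
    proof (intro AE_I2)
      fix w
      have "cmod (m (e n * \<sigma> w)) * (1 / (4 * pi * \<sigma> w ^ 5)) * cmod (\<phi> (e n *\<^sub>R w)) \<le> C * (1 / (4 * pi * \<sigma> w ^ 5)) * B"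
        using C[of "e n * \<sigma> w"] e[of n] \<sigma>[of w] bound C0 by (intro mult_mono) auto
      then show "cmod (m (e n * \<sigma> w) * (1 / of_real (4 * pi * \<sigma> w ^ 5)) * \<phi> (e n *\<^sub>R w)) \<le> C * B / (12 * pi) * (3 / \<sigma> w ^ 5)"
        using \<sigma>[of w] by (simp add: norm_mult norm_divide norm_power mult.commute[of B C])
    qed
  qed measurable
  moreover have "(LINT w|lborel. m 0 * (1 / of_real (4 * pi * \<sigma> w ^ 5)) * \<phi> 0) = \<phi> 0"
  proof -
    have "(LINT w|lborel. m 0 * (1 / of_real (4 * pi * \<sigma> w ^ 5)) * \<phi> 0) = (LINT w|lborel. of_real (3 / \<sigma> w ^ 5) * (\<phi> 0 / of_real (4 * pi)))"
      by (intro Bochner_Integration.integral_cong) (auto simp: m_def)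
    also have "\<dots> = of_real (LINT w|lborel. 3 / \<sigma> w ^ 5) * (\<phi> 0 / of_real (4 * pi))"
      by (simp only: integral_mult_left_zero integral_complex_of_real)
    also have "(LINT w|lborel. 3 / \<sigma> w ^ 5) = 4 * pi"
      using mass by (simp add: has_bochner_integral_iff)
    finally show ?thesis by simp
  qed
  ultimately show ?thesis unfolding rescale[symmetric] by (simp add: e_def)
qed

lemma norm_yukawa_norm: "cmod (yukawa \<kappa> (of_real (norm x))) = exp (- Re \<kappa> * norm x) / norm x * (1 / (4 * pi))"
  by (simp add: yukawa_def norm_divide norm_mult)

lemma yukawa_integrable_3:
  assumes dim: "DIM('a::euclidean_space) = 3" and \<kappa>: "Re \<kappa> > 0"
  shows "integrable lborel (\<lambda>x::'a. yukawa \<kappa> (of_real (norm x)))"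
    and "(LINT x|lborel. cmod (yukawa \<kappa> (of_real (norm (x::'a))))) = 1 / (Re \<kappa>)\<^sup>2"
proof -
  have [measurable]: "(\<lambda>x::'a. yukawa \<kappa> (of_real (norm x))) \<in> borel_measurable borel"
    unfolding yukawa_def by measurable
  have "has_bochner_integral lborel (\<lambda>x::'a. cmod (yukawa \<kappa> (of_real (norm x)))) (4 * pi / (Re \<kappa>)\<^sup>2 * (1 / (4 * pi)))"
    unfolding norm_yukawa_norm by (intro has_bochner_integral_mult_left yukawa_integral_3[OF dim \<kappa>])
  then show "integrable lborel (\<lambda>x::'a. yukawa \<kappa> (of_real (norm x)))"
    "(LINT x|lborel. cmod (yukawa \<kappa> (of_real (norm (x::'a))))) = 1 / (Re \<kappa>)\<^sup>2"
    by (auto simp: has_bochner_integral_iff integrable_norm_iff)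
qed

lemma yukawa_fundamental_3:
  fixes \<phi> :: "'a::euclidean_space \<Rightarrow> complex" and D DD :: "'a \<Rightarrow> 'a \<Rightarrow> complex"
  assumes dim: "DIM('a) = 3" and \<kappa>: "Re \<kappa> > 0"
    and cont: "continuous_on UNIV \<phi>" "\<And>b. b \<in> Basis \<Longrightarrow> continuous_on UNIV (D b)" "\<And>b. b \<in> Basis \<Longrightarrow> continuous_on UNIV (DD b)"
    and bound: "\<And>x. cmod (\<phi> x) \<le> B" "\<And>b x. b \<in> Basis \<Longrightarrow> cmod (D b x) \<le> B" "\<And>b x. b \<in> Basis \<Longrightarrow> cmod (DD b x) \<le> B"
    and deriv: "\<And>b x t. b \<in> Basis \<Longrightarrow> ((\<lambda>t. \<phi> (x + t *\<^sub>R b)) has_vector_derivative D b (x + t *\<^sub>R b)) (at t)"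
      "\<And>b x t. b \<in> Basis \<Longrightarrow> ((\<lambda>t. D b (x + t *\<^sub>R b)) has_vector_derivative DD b (x + t *\<^sub>R b)) (at t)"
  shows "(LINT x|lborel. yukawa \<kappa> (of_real (norm x)) * (\<kappa>\<^sup>2 * \<phi> x - (\<Sum>b\<in>Basis. DD b x))) = \<phi> 0"
proof -
  let ?L = "\<lambda>x. \<kappa>\<^sup>2 * \<phi> x - (\<Sum>b\<in>Basis. DD b x)"
  let ?e = "\<lambda>n. 1 / real (Suc n)"
  have e: "?e n > 0" for n by simp
  have cL: "continuous_on UNIV ?L" using cont by (intro continuous_intros) auto
  have [measurable]: "?L \<in> borel_measurable borel" by (rule borel_measurable_continuous_onI[OF cL])
  have [measurable]: "(\<lambda>x::'a. yukawa \<kappa> (of_real (norm x))) \<in> borel_measurable borel"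
    unfolding yukawa_def by measurable
  define B' where "B' = (cmod \<kappa>)\<^sup>2 * B + 3 * B"
  have L: "cmod (?L x) \<le> B'" for x
  proof -
    have "cmod (\<kappa>\<^sup>2 * \<phi> x) \<le> (cmod \<kappa>)\<^sup>2 * B"
      using bound(1)[of x] by (simp add: norm_mult norm_power mult_left_mono)
    moreover have "cmod (\<Sum>b\<in>Basis. DD b x) \<le> 3 * B"
      using sum_norm_bound[of Basis "\<lambda>b. DD b x" B] bound(3) dim by simp
    ultimately show ?thesis
      using norm_triangle_ineq4[of "\<kappa>\<^sup>2 * \<phi> x" "\<Sum>b\<in>Basis. DD b x"] by (simp add: B'_def)
  qed
  have B': "0 \<le> B'" using L[of 0] norm_ge_zero order_trans by blast
  have green: "(LINT x|lborel. yukawa_reg (?e n) \<kappa> x * ?L x)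
      = (LINT x|lborel. of_real ((?e n)\<^sup>2) * yukawa'' \<kappa> (of_real (regnorm (?e n) x)) * \<phi> x)" for n
    by (rule yukawa_reg_green[OF dim e \<kappa>, where D = D and DD = DD and \<phi> = \<phi>]) (use cont bound deriv in auto)
  have "(\<lambda>n. LINT x|lborel. yukawa_reg (?e n) \<kappa> x * ?L x) \<longlonglongrightarrow> (LINT x|lborel. yukawa \<kappa> (of_real (norm x)) * ?L x)"
  proof (rule integral_dominated_convergence)
    show "integrable lborel (\<lambda>x::'a. B' * cmod (yukawa \<kappa> (of_real (norm x))))"
      using yukawa_integrable_3(1)[OF dim \<kappa>] by simp
    show "AE x in lborel. (\<lambda>n. yukawa_reg (?e n) \<kappa> x * ?L x) \<longlonglongrightarrow> yukawa \<kappa> (of_real (norm x)) * ?L x"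
      using AE_lborel_singleton[of 0]
    proof eventually_elim
      case (elim x)
      have "(\<lambda>n. sqrt ((norm x)\<^sup>2 + (?e n)\<^sup>2)) \<longlonglongrightarrow> sqrt ((norm x)\<^sup>2 + 0\<^sup>2)"
        by (intro tendsto_intros) real_asymp
      then have "(\<lambda>n. complex_of_real (regnorm (?e n) x)) \<longlonglongrightarrow> of_real (norm x)"
        unfolding regnorm_def[OF e] by (intro tendsto_of_real) simp
      moreover have "isCont (yukawa \<kappa>) (of_real (norm x))"
        using yukawa_derivs(1)[of "of_real (norm x)" \<kappa>] elim by (intro DERIV_isCont) auto
      ultimately have "(\<lambda>n. yukawa \<kappa> (of_real (regnorm (?e n) x))) \<longlonglongrightarrow> yukawa \<kappa> (of_real (norm x))"
        by (rule isCont_tendsto_compose[rotated])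
      then show ?case
        unfolding yukawa_reg_def[OF e] by (intro tendsto_mult tendsto_const)
    qed
    fix n
    have "yukawa_reg (?e n) \<kappa> \<in> borel_measurable (borel :: 'a measure)"
      by (rule borel_measurable_continuous_onI[OF continuous_on_yukawa_reg(1)[OF e]])
    then show "(\<lambda>x. yukawa_reg (?e n) \<kappa> x * ?L x) \<in> borel_measurable lborel" by measurable
    show "AE x in lborel. cmod (yukawa_reg (?e n) \<kappa> x * ?L x) \<le> B' * cmod (yukawa \<kappa> (of_real (norm x)))"
      using AE_lborel_singleton[of 0]
    proof eventually_elim
      case (elim x)
      have "cmod (yukawa_reg (?e n) \<kappa> x) \<le> exp (- Re \<kappa> * norm x) / (4 * pi * norm x)"
        unfolding yukawa_reg_def[OF e] using elim \<kappa> by (intro norm_yukawa_le regnorm_bounds[OF e]) auto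
      also have "\<dots> = cmod (yukawa \<kappa> (of_real (norm x)))"
        unfolding norm_yukawa_norm by simp
      finally show ?case
        unfolding norm_mult mult.commute[of B'] using L B' by (intro mult_mono) auto
    qed
  qed measurable
  moreover have "(\<lambda>n. LINT x|lborel. yukawa_reg (?e n) \<kappa> x * ?L x) \<longlonglongrightarrow> \<phi> 0"
    unfolding green
    by (rule regularised_delta_limit_3[OF dim \<kappa> cont(1) bound(1)])
  ultimately show ?thesis by (rule LIMSEQ_unique)
qed

section \<open>Dimension three\<close>

lemma Basis_vec_axis: "b \<in> (Basis :: (real ^ 'n::finite) set) \<longleftrightarrow> (\<exists>i. b = axis i 1)"
  by (auto simp: Basis_vec_def)

lemma sum_Basis_vec: "(\<Sum>b\<in>(Basis :: (real ^ 'n::finite) set). f b) = (\<Sum>i\<in>UNIV. f (axis i 1))"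
proof -
  have B: "Basis = (\<lambda>i. axis i 1 :: real ^ 'n) ` UNIV" using Basis_vec_axis by auto
  have "inj (\<lambda>i. axis i 1 :: real ^ 'n)" by (auto simp: inj_on_def axis_eq_axis)
  then show ?thesis unfolding B by (subst sum.reindex) auto
qed

lemma finite_family_bound:
  fixes f :: "'i::finite \<Rightarrow> 'x \<Rightarrow> complex"
  assumes "\<And>i. \<exists>B. \<forall>x. cmod (f i x) \<le> B"
  obtains B where "\<And>i x. cmod (f i x) \<le> B"
proof -
  obtain b where b: "\<And>i x. cmod (f i x) \<le> b i" using assms by metis
  have "cmod (f i x) \<le> Max (range b)" for i x
    by (rule order_trans[OF b Max_ge]) auto
  then show ?thesis using that by blast
qed

lemma test_function_derivs_bounded:
  fixes \<phi> :: "real ^ 'n::finite \<Rightarrow> complex"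
  assumes \<phi>: "\<phi> \<in> test_functions"
  obtains B where "\<And>x. cmod (\<phi> x) \<le> B" "\<And>i x. cmod (partial_deriv i \<phi> x) \<le> B"
    "\<And>i x. cmod (partial_deriv i (partial_deriv i \<phi>) x) \<le> B"
proof -
  note d = test_function_partial_deriv
  have ex: "\<exists>B. \<forall>x. cmod (f x) \<le> B" if "f \<in> test_functions" for f :: "real ^ 'n \<Rightarrow> complex"
    using test_function_bounded[OF that] by metis
  obtain B0 where B0: "\<And>x. cmod (\<phi> x) \<le> B0" using ex[OF \<phi>] by blast
  obtain B1 where B1: "\<And>i x. cmod (partial_deriv i \<phi> x) \<le> B1"
    using finite_family_bound[of "\<lambda>i. partial_deriv i \<phi>", OF ex[OF d[OF \<phi>]]] by blast
  obtain B2 where B2: "\<And>i x. cmod (partial_deriv i (partial_deriv i \<phi>) x) \<le> B2"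
    using finite_family_bound[of "\<lambda>i. partial_deriv i (partial_deriv i \<phi>)", OF ex[OF d[OF d[OF \<phi>]]]] by blast
  show ?thesis
    by (rule that[of "max B0 (max B1 B2)"]) (use B0 B1 B2 in \<open>auto intro: order_trans[OF _ max.cobounded1]
      order_trans[OF _ max.cobounded2] simp: le_max_iff_disj\<close>)
qed

lemma fundamental_solution_yukawa_3:
  assumes \<kappa>: "Re \<kappa> > 0"
  shows "fundamental_solution (\<kappa>\<^sup>2) (\<lambda>x::real^3. yukawa \<kappa> (of_real (norm x)))"
  unfolding fundamental_solution_def
proof (intro conjI ballI)
  have dim: "DIM(real^3) = 3" by simp
  show "integrable lborel (\<lambda>x::real^3. yukawa \<kappa> (of_real (norm x)))"
    by (rule yukawa_integrable_3[OF dim \<kappa>])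
  fix \<phi> :: "real^3 \<Rightarrow> complex" assume \<phi>: "\<phi> \<in> test_functions"
  obtain B where B: "\<And>x. cmod (\<phi> x) \<le> B" "\<And>i x. cmod (partial_deriv i \<phi> x) \<le> B"
    "\<And>i x. cmod (partial_deriv i (partial_deriv i \<phi>) x) \<le> B"
    using test_function_derivs_bounded[OF \<phi>] by blast
  define D where "D b x = frechet_derivative \<phi> (at x) b" for b x
  define DD where "DD b x = frechet_derivative (D b) (at x) b" for b x
  have D: "D (axis i 1) = partial_deriv i \<phi>" for i by (auto simp: D_def partial_deriv_def)
  have DD: "DD (axis i 1) = partial_deriv i (partial_deriv i \<phi>)" for i
    by (rule ext) (simp add: DD_def D partial_deriv_def[of i "partial_deriv i \<phi>"])
  note d = test_function_partial_deriv
  have "(LINT x|lborel. yukawa \<kappa> (of_real (norm x)) * (\<kappa>\<^sup>2 * \<phi> x - (\<Sum>b\<in>Basis. DD b x))) = \<phi> 0"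
  proof (rule yukawa_fundamental_3[OF dim \<kappa>, where D = D and DD = DD and B = B])
    show "continuous_on UNIV \<phi>" using \<phi> by (rule test_functionD)
    show "cmod (\<phi> x) \<le> B" for x by (rule B)
    fix b :: "real^3" assume "b \<in> Basis"
    then obtain i where b: "b = axis i 1" using Basis_vec_axis by blast
    show "continuous_on UNIV (D b)" "continuous_on UNIV (DD b)"
      unfolding b D DD using \<phi> by (auto intro: test_functionD(4) d)
    show "cmod (D b x) \<le> B" "cmod (DD b x) \<le> B" for x unfolding b D DD by (rule B)+
    show "((\<lambda>t. \<phi> (x + t *\<^sub>R b)) has_vector_derivative D b (x + t *\<^sub>R b)) (at t)" for x t
      unfolding b D by (rule has_vector_derivative_partial_deriv[OF test_functionD(3)[OF \<phi>]])
    show "((\<lambda>t. D b (x + t *\<^sub>R b)) has_vector_derivative DD b (x + t *\<^sub>R b)) (at t)" for x t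
      unfolding b D DD by (rule has_vector_derivative_partial_deriv[OF test_functionD(3)[OF d[OF \<phi>]]])
  qed
  then show "(LINT y|lborel. yukawa \<kappa> (of_real (norm y)) * (\<kappa>\<^sup>2 * \<phi> y - lap \<phi> y)) = \<phi> 0"
    by (simp add: sum_Basis_vec DD lap_def)
qed

lemma sq_integrable_yukawa_3: "sq_integrable (\<lambda>x::real^3. yukawa 1 (of_real (norm x)))"
  unfolding sq_integrable_def
proof
  show "(\<lambda>x::real^3. yukawa 1 (of_real (norm x))) \<in> borel_measurable borel"
    unfolding yukawa_def by measurable
  have "(cmod (yukawa 1 (of_real (norm x))))\<^sup>2 = exp (- 2 * norm x) / (norm x)\<^sup>2 * (1 / (4 * pi))\<^sup>2" for x :: "real^3"
    unfolding norm_yukawa_norm power_mult_distrib power_divide exp_of_nat_mult[symmetric] by (simp add: power2_eq_square flip: exp_add)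
  moreover have "integrable lborel (\<lambda>x::real^3. exp (- 2 * norm x) / (norm x)\<^sup>2 * (1 / (4 * pi))\<^sup>2)"
    by (intro integrable_mult_left integrable_exp_norm_over_square_3) auto
  ultimately show "integrable lborel (\<lambda>x::real^3. (cmod (yukawa 1 (of_real (norm x))))\<^sup>2)" by simp
qed

text \<open>The closed left half-plane is convex, and the derivative of the exponential function has modulus
  at most \<open>1\<close> there.\<close>

lemma norm_exp_diff_le:
  assumes "Re a \<le> 0" "Re b \<le> 0"
  shows "cmod (exp a - exp b) \<le> cmod (a - b)"
proof -
  have "cmod (exp a - exp b) \<le> 1 * cmod (a - b)"
  proof (rule field_differentiable_bound[where S = "{w. Re w \<le> 0}" and f' = exp])
    show "convex {w. Re w \<le> 0}" by (rule convex_halfspace_Re_le)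
    show "(exp has_field_derivative exp z) (at z within {w. Re w \<le> 0})" for z
      by (rule has_field_derivative_at_within[OF DERIV_exp])
  qed (use assms in auto)
  then show ?thesis by simp
qed

text \<open>Here \<open>2\<^sup>1\<^sup>/\<^sup>2 = \<bar>1 + i\<bar>\<close> is the distance of the exponents \<open>i k s\<close> and \<open>-k s\<close> relative to \<open>\<bar>k\<bar> s\<close>. The bound is
  sharp to first order at \<open>s = 0\<close>, which gives the constant in dimension three.\<close>

lemma exp_oscillating_diff_le:
  assumes "Re k > 0" "Im k > 0" "s \<ge> 0"
  shows "cmod (exp (- (- \<i> * k) * of_real s) - exp (- k * of_real s)) \<le> sqrt 2 * cmod k * s"
proof -
  have "cmod (exp (- (- \<i> * k) * of_real s) - exp (- k * of_real s)) \<le> cmod (- (- \<i> * k) * of_real s - - k * of_real s)"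
    using assms by (intro norm_exp_diff_le) auto
  also have "- (- \<i> * k) * of_real s - - k * of_real s = (1 + \<i>) * k * of_real s"
    by (simp add: algebra_simps)
  also have "cmod \<dots> = sqrt 2 * cmod k * s"
    using assms by (simp add: norm_mult cmod_def[of "1 + \<i>"])
  finally show ?thesis .
qed

lemma yukawa_diff_bound_3:
  assumes "Re k > 0" "Im k > 0"
  shows "cmod (yukawa (- \<i> * k) (of_real (norm x)) - yukawa k (of_real (norm x))) \<le> sqrt 2 * cmod k / (4 * pi)"
proof (cases "norm x = 0")
  case True
  then show ?thesis by (simp add: yukawa_def)
next
  case False
  have "yukawa (- \<i> * k) (of_real (norm x)) - yukawa k (of_real (norm x))
      = (exp (- (- \<i> * k) * of_real (norm x)) - exp (- k * of_real (norm x))) / of_real (4 * pi * norm x)"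
    by (simp add: yukawa_def diff_divide_distrib)
  then have "cmod (yukawa (- \<i> * k) (of_real (norm x)) - yukawa k (of_real (norm x)))
      = cmod (exp (- (- \<i> * k) * of_real (norm x)) - exp (- k * of_real (norm x))) / (4 * pi * norm x)"
    by (simp add: norm_divide norm_mult)
  also have "\<dots> \<le> sqrt 2 * cmod k * norm x / (4 * pi * norm x)"
    using assms by (intro divide_right_mono exp_oscillating_diff_le) auto
  also have "\<dots> = sqrt 2 * cmod k / (4 * pi)" using False by simp
  finally show ?thesis .
qed

lemma eigenvalue_bound_3:
  fixes V :: "real^3 \<Rightarrow> complex"
  assumes V: "integrable lebesgue V" and z: "z \<in> point_spectrum V" "cmod z = r ^ 4" "r > 0"
  shows "1 \<le> sqrt 2 / (8 * pi * r) * L1_norm V"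
proof (rule eigenvalue_bound_of_kernels[OF V z, where g = "\<lambda>\<kappa> x. yukawa \<kappa> (of_real (norm x))"])
  show "fundamental_solution (\<kappa>\<^sup>2) (\<lambda>x::real^3. yukawa \<kappa> (of_real (norm x)))" if "Re \<kappa> > 0" for \<kappa>
    by (rule fundamental_solution_yukawa_3[OF that])
  show "(LINT x|lborel. cmod (yukawa \<kappa> (of_real (norm (x::real^3))))) \<le> 1 / (Re \<kappa>)\<^sup>2" if "Re \<kappa> > 0" for \<kappa>
    using yukawa_integrable_3(2)[OF _ that, where 'a = "real^3"] by simp
  show "sq_integrable (\<lambda>x::real^3. yukawa 1 (of_real (norm x)))" by (rule sq_integrable_yukawa_3)
  show "sqrt 2 / (8 * pi * r) > 0" using z by simp
  show "cmod (yukawa (- \<i> * k) (of_real (norm x)) - yukawa k (of_real (norm x))) \<le> 2 * (sqrt 2 / (8 * pi * r)) * (cmod k)\<^sup>2"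
    if k: "Re k > 0" "Im k > 0" "cmod k \<ge> r" for k and x :: "real^3"
  proof -
    have "cmod k * r \<le> cmod k * cmod k" using k(3) by (intro mult_left_mono) auto
    then have "sqrt 2 / (4 * pi * r) * (cmod k * r) \<le> sqrt 2 / (4 * pi * r) * (cmod k * cmod k)"
      by (rule mult_left_mono) (use z in simp)
    then have "sqrt 2 * cmod k / (4 * pi) \<le> 2 * (sqrt 2 / (8 * pi * r)) * (cmod k)\<^sup>2"
      using z k(3) by (simp add: power2_eq_square)
    with yukawa_diff_bound_3[OF k(1,2), of x] show ?thesis by linarith
  qed
qed

section \<open>Dimension one\<close>

lemma lborel_vec_1: "(lborel :: (real^1) measure) = distr lborel borel vec"
proof (rule lborel_eqI)
  fix l u :: "real^1"
  assume le: "\<And>b. b \<in> Basis \<Longrightarrow> l \<bullet> b \<le> u \<bullet> b"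
  have B: "(Basis :: (real^1) set) = {axis 1 1}" using Basis_vec_axis by (auto simp: num1_eq1)
  have "vec -` box l u = {l $ 1<..<u $ 1}"
    by (auto simp: mem_box_cart num1_eq1)
  moreover have "vec \<in> borel_measurable (borel :: real measure)"
    by (rule borel_measurable_continuous_onI) (auto simp: vec_def intro!: continuous_intros)
  ultimately have "emeasure (distr lborel borel vec) (box l u) = emeasure lborel {l $ 1<..<u $ 1}"
    by (subst emeasure_distr) auto
  also have "\<dots> = ennreal (u $ 1 - l $ 1)"
    using le[of "axis 1 1"] by (simp add: B inner_axis)
  finally show "emeasure (distr lborel borel vec) (box l u) = ennreal (\<Prod>b\<in>Basis. (u - l) \<bullet> b)"
    by (simp add: B inner_axis)
qed simp

lemma lborel_vec_1_integral:
  fixes f :: "real^1 \<Rightarrow> 'b::{banach, second_countable_topology}"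
  assumes [measurable]: "f \<in> borel_measurable borel"
  shows "integrable lborel f \<longleftrightarrow> integrable lborel (\<lambda>t. f (vec t))" "(LINT x|lborel. f x) = (LINT t|lborel. f (vec t))"
proof -
  have [measurable]: "(vec :: real \<Rightarrow> real^1) \<in> borel_measurable borel"
    by (rule borel_measurable_continuous_onI) (auto simp: vec_def intro!: continuous_intros)
  show "integrable lborel f \<longleftrightarrow> integrable lborel (\<lambda>t. f (vec t))"
    unfolding lborel_vec_1 by (subst integrable_distr_eq) auto
  show "(LINT x|lborel. f x) = (LINT t|lborel. f (vec t))"
    unfolding lborel_vec_1 by (subst integral_distr) auto
qed

definition green_1 :: "complex \<Rightarrow> real^1 \<Rightarrow> complex" where
  "green_1 \<kappa> x = exp (- \<kappa> * of_real \<bar>x $ 1\<bar>) / (2 * \<kappa>)"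

lemma green_1_measurable [measurable]: "green_1 \<kappa> \<in> borel_measurable borel"
  unfolding green_1_def[abs_def] by (intro borel_measurable_divide borel_measurable_continuous_onI continuous_intros)

lemma has_bochner_integral_exp_abs:
  fixes \<beta> :: real
  assumes \<beta>: "\<beta> > 0"
  shows "has_bochner_integral lborel (\<lambda>t. exp (- \<beta> * \<bar>t\<bar>)) (2 * (1 / \<beta>))"
proof -
  let ?F = "\<lambda>t. - exp (- \<beta> * t) / \<beta>"
  have "(?F \<longlongrightarrow> - 0 / \<beta>) at_top"
    using tendsto_power_times_exp_minus[OF \<beta>, of 0] \<beta> by (intro tendsto_intros) auto
  then have "(\<integral>\<^sup>+t. ennreal (exp (- \<beta> * t)) * indicator {0..} t \<partial>lborel) = ennreal (- 0 / \<beta> - ?F 0)"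
    using \<beta> by (intro nn_integral_FTC_atLeast) (auto intro!: derivative_eq_intros)
  then have "(\<integral>\<^sup>+t. ennreal (indicator {0..} t *\<^sub>R exp (- \<beta> * \<bar>t\<bar>)) \<partial>lborel) = ennreal (1 / \<beta>)"
    by (subst nn_integral_cong[where v = "\<lambda>t. ennreal (exp (- \<beta> * t)) * indicator {0..} t"]) (auto simp: indicator_def)
  then have "has_bochner_integral lborel (\<lambda>t. indicator {0..} t *\<^sub>R exp (- \<beta> * \<bar>t\<bar>)) (1 / \<beta>)"
    using \<beta> by (intro has_bochner_integral_nn_integral) auto
  then have "has_bochner_integral lborel (\<lambda>t. exp (- \<beta> * \<bar>t\<bar>)) (2 *\<^sub>R (1 / \<beta>))"
    by (rule has_bochner_integral_even_function) simp
  then show ?thesis by simp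
qed

lemma norm_green_1: "cmod (green_1 \<kappa> (vec t)) = exp (- Re \<kappa> * \<bar>t\<bar>) * (1 / (2 * cmod \<kappa>))"
  by (simp add: green_1_def norm_divide norm_mult)

lemma green_1_L1:
  assumes \<kappa>: "Re \<kappa> > 0"
  shows "integrable lborel (green_1 \<kappa>)" "(LINT x|lborel. cmod (green_1 \<kappa> x)) \<le> 1 / (Re \<kappa>)\<^sup>2"
proof -
  have b: "has_bochner_integral lborel (\<lambda>t. cmod (green_1 \<kappa> (vec t))) (2 * (1 / Re \<kappa>) * (1 / (2 * cmod \<kappa>)))"
    unfolding norm_green_1 by (intro has_bochner_integral_mult_left has_bochner_integral_exp_abs \<kappa>)
  then have "integrable lborel (\<lambda>x. cmod (green_1 \<kappa> x))"
    using lborel_vec_1_integral(1)[of "\<lambda>x. cmod (green_1 \<kappa> x)"] by (simp add: has_bochner_integral_iff)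
  then show "integrable lborel (green_1 \<kappa>)" by (subst (asm) integrable_norm_iff) auto
  have "(LINT x|lborel. cmod (green_1 \<kappa> x)) = 1 / (Re \<kappa> * cmod \<kappa>)"
    using lborel_vec_1_integral(2)[of "\<lambda>x. cmod (green_1 \<kappa> x)"] b by (simp add: has_bochner_integral_iff)
  also have "\<dots> \<le> 1 / (Re \<kappa>)\<^sup>2"
    unfolding power2_eq_square using \<kappa> abs_Re_le_cmod[of \<kappa>] by (intro frac_le mult_left_mono) auto
  finally show "(LINT x|lborel. cmod (green_1 \<kappa> x)) \<le> 1 / (Re \<kappa>)\<^sup>2" .
qed

lemma sq_integrable_green_1: "sq_integrable (green_1 1)"
  unfolding sq_integrable_def
proof
  have "(cmod (green_1 1 (vec t)))\<^sup>2 = exp (- 2 * \<bar>t\<bar>) * (1 / 4)" for t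
    unfolding norm_green_1 by (simp add: power2_eq_square flip: exp_add)
  then have eq: "(\<lambda>t. (cmod (green_1 1 (vec t)))\<^sup>2) = (\<lambda>t. exp (- 2 * \<bar>t\<bar>) * (1 / 4))" by blast
  have "integrable lborel (\<lambda>t. (cmod (green_1 1 (vec t)))\<^sup>2)"
    unfolding eq using has_bochner_integral_exp_abs[of 2]
    by (intro integrable_mult_left) (simp add: has_bochner_integral_iff)
  then show "integrable lborel (\<lambda>x. (cmod (green_1 1 x))\<^sup>2)"
    using lborel_vec_1_integral(1)[of "\<lambda>x. (cmod (green_1 1 x))\<^sup>2"] by simp
qed measurable

lemma fundamental_solution_green_1:
  assumes \<kappa>: "Re \<kappa> > 0"
  shows "fundamental_solution (\<kappa>\<^sup>2) (green_1 \<kappa>)"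
  unfolding fundamental_solution_def
proof (intro conjI ballI)
  show "integrable lborel (green_1 \<kappa>)" by (rule green_1_L1[OF \<kappa>])
  have \<kappa>0: "\<kappa> \<noteq> 0" using \<kappa> by auto
  fix \<phi> :: "real^1 \<Rightarrow> complex" assume \<phi>: "\<phi> \<in> test_functions"
  note d = test_function_partial_deriv
  define p where "p t = \<phi> (vec t)" for t
  define p1 where "p1 t = partial_deriv 1 \<phi> (vec t)" for t
  define p2 where "p2 t = partial_deriv 1 (partial_deriv 1 \<phi>) (vec t)" for t
  have vec_eq: "(vec t :: real^1) = 0 + t *\<^sub>R axis 1 1" for t
    by (auto simp: vec_eq_iff axis_def num1_eq1)
  have derivs: "(p has_vector_derivative p1 t) (at t)" "(p1 has_vector_derivative p2 t) (at t)" for t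
    unfolding p_def[abs_def] p1_def[abs_def] p2_def vec_eq
    by (rule has_vector_derivative_partial_deriv[OF test_functionD(3)] \<phi> d[OF \<phi>])+
  have cvec: "continuous_on UNIV (vec :: real \<Rightarrow> real^1)" by (auto simp: vec_def intro!: continuous_intros)
  have cont: "continuous_on A p" "continuous_on A p2" for A
    unfolding p_def[abs_def] p2_def[abs_def]
    using test_functionD(4)[OF \<phi>] test_functionD(4)[OF d[OF d[OF \<phi>]]] cvec
    by (auto intro: continuous_on_compose2[of UNIV] continuous_on_subset)
  obtain c where c: "\<And>x. x \<notin> cbox (-c) c \<Longrightarrow> \<phi> x = 0" using test_function_supported_cbox[OF \<phi>] by blast
  define a where "a = \<bar>c $ 1\<bar> + 1"
  have a: "a > 0" by (simp add: a_def)
  have p0: "p t = 0" if "\<bar>t\<bar> > \<bar>c $ 1\<bar>" for t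
    unfolding p_def using that by (intro c) (auto simp: mem_box_cart num1_eq1)
  have op: "open {t. \<bar>t\<bar> > \<bar>c $ 1\<bar>}" by (intro open_Collect_less continuous_intros)
  have p10: "p1 t = 0" if "\<bar>t\<bar> > \<bar>c $ 1\<bar>" for t
  proof -
    have "(p has_vector_derivative 0) (at t)"
      by (rule has_vector_derivative_transform_within_open[of "\<lambda>_. 0" _ _ "{t. \<bar>t\<bar> > \<bar>c $ 1\<bar>}"])
        (use that p0 op in auto)
    then show ?thesis using derivs(1)[of t] vector_derivative_unique_at by blast
  qed
  have p20: "p2 t = 0" if "\<bar>t\<bar> > \<bar>c $ 1\<bar>" for t
  proof -
    have "(p1 has_vector_derivative 0) (at t)"
      by (rule has_vector_derivative_transform_within_open[of "\<lambda>_. 0" _ _ "{t. \<bar>t\<bar> > \<bar>c $ 1\<bar>}"])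
        (use that p10 op in auto)
    then show ?thesis using derivs(2)[of t] vector_derivative_unique_at by blast
  qed
  \<comment> \<open>\<open>s = -1\<close> on the right half-line and \<open>s = 1\<close> on the left one; \<open>?F s\<close> is a primitive of the integrand \<open>?f s\<close>\<close>
  let ?f = "\<lambda>s t. exp (s * \<kappa> * of_real t) / (2 * \<kappa>) * (\<kappa>\<^sup>2 * p t - p2 t)"
  let ?F = "\<lambda>s t. exp (s * \<kappa> * of_real t) / (2 * \<kappa>) * (s * \<kappa> * p t - p1 t)"
  have F: "(?F s has_vector_derivative ?f s t) (at t)" if s: "s * s = 1" for s t
  proof -
    have "((\<lambda>t. exp (s * \<kappa> * of_real t)) has_vector_derivative s * \<kappa> * exp (s * \<kappa> * of_real t)) (at t)"
      by (rule has_vector_derivative_real_field) (auto intro!: derivative_eq_intros)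
    then have "(?F s has_vector_derivative
        (exp (s * \<kappa> * of_real t) / (2 * \<kappa>)) * (s * \<kappa> * p1 t - p2 t) + s * \<kappa> * exp (s * \<kappa> * of_real t) / (2 * \<kappa>) * (s * \<kappa> * p t - p1 t)) (at t)"
      by (intro has_vector_derivative_mult has_vector_derivative_divide has_vector_derivative_diff
          has_vector_derivative_mult_right derivs)
    moreover have "s * \<kappa> * E * (s * \<kappa> * P - P1) + E * (s * \<kappa> * P1 - P2) = E * (\<kappa>\<^sup>2 * P - P2)" for E P P1 P2
    proof -
      have "s * \<kappa> * E * (s * \<kappa> * P - P1) + E * (s * \<kappa> * P1 - P2) = E * ((s * s) * \<kappa>\<^sup>2 * P - P2)"
        by (simp add: algebra_simps power2_eq_square)
      then show ?thesis using s by simp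
    qed
    note eq = this[of "exp (s * \<kappa> * of_real t) / (2 * \<kappa>)" "p t" "p1 t" "p2 t"]
    ultimately show ?thesis unfolding eq[symmetric] by (simp add: add.commute)
  qed
  have cf: "continuous_on A (?f s)" for A s by (intro continuous_intros cont) (use \<kappa>0 in auto)
  have FTC: "(LINT t|lborel. indicator {u..v} t *\<^sub>R ?f s t) = ?F s v - ?F s u" if "u \<le> v" "s * s = 1" for u v s
    by (rule integral_FTC_atLeastAtMost[OF that(1) has_vector_derivative_at_within[OF F[OF that(2)]] cf])
  have right: "(LINT t|lborel. indicator {0..a} t *\<^sub>R ?f (-1) t) = ?F (-1) a - ?F (-1) 0"
    by (rule FTC) (use a in auto)
  have left: "(LINT t|lborel. indicator {-a..0} t *\<^sub>R ?f 1 t) = ?F 1 0 - ?F 1 (-a)"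
    by (rule FTC) (use a in auto)
  have ints: "integrable lborel (\<lambda>t. indicator {0..a} t *\<^sub>R ?f (-1) t)" "integrable lborel (\<lambda>t. indicator {-a..0} t *\<^sub>R ?f 1 t)"
    by (rule borel_integrable_atLeastAtMost'[OF cf, unfolded set_integrable_def])+
  have ends: "p a = 0" "p1 a = 0" "p (-a) = 0" "p1 (-a) = 0"
    by (auto simp: a_def intro!: p0 p10)
  have [measurable]: "\<phi> \<in> borel_measurable borel" "lap \<phi> \<in> borel_measurable borel"
    using \<phi> by (auto intro: test_function_measurable test_function_lap)
  have "(LINT y|lborel. green_1 \<kappa> y * (\<kappa>\<^sup>2 * \<phi> y - lap \<phi> y))
      = (LINT t|lborel. green_1 \<kappa> (vec t) * (\<kappa>\<^sup>2 * \<phi> (vec t) - lap \<phi> (vec t)))"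
    by (rule lborel_vec_1_integral(2)) measurable
  also have "\<dots> = (LINT t|lborel. green_1 \<kappa> (vec t) * (\<kappa>\<^sup>2 * p t - p2 t))"
    by (simp add: p_def p2_def lap_def UNIV_1)
  also have "\<dots> = (LINT t|lborel. indicator {0..a} t *\<^sub>R ?f (-1) t + indicator {-a..0} t *\<^sub>R ?f 1 t)"
  proof (rule integral_cong_AE)
    show "AE t in lborel. green_1 \<kappa> (vec t) * (\<kappa>\<^sup>2 * p t - p2 t) = indicator {0..a} t *\<^sub>R ?f (-1) t + indicator {-a..0} t *\<^sub>R ?f 1 t"
      using AE_lborel_singleton[of 0]
    proof eventually_elim
      case (elim t)
      consider "\<bar>t\<bar> > a" | "0 < t" "t \<le> a" | "t < 0" "- a \<le> t" using elim by linarith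
      then show ?case
      proof cases
        case 1
        then have "p t = 0" "p2 t = 0" using p0 p20 by (auto simp: a_def)
        with 1 show ?thesis by (auto simp: indicator_def)
      qed (auto simp: green_1_def)
    qed
    have [measurable]: "p \<in> borel_measurable borel" "p2 \<in> borel_measurable borel"
      using cont by (auto intro: borel_measurable_continuous_onI)
    have [measurable]: "(vec :: real \<Rightarrow> real^1) \<in> borel_measurable borel"
      by (rule borel_measurable_continuous_onI[OF cvec])
    show "(\<lambda>t. green_1 \<kappa> (vec t) * (\<kappa>\<^sup>2 * p t - p2 t)) \<in> borel_measurable lborel" by measurable
    show "(\<lambda>t. indicator {0..a} t *\<^sub>R ?f (-1) t + indicator {-a..0} t *\<^sub>R ?f 1 t) \<in> borel_measurable lborel" by measurable
  qed
  also have "\<dots> = (?F (-1) a - ?F (-1) 0) + (?F 1 0 - ?F 1 (-a))"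
    using ints by (simp only: Bochner_Integration.integral_add left right)
  also have "\<dots> = p 0" using ends \<kappa>0 by (simp add: field_simps)
  also have "p 0 = \<phi> 0"
  proof -
    have "(vec 0 :: real^1) = 0" by (simp add: vec_eq_iff)
    then show ?thesis by (simp add: p_def)
  qed
  finally show "(LINT y|lborel. green_1 \<kappa> y * (\<kappa>\<^sup>2 * \<phi> y - lap \<phi> y)) = \<phi> 0" .
qed

lemma sin_le_sinh_real: "x \<ge> 0 \<Longrightarrow> sin x \<le> sinh (x::real)"
proof -
  assume x: "x \<ge> 0"
  have "sinh 0 - sin 0 \<le> sinh x - sin x"
  proof (rule DERIV_nonneg_imp_nondecreasing[OF x])
    fix y :: real
    have "((\<lambda>x. sinh x - sin x) has_real_derivative cosh y - cos y) (at y)"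
      by (auto intro!: derivative_eq_intros)
    moreover have "cosh y - cos y \<ge> 0" using cosh_real_ge_1[of y] cos_le_one[of y] by linarith
    ultimately show "\<exists>z. ((\<lambda>x. sinh x - sin x) has_real_derivative z) (at y) \<and> 0 \<le> z" by blast
  qed
  then show ?thesis by simp
qed

text \<open>With \<open>a\<close> and \<open>b\<close> the real and imaginary parts of \<open>k r\<close>, the left-hand side is
  \<open>\<bar>i exp (i k r) - exp (-k r)\<bar>\<close>, the oscillating factor of the kernel of \<open>(\<Delta>\<^sup>2 - k\<^sup>4)\<^sup>-\<^sup>1\<close>. Its square is
  \<open>exp (-2a) + exp (-2b) + 2 exp (-a-b) sin (a+b)\<close>, which for \<open>s = a + b\<close> is at most
  \<open>1 + exp (-2s) + 2 exp (-s) sin s \<le> 2\<close>, because \<open>sin s \<le> sinh s\<close>. Equality at \<open>r = 0\<close> makes this the source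
  of the constant in dimension one.\<close>

lemma oscillating_pair_bound:
  fixes a b :: real
  assumes "a \<ge> 0" "b \<ge> 0"
  shows "cmod (\<i> * exp (Complex (- b) a) - exp (Complex (- a) (- b))) \<le> sqrt 2"
proof -
  have "(cmod (\<i> * exp (Complex (- b) a) - exp (Complex (- a) (- b))))\<^sup>2
      = (exp (- b) * sin a + exp (- a) * cos b)\<^sup>2 + (exp (- b) * cos a + exp (- a) * sin b)\<^sup>2"
    unfolding cmod_power2 by (simp add: Re_exp Im_exp power2_commute power2_eq_square algebra_simps)
  also have "\<dots> = (exp (- b))\<^sup>2 * ((sin a)\<^sup>2 + (cos a)\<^sup>2) + (exp (- a))\<^sup>2 * ((sin b)\<^sup>2 + (cos b)\<^sup>2)
      + 2 * exp (- a) * exp (- b) * (sin a * cos b + cos a * sin b)"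
  proof -
    have "(y * sa + x * cb)\<^sup>2 + (y * ca + x * sb)\<^sup>2
        = y\<^sup>2 * (sa\<^sup>2 + ca\<^sup>2) + x\<^sup>2 * (sb\<^sup>2 + cb\<^sup>2) + 2 * x * y * (sa * cb + ca * sb)" for x y sa sb ca cb :: real
      by (simp add: power2_eq_square algebra_simps)
    then show ?thesis .
  qed
  also have "\<dots> = (exp (- b))\<^sup>2 + (exp (- a))\<^sup>2 + 2 * exp (- (a + b)) * sin (a + b)"
  proof -
    have "exp (- (a + b)) = exp (- a) * exp (- b)" by (simp flip: exp_add)
    then show ?thesis unfolding sin_add sin_cos_squared_add by simp
  qed
  also have "\<dots> \<le> 2"
  proof -
    have "0 \<le> (1 - (exp (- a))\<^sup>2) * (1 - (exp (- b))\<^sup>2)"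
      using assms by (intro mult_nonneg_nonneg) (auto simp: power_le_one)
    then have 1: "(exp (- b))\<^sup>2 + (exp (- a))\<^sup>2 \<le> 1 + (exp (- a))\<^sup>2 * (exp (- b))\<^sup>2"
      by (simp add: algebra_simps)
    have e: "(exp (- a))\<^sup>2 * (exp (- b))\<^sup>2 = exp (- (a + b)) * exp (- (a + b))"
      by (simp add: power2_eq_square flip: exp_add)
    have "exp (- (a + b)) * sin (a + b) \<le> exp (- (a + b)) * sinh (a + b)"
      using assms by (intro mult_left_mono sin_le_sinh_real) auto
    also have "\<dots> = (exp (- (a + b)) * exp (a + b) - exp (- (a + b)) * exp (- (a + b))) / 2"
      by (simp add: sinh_def right_diff_distrib)
    also have "exp (- (a + b)) * exp (a + b) = 1" by (simp flip: exp_add)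
    finally have 2: "exp (- (a + b)) * sin (a + b) \<le> (1 - exp (- (a + b)) * exp (- (a + b))) / 2" .
    have "x + 2 * v \<le> 2" if "v \<le> (1 - q) / 2" "x \<le> 1 + y" "y = q" for v x y q :: real
      using that by (simp add: field_simps)
    from this[OF 2 1 e] show ?thesis by (simp only: mult.assoc)
  qed
  finally show ?thesis by (intro real_le_rsqrt)
qed

lemma green_1_diff_bound:
  assumes k: "Re k > 0" "Im k > 0"
  shows "cmod (green_1 (- \<i> * k) x - green_1 k x) \<le> sqrt 2 / (2 * cmod k)"
proof -
  have k0: "k \<noteq> 0" using k by auto
  define t where "t = \<bar>x $ 1\<bar>"
  have t: "t \<ge> 0" by (simp add: t_def)
  have e: "- (- \<i> * k) * of_real t = Complex (- (Im k * t)) (Re k * t)" "- k * of_real t = Complex (- (Re k * t)) (- (Im k * t))"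
    by (auto simp: complex_eq_iff)
  have "E / (2 * (- \<i> * k)) = \<i> * E / (2 * k)" for E using k0 by (simp add: field_simps)
  then have "green_1 (- \<i> * k) x = \<i> * exp (- (- \<i> * k) * of_real t) / (2 * k)"
    unfolding green_1_def t_def by blast
  then have "green_1 (- \<i> * k) x - green_1 k x
      = (\<i> * exp (Complex (- (Im k * t)) (Re k * t)) - exp (Complex (- (Re k * t)) (- (Im k * t)))) / (2 * k)"
    by (simp only: green_1_def t_def[symmetric] e diff_divide_distrib)
  moreover have "cmod (\<i> * exp (Complex (- (Im k * t)) (Re k * t)) - exp (Complex (- (Re k * t)) (- (Im k * t)))) \<le> sqrt 2"
    using k t by (intro oscillating_pair_bound) auto
  ultimately show ?thesis by (simp add: norm_divide norm_mult divide_right_mono)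
qed

lemma eigenvalue_bound_1:
  fixes V :: "real^1 \<Rightarrow> complex"
  assumes V: "integrable lebesgue V" and z: "z \<in> point_spectrum V" "cmod z = r ^ 4" "r > 0"
  shows "1 \<le> sqrt 2 / (4 * r ^ 3) * L1_norm V"
proof (rule eigenvalue_bound_of_kernels[OF V z, where g = green_1])
  show "sqrt 2 / (4 * r ^ 3) > 0" using z by simp
  show "cmod (green_1 (- \<i> * k) x - green_1 k x) \<le> 2 * (sqrt 2 / (4 * r ^ 3)) * (cmod k)\<^sup>2"
    if k: "Re k > 0" "Im k > 0" "cmod k \<ge> r" for k x
  proof -
    have "r ^ 3 \<le> cmod k ^ 3" using k(3) z by (intro power_mono) auto
    moreover have "cmod k > 0" using k z by linarith
    ultimately have "sqrt 2 / (2 * cmod k) \<le> 2 * (sqrt 2 / (4 * r ^ 3)) * (cmod k)\<^sup>2"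
      using z by (simp add: divide_simps power2_eq_square power3_eq_cube mult.commute mult.left_commute)
    with green_1_diff_bound[OF k(1,2), of x] show ?thesis by linarith
  qed
qed (use fundamental_solution_green_1 green_1_L1(2) sq_integrable_green_1 in auto)

section \<open>Dimension two\<close>

text \<open>The method of descent: integrating the three-dimensional kernel over a line gives the
  two-dimensional one. The origin is excluded because the kernel is not integrable over a
  line through its singularity.\<close>

definition green_2 :: "complex \<Rightarrow> real^2 \<Rightarrow> complex" where
  "green_2 \<kappa> x = (if x = 0 then 0 else (LINT t|lborel. yukawa \<kappa> (of_real (norm (x, t :: real)))))"

lemma dim_2_plus_1: "DIM((real^2) \<times> real) = 3"
  by simp

lemma yukawa_integrable_prod:
  assumes \<kappa>: "Re \<kappa> > 0"
  shows "integrable (lborel \<Otimes>\<^sub>M lborel) (\<lambda>p::(real^2) \<times> real. yukawa \<kappa> (of_real (norm p)))"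
    and "(LINT p|(lborel \<Otimes>\<^sub>M lborel). cmod (yukawa \<kappa> (of_real (norm (p::(real^2) \<times> real))))) = 1 / (Re \<kappa>)\<^sup>2"
  using yukawa_integrable_3[OF dim_2_plus_1 \<kappa>] by (simp_all add: lborel_prod)

lemma green_2_AE: "AE x in lborel. green_2 \<kappa> x = (LINT t|lborel. yukawa \<kappa> (of_real (norm (x, t :: real))))"
  using AE_lborel_singleton[of "0::real^2"] by eventually_elim (simp add: green_2_def)

lemma yukawa_prod_measurable [measurable]:
  "(\<lambda>p::(real^2) \<times> real. yukawa \<kappa> (of_real (norm p))) \<in> borel_measurable (lborel \<Otimes>\<^sub>M lborel)"
proof -
  have "(\<lambda>p::(real^2) \<times> real. yukawa \<kappa> (of_real (norm p))) \<in> borel_measurable borel"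
    unfolding yukawa_def by measurable
  then show ?thesis by (simp add: lborel_prod)
qed

lemma line_integral_measurable:
  "(\<lambda>x::real^2. LINT t|lborel. yukawa \<kappa> (of_real (norm (x, t :: real)))) \<in> borel_measurable borel"
proof -
  have "(\<lambda>(x::real^2, t::real). yukawa \<kappa> (of_real (norm (x, t :: real)))) \<in> borel_measurable (lborel \<Otimes>\<^sub>M lborel)"
    using yukawa_prod_measurable[of \<kappa>] by (simp add: split_beta')
  from lborel.borel_measurable_lebesgue_integral[OF this] show ?thesis by simp
qed

lemma green_2_measurable [measurable]: "green_2 \<kappa> \<in> borel_measurable borel"
  unfolding green_2_def[abs_def] using line_integral_measurable by measurable

lemma green_2_L1:
  assumes \<kappa>: "Re \<kappa> > 0"
  shows "integrable lborel (green_2 \<kappa>)" "(LINT x|lborel. cmod (green_2 \<kappa> x)) \<le> 1 / (Re \<kappa>)\<^sup>2"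
proof -
  note int = yukawa_integrable_prod(1)[OF \<kappa>]
  have i1: "integrable lborel (\<lambda>x::real^2. LINT t|lborel. yukawa \<kappa> (of_real (norm (x, t :: real))))"
    by (rule lborel_pair.integrable_fst'[OF int])
  then show i: "integrable lborel (green_2 \<kappa>)"
  proof (rule integrable_cong_AE_imp)
    show "AE x in lborel. (LINT t|lborel. yukawa \<kappa> (of_real (norm (x, t :: real)))) = green_2 \<kappa> x"
      using green_2_AE[of \<kappa>] by eventually_elim simp
  qed measurable
  have i2: "integrable (lborel \<Otimes>\<^sub>M lborel) (\<lambda>p::(real^2) \<times> real. cmod (yukawa \<kappa> (of_real (norm p))))"
    using int by (rule integrable_norm)
  have "(LINT x|lborel. cmod (green_2 \<kappa> x)) \<le> (LINT x|lborel. LINT t|lborel. cmod (yukawa \<kappa> (of_real (norm (x::real^2, t :: real)))))"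
  proof (rule integral_mono_AE)
    show "integrable lborel (\<lambda>x. cmod (green_2 \<kappa> x))" using i by (rule integrable_norm)
    show "integrable lborel (\<lambda>x::real^2. LINT t|lborel. cmod (yukawa \<kappa> (of_real (norm (x, t :: real)))))"
      by (rule lborel_pair.integrable_fst'[OF i2])
    show "AE x in lborel. cmod (green_2 \<kappa> x) \<le> (LINT t|lborel. cmod (yukawa \<kappa> (of_real (norm (x, t :: real)))))"
      using green_2_AE[of \<kappa>] by eventually_elim (simp add: integral_norm_bound)
  qed
  also have "\<dots> = 1 / (Re \<kappa>)\<^sup>2"
    using lborel_pair.integral_fst'[OF i2] yukawa_integrable_prod(2)[OF \<kappa>] by simp
  finally show "(LINT x|lborel. cmod (green_2 \<kappa> x)) \<le> 1 / (Re \<kappa>)\<^sup>2" .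
qed

lemma fundamental_solution_green_2:
  assumes \<kappa>: "Re \<kappa> > 0"
  shows "fundamental_solution (\<kappa>\<^sup>2) (green_2 \<kappa>)"
  unfolding fundamental_solution_def
proof (intro conjI ballI)
  show "integrable lborel (green_2 \<kappa>)" by (rule green_2_L1[OF \<kappa>])
  fix \<phi> :: "real^2 \<Rightarrow> complex" assume \<phi>: "\<phi> \<in> test_functions"
  note d = test_function_partial_deriv
  obtain B where B: "\<And>x. cmod (\<phi> x) \<le> B" "\<And>i x. cmod (partial_deriv i \<phi> x) \<le> B"
    "\<And>i x. cmod (partial_deriv i (partial_deriv i \<phi>) x) \<le> B"
    using test_function_derivs_bounded[OF \<phi>] by blast
  have B0: "0 \<le> B" using B(1)[of 0] norm_ge_zero order_trans by blast
  define E where "E b x = frechet_derivative \<phi> (at x) b" for b x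
  define EE where "EE b x = frechet_derivative (E b) (at x) b" for b x
  have E: "E (axis i 1) = partial_deriv i \<phi>" for i by (auto simp: E_def partial_deriv_def)
  have EE: "EE (axis i 1) = partial_deriv i (partial_deriv i \<phi>)" for i
    by (rule ext) (simp add: EE_def E partial_deriv_def[of i "partial_deriv i \<phi>"])
  have E0: "E 0 = (\<lambda>_. 0)"
    using linear_0[OF linear_frechet_derivative[OF test_functionD(3)[OF \<phi>]]] by (auto simp: E_def)
  have EE0: "EE 0 = (\<lambda>_. 0)" by (auto simp: EE_def E0)
  let ?g = "\<lambda>p::(real^2) \<times> real. yukawa \<kappa> (of_real (norm p))"
  let ?L = "\<lambda>x. \<kappa>\<^sup>2 * \<phi> x - lap \<phi> x"
  define D where "D b p = E (fst b) (fst p)" for b p :: "(real^2) \<times> real"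
  define DD where "DD b p = EE (fst b) (fst p)" for b p :: "(real^2) \<times> real"
  define \<Phi> where "\<Phi> p = \<phi> (fst p)" for p :: "(real^2) \<times> real"
  have "(LINT p|lborel. ?g p * (\<kappa>\<^sup>2 * \<Phi> p - (\<Sum>b\<in>Basis. DD b p))) = \<Phi> 0"
  proof (rule yukawa_fundamental_3[OF dim_2_plus_1 \<kappa>, where \<phi> = \<Phi> and D = D and DD = DD and B = B])
    have cont_fst: "continuous_on UNIV (\<lambda>p::(real^2) \<times> real. f (fst p))" if "continuous_on UNIV f" for f :: "real^2 \<Rightarrow> complex"
      by (rule continuous_on_compose2[OF that]) (auto intro: continuous_intros)
    show "continuous_on UNIV \<Phi>"
      unfolding \<Phi>_def[abs_def] by (rule cont_fst[OF test_functionD(4)[OF \<phi>]])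
    show "cmod (\<Phi> p) \<le> B" for p unfolding \<Phi>_def by (rule B)
    fix b :: "(real^2) \<times> real" assume "b \<in> Basis"
    then have "(\<exists>i. fst b = axis i 1) \<or> fst b = 0"
      by (auto simp: Basis_prod_def Basis_vec_axis)
    then consider i where "fst b = axis i 1" | "fst b = 0" by blast
    note cases = this
    have DD_cases: "D b p = partial_deriv i \<phi> (fst p)" "DD b p = partial_deriv i (partial_deriv i \<phi>) (fst p)"
      if "fst b = axis i 1" for i p
      using that by (simp_all add: D_def DD_def E EE)
    have DD_0: "D b p = 0" "DD b p = 0" if "fst b = 0" for p
      using that by (simp_all add: D_def DD_def E0 EE0)
    show "continuous_on UNIV (D b)"
    proof (cases rule: cases)
      case (1 i)
      show ?thesis unfolding DD_cases(1)[OF 1, abs_def] by (rule cont_fst[OF test_functionD(4)[OF d[OF \<phi>]]])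
    next
      case 2
      show ?thesis unfolding DD_0(1)[OF 2, abs_def] by (rule continuous_on_const)
    qed
    show "continuous_on UNIV (DD b)"
    proof (cases rule: cases)
      case (1 i)
      show ?thesis unfolding DD_cases(2)[OF 1, abs_def] by (rule cont_fst[OF test_functionD(4)[OF d[OF d[OF \<phi>]]]])
    next
      case 2
      show ?thesis unfolding DD_0(2)[OF 2, abs_def] by (rule continuous_on_const)
    qed
    show "cmod (D b p) \<le> B" for p
      by (cases rule: cases) (simp_all add: DD_cases(1) DD_0(1) B B0)
    show "cmod (DD b p) \<le> B" for p
      by (cases rule: cases) (simp_all add: DD_cases(2) DD_0(2) B B0)
    show "((\<lambda>t. \<Phi> (p + t *\<^sub>R b)) has_vector_derivative D b (p + t *\<^sub>R b)) (at t)" for p t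
    proof (cases rule: cases)
      case (1 i)
      then show ?thesis
        using has_vector_derivative_partial_deriv[OF test_functionD(3)[OF \<phi>], of "fst p" i t]
        by (simp add: DD_cases(1) \<Phi>_def)
    qed (simp add: DD_0(1) \<Phi>_def)
    show "((\<lambda>t. D b (p + t *\<^sub>R b)) has_vector_derivative DD b (p + t *\<^sub>R b)) (at t)" for p t
    proof (cases rule: cases)
      case (1 i)
      then show ?thesis
        using has_vector_derivative_partial_deriv[OF test_functionD(3)[OF d[OF \<phi>]], of i "fst p" i t]
        by (simp add: DD_cases)
    qed (simp add: DD_0)
  qed
  moreover have "(\<Sum>b\<in>(Basis :: ((real^2) \<times> real) set). EE (fst b) x) = lap \<phi> x" for x
  proof -
    have "(\<Sum>b\<in>(Basis :: ((real^2) \<times> real) set). EE (fst b) x) = (\<Sum>b\<in>Basis. EE b x) + EE 0 x"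
      unfolding Basis_prod_def by (subst sum.union_disjoint) (auto simp: sum.reindex inj_on_def)
    then show ?thesis by (simp add: EE0 sum_Basis_vec EE lap_def)
  qed
  ultimately have full: "(LINT p|lborel. ?g p * ?L (fst p)) = \<phi> 0" by (simp add: DD_def \<Phi>_def)
  have [measurable]: "\<phi> \<in> borel_measurable borel" "lap \<phi> \<in> borel_measurable borel"
    using \<phi> by (auto intro: test_function_measurable test_function_lap)
  have L: "?L \<in> test_functions"
    using test_function_add[OF test_function_cmult[OF \<phi>, of "\<kappa>\<^sup>2"] test_function_cmult[OF test_function_lap[OF \<phi>], of "-1"]] by simp
  obtain B' where B': "\<And>x. cmod (?L x) \<le> B'" using test_function_bounded[OF L] by blast
  have int: "integrable (lborel \<Otimes>\<^sub>M lborel) (\<lambda>p. ?g p * ?L (fst p))"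
    by (rule integrable_mult_bounded[OF yukawa_integrable_prod(1)[OF \<kappa>] _ B']) measurable
  have "(LINT y|lborel. green_2 \<kappa> y * ?L y) = (LINT y|lborel. LINT t|lborel. ?g (y, t) * ?L (fst (y, t)))"
  proof (rule integral_cong_AE)
    show "AE y in lborel. green_2 \<kappa> y * ?L y = (LINT t|lborel. ?g (y, t) * ?L (fst (y, t)))"
      using green_2_AE[of \<kappa>] by eventually_elim simp
    show "(\<lambda>y. green_2 \<kappa> y * ?L y) \<in> borel_measurable lborel" by measurable
    show "(\<lambda>y. LINT t|lborel. ?g (y, t) * ?L (fst (y, t))) \<in> borel_measurable lborel"
      by (rule borel_measurable_integrable[OF lborel_pair.integrable_fst'[OF int]])
  qed
  also have "\<dots> = (LINT p|(lborel \<Otimes>\<^sub>M lborel). ?g p * ?L (fst p))"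
    by (rule lborel_pair.integral_fst'[OF int])
  also have "\<dots> = \<phi> 0" using full by (simp add: lborel_prod)
  finally show "(LINT y|lborel. green_2 \<kappa> y * (\<kappa>\<^sup>2 * \<phi> y - lap \<phi> y)) = \<phi> 0" .
qed

text \<open>Square integrability is inherited from the three-dimensional kernel: by the Cauchy-Schwarz
  inequality with weight \<open>exp \<bar>t\<bar>\<close>, the square of the line integral of \<open>exp (-\<rho>) / \<rho>\<close> is at most
  \<open>2 \<integral>exp (-\<rho>) / \<rho>\<^sup>2 dt\<close>.\<close>

lemma sq_integrable_green_2: "sq_integrable (green_2 1)"
  unfolding sq_integrable_def
proof
  let ?h = "\<lambda>p::(real^2) \<times> real. exp (- 1 * norm p) / (norm p)\<^sup>2"
  have ih: "integrable (lborel \<Otimes>\<^sub>M lborel) ?h"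
    unfolding lborel_prod by (rule integrable_exp_norm_over_square_3[OF dim_2_plus_1]) simp
  show "integrable lborel (\<lambda>x. (cmod (green_2 1 x))\<^sup>2)"
  proof (rule Bochner_Integration.integrable_bound)
    show "integrable lborel (\<lambda>x. 2 * (LINT t|lborel. ?h (x, t)))"
      using lborel_pair.integrable_fst'[OF ih] by simp
    show "AE x in lborel. norm ((cmod (green_2 1 x))\<^sup>2) \<le> norm (2 * (LINT t|lborel. ?h (x, t)))"
      using lborel_pair.AE_integrable_fst'[OF ih] lborel_pair.AE_integrable_fst'[OF yukawa_integrable_prod(1)[of 1, simplified]]
        AE_lborel_singleton[of "0::real^2"]
    proof eventually_elim
      case (elim x)
      define I where "I = cmod (green_2 1 x)"
      define H where "H = (LINT t|lborel. ?h (x, t))"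
      have H: "0 \<le> H" unfolding H_def by (intro integral_nonneg_AE) auto
      have key: "I \<le> (s * H + 2 / s) / 2" if s: "s > 0" for s
      proof -
        have e: "integrable lborel (\<lambda>t. exp (- 1 * \<bar>t\<bar>) :: real)" "(LINT t|lborel. exp (- 1 * \<bar>t\<bar>) :: real) = 2"
          using has_bochner_integral_exp_abs[of 1] by (auto simp: has_bochner_integral_iff)
        have le: "cmod (yukawa 1 (of_real (norm (x, t)))) \<le> (s * ?h (x, t) + exp (- 1 * \<bar>t\<bar>) / s) / 2" for t
        proof -
          let ?\<rho> = "norm (x, t)"
          have \<rho>: "?\<rho> > 0" using elim(3) by (simp add: zero_prod_def)
          have t: "\<bar>t\<bar> \<le> ?\<rho>" using norm_snd_le[of t x] by simp
          define A where "A = exp (- ?\<rho>) / ?\<rho>"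
          have A: "A \<ge> 0" using \<rho> by (simp add: A_def)
          have AA: "A * A * exp \<bar>t\<bar> \<le> ?h (x, t)"
          proof -
            have "A * A * exp \<bar>t\<bar> = exp (- ?\<rho> + - ?\<rho> + \<bar>t\<bar>) / ?\<rho>\<^sup>2"
              unfolding exp_add A_def by (simp add: power2_eq_square)
            also have "\<dots> \<le> exp (- 1 * ?\<rho>) / ?\<rho>\<^sup>2"
              using t by (intro divide_right_mono) auto
            finally show ?thesis .
          qed
          have "0 \<le> (s * A * exp \<bar>t\<bar> - 1)\<^sup>2 * (exp (- \<bar>t\<bar>) / s)" using s by simp
          also have "\<dots> = s * (A * A * (exp \<bar>t\<bar> * (exp \<bar>t\<bar> * exp (- \<bar>t\<bar>)))) - 2 * A * (exp \<bar>t\<bar> * exp (- \<bar>t\<bar>)) + exp (- \<bar>t\<bar>) / s"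
            using s by (simp add: power2_eq_square field_simps)
          also have "exp \<bar>t\<bar> * exp (- \<bar>t\<bar>) = 1" by (simp flip: exp_add)
          finally have "2 * A \<le> s * (A * A * exp \<bar>t\<bar>) + exp (- \<bar>t\<bar>) / s" by simp
          also have "\<dots> \<le> s * ?h (x, t) + exp (- \<bar>t\<bar>) / s"
            using AA s by (intro add_right_mono mult_left_mono) auto
          finally have "A \<le> (s * ?h (x, t) + exp (- 1 * \<bar>t\<bar>) / s) / 2" by simp
          moreover have "cmod (yukawa 1 (of_real ?\<rho>)) \<le> A"
          proof -
            have "1 / (4 * pi) \<le> 1" using pi_gt3 by simp
            from mult_left_mono[OF this A] show ?thesis
              unfolding norm_yukawa_norm by (simp add: A_def)
          qed
          ultimately show ?thesis by linarith
        qed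
        have green: "green_2 1 x = (LINT t|lborel. yukawa 1 (of_real (norm (x, t :: real))))"
          using elim(3) by (simp add: green_2_def)
        have "I \<le> (LINT t|lborel. (s * ?h (x, t) + exp (- 1 * \<bar>t\<bar>) / s) / 2)"
          unfolding I_def green
        proof (rule Bochner_Integration.integral_norm_bound_integral)
          show "integrable lborel (\<lambda>t::real. yukawa 1 (of_real (norm (x, t))))" by (rule elim(2))
          show "integrable lborel (\<lambda>t. (s * ?h (x, t) + exp (- 1 * \<bar>t\<bar>) / s) / 2)"
            using elim(1) e(1) by (intro integrable_divide Bochner_Integration.integrable_add integrable_mult_right) auto
        qed (rule le)
        also have "\<dots> = ((LINT t|lborel. s * ?h (x, t)) + (LINT t|lborel. exp (- 1 * \<bar>t\<bar>) / s)) / 2"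
        proof -
          have "integrable lborel (\<lambda>t. s * ?h (x, t))" by (intro integrable_mult_right elim(1))
          moreover have "integrable lborel (\<lambda>t. exp (- 1 * \<bar>t\<bar>) / s)" by (intro integrable_divide e(1))
          ultimately show ?thesis by (simp only: integral_divide_zero Bochner_Integration.integral_add)
        qed
        also have "\<dots> = (s * H + 2 / s) / 2"
          by (simp only: integral_mult_right_zero integral_divide_zero e(2) H_def)
        finally show ?thesis .
      qed
      have "I\<^sup>2 \<le> 2 * H"
      proof (cases "I > 0")
        case True
        then have "I \<le> (2 / I * H + I) / 2" using key[of "2 / I"] by simp
        then show ?thesis using True by (simp add: field_simps power2_eq_square)
      next
        case False
        then have "I = 0" by (simp add: I_def)
        then show ?thesis using H by simp
      qed
      then show ?case using H by (simp add: I_def H_def)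
    qed
  qed measurable
qed measurable

text \<open>As \<open>Re \<kappa> \<rightarrow> 0\<close> the tail of the line integral converges only conditionally. Since
  \<open>exp (-\<kappa> \<rho>) / \<rho> dt = exp (-\<kappa> \<rho>) / t d\<rho>\<close>, integration by parts against \<open>1/t\<close> gives a bound that is uniform in
  \<open>Re \<kappa>\<close>.\<close>

lemma yukawa_line_tail_bound:
  fixes x :: "'a::real_normed_vector"
  assumes \<kappa>: "Re \<kappa> > 0" and x: "x \<noteq> 0" and a: "0 < a" "a \<le> N"
  shows "cmod (integral {a..N} (\<lambda>t. yukawa \<kappa> (of_real (norm (x, t))))) \<le> 2 / (4 * pi * cmod \<kappa> * a)"
proof -
  have \<kappa>0: "\<kappa> \<noteq> 0" using \<kappa> by auto
  define \<rho> where "\<rho> t = sqrt ((norm x)\<^sup>2 + t\<^sup>2)" for t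
  have \<rho>: "norm (x, t) = \<rho> t" for t by (simp add: norm_Pair \<rho>_def)
  have pos: "0 < (norm x)\<^sup>2 + t\<^sup>2" for t using x by (simp add: add_pos_nonneg)
  then have \<rho>0: "\<rho> t > 0" for t by (simp add: \<rho>_def)
  have d\<rho>: "(\<rho> has_real_derivative t / \<rho> t) (at t)" for t
  proof -
    have "((\<lambda>t. (norm x)\<^sup>2 + t\<^sup>2) has_real_derivative 2 * t) (at t)" by (auto intro!: derivative_eq_intros)
    from DERIV_chain2[OF DERIV_real_sqrt[OF pos] this] show ?thesis
      by (simp add: \<rho>_def[abs_def] field_simps)
  qed
  define e where "e t = exp (- \<kappa> * of_real (\<rho> t))" for t
  have e1: "cmod (e t) \<le> 1" for t using \<kappa> \<rho>0[of t] by (simp add: e_def)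
  have de: "(e has_vector_derivative - \<kappa> * of_real (t / \<rho> t) * e t) (at t)" for t
  proof -
    have 1: "((\<lambda>t. complex_of_real (\<rho> t)) has_vector_derivative of_real (t / \<rho> t)) (at t)"
      by (rule has_vector_derivative_of_real[OF d\<rho>])
    have 2: "((\<lambda>w. exp (- \<kappa> * w)) has_field_derivative - \<kappa> * exp (- \<kappa> * of_real (\<rho> t))) (at (of_real (\<rho> t)))"
      by (auto intro!: derivative_eq_intros)
    from field_vector_diff_chain_at[OF 1 2] show ?thesis
      by (simp add: o_def e_def[abs_def] ac_simps)
  qed
  define T where "T t = (- 1 / (4 * of_real pi * \<kappa>)) * (e t * of_real (inverse t))" for t
  define S where "S t = e t / (4 * of_real pi * \<kappa> * (of_real t)\<^sup>2)" for t
  have ce: "continuous_on A e" for A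
    unfolding e_def[abs_def] \<rho>_def by (intro continuous_intros)
  have cS: "continuous_on {a..N} S"
    unfolding S_def[abs_def] using a \<kappa>0 by (intro continuous_intros ce) auto
  have dT: "(T has_vector_derivative yukawa \<kappa> (of_real (norm (x, t))) + S t) (at t)" if t: "t > 0" for t
  proof -
    have inv: "((\<lambda>t. complex_of_real (inverse t)) has_vector_derivative of_real (- (inverse t ^ 2))) (at t)"
      by (rule has_vector_derivative_of_real) (use t in \<open>auto intro!: derivative_eq_intros simp: power2_eq_square\<close>)
    have "(T has_vector_derivative
        (- 1 / (4 * of_real pi * \<kappa>)) * (e t * of_real (- (inverse t ^ 2)) + (- \<kappa> * of_real (t / \<rho> t) * e t) * of_real (inverse t))) (at t)"
      unfolding T_def[abs_def] by (intro has_vector_derivative_mult_right has_vector_derivative_mult de inv)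
    moreover have "(- 1 / (4 * of_real pi * \<kappa>)) * (e t * of_real (- (inverse t ^ 2)) + (- \<kappa> * of_real (t / \<rho> t) * e t) * of_real (inverse t))
        = yukawa \<kappa> (of_real (norm (x, t))) + S t"
    proof -
      have alg: "(- 1 / (4 * P * \<kappa>)) * (E * (- (inverse u ^ 2)) + (- \<kappa> * (u / R) * E) * inverse u) = E / (4 * P * R) + E / (4 * P * \<kappa> * u\<^sup>2)"
        if "P \<noteq> 0" "R \<noteq> 0" "u \<noteq> 0" for P R u E :: complex
        using that \<kappa>0 by (simp add: field_simps power2_eq_square)
      have "yukawa \<kappa> (of_real (norm (x, t))) + S t = e t / (4 * of_real pi * of_real (\<rho> t)) + e t / (4 * of_real pi * \<kappa> * (of_real t)\<^sup>2)"
        by (simp add: yukawa_def S_def e_def \<rho>)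
      also have "\<dots> = (- 1 / (4 * of_real pi * \<kappa>)) * (e t * (- (inverse (of_real t) ^ 2)) + (- \<kappa> * (of_real t / of_real (\<rho> t)) * e t) * inverse (of_real t))"
        using t \<rho>0[of t] by (intro alg[symmetric]) auto
      finally show ?thesis by simp
    qed
    ultimately show ?thesis by simp
  qed
  have "((\<lambda>t. yukawa \<kappa> (of_real (norm (x, t))) + S t) has_integral T N - T a) {a..N}"
  proof (rule fundamental_theorem_of_calculus[OF a(2)])
    fix t assume "t \<in> {a..N}"
    then have "t > 0" using a by simp
    then show "(T has_vector_derivative yukawa \<kappa> (of_real (norm (x, t))) + S t) (at t within {a..N})"
      by (rule has_vector_derivative_at_within[OF dT])
  qed
  from has_integral_diff[OF this integrable_integral[OF integrable_continuous_real[OF cS]]]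
  have eq: "integral {a..N} (\<lambda>t. yukawa \<kappa> (of_real (norm (x, t)))) = T N - T a - integral {a..N} S"
    by (simp add: integral_unique)
  let ?c = "4 * pi * cmod \<kappa>"
  have c: "?c > 0" using \<kappa>0 by simp
  have Tle: "cmod (T t) \<le> 1 / (?c * t)" if "t > 0" for t
  proof -
    have "cmod (T t) = (1 / ?c) * (cmod (e t) * inverse t)"
      using that by (simp add: T_def norm_mult norm_divide norm_inverse)
    also have "\<dots> \<le> (1 / ?c) * (1 * inverse t)"
      using e1[of t] c that by (intro mult_left_mono mult_right_mono) auto
    also have "\<dots> = 1 / (?c * t)" by (simp add: inverse_eq_divide)
    finally show ?thesis .
  qed
  have "cmod (integral {a..N} S) \<le> integral {a..N} (\<lambda>t. (1 / ?c) * (inverse t)\<^sup>2)"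
  proof (rule Henstock_Kurzweil_Integration.integral_norm_bound_integral)
    show "S integrable_on {a..N}" by (rule integrable_continuous_real[OF cS])
    show "(\<lambda>t. (1 / ?c) * (inverse t)\<^sup>2) integrable_on {a..N}"
      using a by (intro integrable_continuous_real continuous_intros) auto
    show "cmod (S t) \<le> (1 / ?c) * (inverse t)\<^sup>2" if "t \<in> {a..N}" for t
    proof -
      have "cmod (S t) = (1 / ?c) * (cmod (e t) * (inverse t)\<^sup>2)"
        by (simp add: S_def norm_mult norm_divide norm_power inverse_eq_divide power_divide)
      also have "\<dots> \<le> (1 / ?c) * (1 * (inverse t)\<^sup>2)"
        using e1[of t] c by (intro mult_left_mono mult_right_mono) auto
      finally show ?thesis by simp
    qed
  qed
  also have "\<dots> = - (1 / ?c) * inverse N - - (1 / ?c) * inverse a"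
  proof (rule integral_unique, rule fundamental_theorem_of_calculus[OF a(2)])
    fix t assume "t \<in> {a..N}"
    then have t: "t \<noteq> 0" using a by auto
    have "((\<lambda>t. - (1 / ?c) * inverse t) has_real_derivative - (1 / ?c) * (- (inverse t ^ Suc (Suc 0)))) (at t)"
      by (rule DERIV_cmult[OF DERIV_inverse[OF t]])
    then have "((\<lambda>t. - (1 / ?c) * inverse t) has_vector_derivative (1 / ?c) * (inverse t)\<^sup>2) (at t)"
      unfolding has_real_derivative_iff_has_vector_derivative by (simp add: power2_eq_square)
    then show "((\<lambda>t. - (1 / ?c) * inverse t) has_vector_derivative (1 / ?c) * (inverse t)\<^sup>2) (at t within {a..N})"
      by (rule has_vector_derivative_at_within)
  qed
  also have "\<dots> = 1 / (?c * a) - 1 / (?c * N)" by (simp add: inverse_eq_divide)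
  finally have Sle: "cmod (integral {a..N} S) \<le> 1 / (?c * a) - 1 / (?c * N)" .
  have "cmod (T N - T a - integral {a..N} S) \<le> cmod (T N) + cmod (T a) + cmod (integral {a..N} S)"
    using norm_triangle_ineq4[of "T N - T a" "integral {a..N} S"] norm_triangle_ineq4[of "T N" "T a"] by linarith
  also have "\<dots> \<le> 1 / (?c * N) + 1 / (?c * a) + (1 / (?c * a) - 1 / (?c * N))"
    using Tle[of N] Tle[of a] Sle a by linarith
  also have "\<dots> = 2 / (?c * a)" by simp
  finally show ?thesis unfolding eq by simp
qed

text \<open>Near the centre of the line the singularities of the two kernels cancel; on the tails each kernel is
  estimated separately. The bound \<open>1\<close> is not sharp.\<close>

lemma green_2_diff_bound:
  assumes k: "Re k > 0" "Im k > 0"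
  shows "cmod (green_2 (- \<i> * k) x - green_2 k x) \<le> 1"
proof (cases "x = 0")
  case True
  then show ?thesis by (simp add: green_2_def)
next
  case False
  define K where "K = cmod k"
  have K: "K > 0" using k by (auto simp: K_def)
  let ?Y = "\<lambda>\<kappa> (t::real). yukawa \<kappa> (of_real (norm (x, t)))"
  define f where "f t = ?Y (- \<i> * k) t - ?Y k t" for t
  have nz: "norm (x, t) \<noteq> 0" for t :: real using False by (simp add: zero_prod_def)
  have cY: "continuous_on A (?Y \<kappa>)" for A \<kappa>
    unfolding yukawa_def using nz by (auto intro!: continuous_intros)
  have cf: "continuous_on A f" for A unfolding f_def[abs_def] by (intro continuous_intros cY)
  have iY: "integrable lborel (?Y \<kappa>)" if "Re \<kappa> > 0" for \<kappa>
  proof (rule integrable_dominated)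
    show "integrable lborel (\<lambda>t. exp (- Re \<kappa> * \<bar>t\<bar>) * (1 / (4 * pi * norm x)))"
      using has_bochner_integral_exp_abs[OF that] by (intro integrable_mult_left) (simp add: has_bochner_integral_iff)
    show "?Y \<kappa> \<in> borel_measurable lborel"
      using borel_measurable_continuous_onI[OF cY] by simp
    have "cmod (?Y \<kappa> t) \<le> exp (- Re \<kappa> * \<bar>t\<bar>) * (1 / (4 * pi * norm x))" for t
    proof -
      have "\<bar>t\<bar> \<le> norm (x, t)" "norm x \<le> norm (x, t)"
        using norm_snd_le[of t x] norm_fst_le[of x t] by auto
      then have "exp (- Re \<kappa> * norm (x, t)) / norm (x, t) \<le> exp (- Re \<kappa> * \<bar>t\<bar>) / norm x"
        using False that by (intro frac_le) auto
      from mult_right_mono[OF this, of "1 / (4 * pi)"] show ?thesis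
        unfolding norm_yukawa_norm by (simp add: ac_simps)
    qed
    then show "cmod (?Y \<kappa> t) \<le> exp (- Re \<kappa> * \<bar>t\<bar>) * (1 / (4 * pi * norm x))" for t .
  qed
  have ii: "integrable lborel (?Y (- \<i> * k))" "integrable lborel (?Y k)" using k by (auto intro!: iY)
  then have if': "integrable lborel f" unfolding f_def by simp
  have eq: "green_2 (- \<i> * k) x - green_2 k x = (LINT t|lborel. f t)"
    using False ii by (simp add: green_2_def f_def)
  \<comment> \<open>At this distance the bound of the near part and the bound of the tails are both of order one.\<close>
  define a where "a = 1 / K"
  have a: "a > 0" using K by (simp add: a_def)
  have half: "cmod (integral {0..N} f) \<le> 6 / (4 * pi)" if N: "a \<le> N" for N
  proof -
    have "cmod (integral {0..a} f) \<le> sqrt 2 * K / (4 * pi) * (a - 0)"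
    proof (rule integral_bound)
      show "cmod (f t) \<le> sqrt 2 * K / (4 * pi)" for t
        unfolding f_def K_def by (rule yukawa_diff_bound_3[OF k])
    qed (use a cf in auto)
    also have "sqrt 2 * K / (4 * pi) * (a - 0) = sqrt 2 / (4 * pi)"
      using K by (simp add: a_def)
    also have "\<dots> \<le> 2 / (4 * pi)"
      using sqrt2_less_2 by (intro divide_right_mono) auto
    finally have 1: "cmod (integral {0..a} f) \<le> 2 / (4 * pi)" .
    have tail: "cmod (integral {a..N} (?Y \<kappa>)) \<le> 2 / (4 * pi)" if "Re \<kappa> > 0" "cmod \<kappa> = K" for \<kappa>
      using yukawa_line_tail_bound[OF that(1) False a N] K that(2) by (simp add: a_def)
    have "integral {a..N} f = integral {a..N} (?Y (- \<i> * k)) - integral {a..N} (?Y k)"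
      unfolding f_def[abs_def] by (intro Henstock_Kurzweil_Integration.integral_diff integrable_continuous_real cY)
    then have 2: "cmod (integral {a..N} f) \<le> 2 / (4 * pi) + 2 / (4 * pi)"
      using norm_triangle_ineq4[of "integral {a..N} (?Y (- \<i> * k))" "integral {a..N} (?Y k)"]
        tail[of "- \<i> * k"] tail[of k] k by (simp add: K_def norm_mult)
    have "integral {0..N} f = integral {0..a} f + integral {a..N} f"
      using a N by (intro Henstock_Kurzweil_Integration.integral_combine[symmetric] integrable_continuous_real cf) auto
    then have "cmod (integral {0..N} f) \<le> cmod (integral {0..a} f) + cmod (integral {a..N} f)"
      by (simp add: norm_triangle_ineq)
    also have "\<dots> \<le> 2 / (4 * pi) + (2 / (4 * pi) + 2 / (4 * pi))" using 1 2 by linarith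
    finally show ?thesis by simp
  qed
  have whole: "cmod (integral {-N..N} f) \<le> 1" if N: "a \<le> N" for N
  proof -
    have "integral {-N..-0} (\<lambda>t. f (- t)) = integral {0..N} f" by (rule Henstock_Kurzweil_Integration.integral_reflect_real)
    moreover have "(\<lambda>t. f (- t)) = f" by (auto simp: f_def norm_Pair)
    ultimately have "integral {-N..0} f = integral {0..N} f" by simp
    moreover have "integral {-N..N} f = integral {-N..0} f + integral {0..N} f"
      using a N by (intro Henstock_Kurzweil_Integration.integral_combine[symmetric] integrable_continuous_real cf) auto
    ultimately have "cmod (integral {-N..N} f) \<le> cmod (integral {0..N} f) + cmod (integral {0..N} f)"
      by (simp add: norm_triangle_ineq)
    also have "\<dots> \<le> 12 / (4 * pi)" using half[OF N] by simp
    also have "\<dots> \<le> 1" using pi_gt3 by simp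
    finally show ?thesis .
  qed
  have "(\<lambda>n. LINT t|lborel. indicator {- real n..real n} t *\<^sub>R f t) \<longlonglongrightarrow> (LINT t|lborel. f t)"
  proof (rule integral_dominated_convergence)
    show "integrable lborel (\<lambda>t. cmod (f t))" using if' by (rule integrable_norm)
    show "f \<in> borel_measurable lborel" using if' by (rule borel_measurable_integrable)
    then show "(\<lambda>t. indicator {- real n..real n} t *\<^sub>R f t) \<in> borel_measurable lborel" for n by measurable
    show "AE t in lborel. (\<lambda>n. indicator {- real n..real n} t *\<^sub>R f t) \<longlonglongrightarrow> f t"
    proof (intro AE_I2 tendsto_eventually)
      fix t :: real
      obtain m :: nat where "\<bar>t\<bar> \<le> real m" using real_arch_simple by blast
      then show "\<forall>\<^sub>F n in sequentially. indicator {- real n..real n} t *\<^sub>R f t = f t"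
        by (intro eventually_sequentiallyI[of m]) (auto simp: indicator_def)
    qed
    show "AE t in lborel. cmod (indicator {- real n..real n} t *\<^sub>R f t) \<le> cmod (f t)" for n
      by (auto simp: indicator_def)
  qed
  moreover have "(LINT t|lborel. indicator {- real n..real n} t *\<^sub>R f t) = integral {- real n..real n} f" for n
    using set_borel_integral_eq_integral(2)[of "{- real n..real n}" f] borel_integrable_atLeastAtMost'[OF cf]
    by (simp add: set_lebesgue_integral_def)
  ultimately have lim: "(\<lambda>n. integral {- real n..real n} f) \<longlonglongrightarrow> (LINT t|lborel. f t)" by simp
  obtain m :: nat where m: "a \<le> real m" using real_arch_simple by blast
  have "\<forall>\<^sub>F n in sequentially. cmod (integral {- real n..real n} f) \<le> 1"
    using m by (intro eventually_sequentiallyI[of m] whole) auto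
  then show ?thesis
    unfolding eq by (intro tendsto_upperbound[OF tendsto_norm[OF lim]]) auto
qed

lemma eigenvalue_bound_2:
  fixes V :: "real^2 \<Rightarrow> complex"
  assumes V: "integrable lebesgue V" and z: "z \<in> point_spectrum V" "cmod z = r ^ 4" "r > 0"
  shows "1 \<le> 1 / (2 * r\<^sup>2) * L1_norm V"
proof (rule eigenvalue_bound_of_kernels[OF V z, where g = green_2])
  show "1 / (2 * r\<^sup>2) > 0" using z by simp
  show "cmod (green_2 (- \<i> * k) x - green_2 k x) \<le> 2 * (1 / (2 * r\<^sup>2)) * (cmod k)\<^sup>2"
    if k: "Re k > 0" "Im k > 0" "cmod k \<ge> r" for k x
  proof -
    have "r\<^sup>2 \<le> (cmod k)\<^sup>2" using k(3) z by (intro power_mono) auto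
    then have "1 \<le> 2 * (1 / (2 * r\<^sup>2)) * (cmod k)\<^sup>2" using z by simp
    with green_2_diff_bound[OF k(1,2), of x] show ?thesis by linarith
  qed
qed (use fundamental_solution_green_2 green_2_L1(2) sq_integrable_green_2 in auto)

section \<open>The eigenvalue bounds\<close>

theorem theorem1:
  "\<exists>C :: nat \<Rightarrow> real.
     (\<forall>d\<in>{1, 2, 3}. C d > 0) \<and>
     C 1 = 1 / 4 \<and> C 3 = 1 / 4 * (1 / (4 * pi) ^ 4) \<and>
     (\<forall>V :: real ^ 1 \<Rightarrow> complex. integrable lebesgue V \<longrightarrow>
        point_spectrum V \<subseteq> {z. cmod z \<le> C 1 * L1_norm V powr (4 / (4 - 1))}) \<and>
     (\<forall>V :: real ^ 2 \<Rightarrow> complex. integrable lebesgue V \<longrightarrow>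
        point_spectrum V \<subseteq> {z. cmod z \<le> C 2 * L1_norm V powr (4 / (4 - 2))}) \<and>
     (\<forall>V :: real ^ 3 \<Rightarrow> complex. integrable lebesgue V \<longrightarrow>
        point_spectrum V \<subseteq> {z. cmod z \<le> C 3 * L1_norm V powr (4 / (4 - 3))})"
proof -
  \<comment> \<open>the value \<open>1 / 4\<close> at \<open>2\<close> comes from the bound \<open>1\<close> on the difference of the planar kernels\<close>
  define C :: "nat \<Rightarrow> real" where "C d = (if d = 3 then 1 / 4 * (1 / (4 * pi) ^ 4) else 1 / 4)" for d
  have root: "\<exists>r>0. cmod z = r ^ 4" if "z \<noteq> 0" for z
    using that by (intro exI[of _ "root 4 (cmod z)"]) auto
  have "cmod z \<le> C 1 * L1_norm V powr (4 / (4 - 1))"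
    if V: "integrable lebesgue V" and z: "z \<in> point_spectrum V" for V :: "real ^ 1 \<Rightarrow> complex" and z
  proof (cases "z = 0")
    case False
    then obtain r where r: "r > 0" "cmod z = r ^ 4" using root by blast
    have "1 \<le> sqrt 2 / (4 * r ^ 3) * L1_norm V" by (rule eigenvalue_bound_1[OF V z r(2,1)])
    then have "4 * r ^ 3 \<le> L1_norm V * sqrt 2"
      using r(1) by (simp add: field_simps)
    then have "4 * r ^ 3 * sqrt 2 \<le> L1_norm V * sqrt 2 * sqrt 2" by (rule mult_right_mono) simp
    also have "\<dots> = 2 * L1_norm V" by (simp add: mult.assoc)
    finally have "2 * sqrt 2 * r ^ 3 \<le> L1_norm V" by (simp add: mult.commute mult.left_commute)
    then have "(2 * sqrt 2 * r ^ 3) powr (4 / 3) \<le> L1_norm V powr (4 / 3)"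
      using r(1) by (intro powr_mono2) auto
    moreover have "(2 * sqrt 2 * r ^ 3) powr (4 / 3) = 4 * r ^ 4"
    proof -
      have "2 * sqrt 2 * r ^ 3 = (sqrt 2 * r) powr 3"
        using r(1) by (simp add: powr_numeral power_mult_distrib power3_eq_cube)
      then have "(2 * sqrt 2 * r ^ 3) powr (4 / 3) = (sqrt 2 * r) powr 4"
        by (simp add: powr_powr)
      also have "\<dots> = 4 * r ^ 4"
        using r(1) by (simp add: powr_numeral power_mult_distrib power4_eq_xxxx)
      finally show ?thesis .
    qed
    ultimately show ?thesis using r(2) by (simp add: C_def)
  qed (simp add: C_def)
  moreover have "cmod z \<le> C 2 * L1_norm V powr (4 / (4 - 2))"
    if V: "integrable lebesgue V" and z: "z \<in> point_spectrum V" for V :: "real ^ 2 \<Rightarrow> complex" and z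
  proof (cases "z = 0")
    case False
    then obtain r where r: "r > 0" "cmod z = r ^ 4" using root by blast
    have "1 \<le> 1 / (2 * r\<^sup>2) * L1_norm V" by (rule eigenvalue_bound_2[OF V z r(2,1)])
    then have le: "2 * r\<^sup>2 \<le> L1_norm V" using r(1) by (simp add: field_simps)
    then have "(2 * r\<^sup>2)\<^sup>2 \<le> (L1_norm V)\<^sup>2" by (intro power_mono) auto
    moreover have "L1_norm V > 0"
    proof -
      have "0 < 2 * r\<^sup>2" using r(1) by simp
      with le show ?thesis by linarith
    qed
    ultimately show ?thesis using r(2) by (simp add: C_def powr_numeral power_mult_distrib)
  qed (simp add: C_def)
  moreover have "cmod z \<le> C 3 * L1_norm V powr (4 / (4 - 3))"
    if V: "integrable lebesgue V" and z: "z \<in> point_spectrum V" for V :: "real ^ 3 \<Rightarrow> complex" and z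
  proof (cases "z = 0")
    case False
    then obtain r where r: "r > 0" "cmod z = r ^ 4" using root by blast
    have "1 \<le> sqrt 2 / (8 * pi * r) * L1_norm V" by (rule eigenvalue_bound_3[OF V z r(2,1)])
    then have "8 * pi * r \<le> sqrt 2 * L1_norm V" using r(1) by (simp add: field_simps)
    then have "(8 * pi * r) ^ 4 \<le> (sqrt 2 * L1_norm V) ^ 4" using r(1) by (intro power_mono) auto
    moreover have "sqrt 2 ^ 4 = (4 :: real)" by (simp add: power4_eq_xxxx)
    ultimately have le: "(8 * pi) ^ 4 * r ^ 4 \<le> 4 * L1_norm V ^ 4" by (simp add: power_mult_distrib)
    have "L1_norm V > 0"
    proof -
      have "8 * pi * r > 0" using r(1) by simp
      then have "sqrt 2 * L1_norm V > 0" using \<open>8 * pi * r \<le> sqrt 2 * L1_norm V\<close> by linarith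
      then show ?thesis by (simp add: zero_less_mult_iff)
    qed
    then show ?thesis using le r(2) by (simp add: C_def powr_numeral power_mult_distrib field_simps)
  qed (simp add: C_def)
  moreover have "C 1 = 1 / 4" "C 3 = 1 / 4 * (1 / (4 * pi) ^ 4)" "\<forall>d\<in>{1, 2, 3}. C d > 0"
    by (auto simp: C_def)
  ultimately show ?thesis by (intro exI[of _ C]) auto
qed

end
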